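(* Let $(X,\omega,J)$ be a Kähler manifold and $\iota:Y\hookrightarrow X$ any coisotropic submanifold, with null foliation $\mathcal F$. Let $K=(K^i_j)$ be the curvature two-form and let $\sqrt{-1}\,\rho=\sum_j K^j_j$, where $\rho$ is the Ricci form of the metric. Then $$-\,\mathrm{curv}(K_Y)=-\,\mathrm{curv}(\det\mathcal E^{1,0})+\sqrt{-1}\,\iota^*\rho ,$$ $$-\,{}^{E}\mathrm{curv}(K_Y)=\sqrt{-1}\,d_{\mathcal F}(\alpha_Y^{\parallel})+\sqrt{-1}\,\iota_{\mathcal F}^*\rho ,$$ where $\iota^*_{\mathcal F}\rho$ is the restriction of $\rho$ to $T\mathcal F=(TY)^\omega\subset TY$. Equivalently, $$-\,\mathrm{curv}(K_Y)+\mathrm{curv}(\det\mathcal E^{1,0})=\sqrt{-1}\,\iota^*\rho,\qquad -\,{}^{E}\mathrm{curv}(K_Y)-\sqrt{-1}\,d_{\mathcal F}(\alpha_Y^{\parallel})=\sqrt{-1}\,\iota^*_{\mathcal F}\rho .$$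
   Context: $(X,\omega,J)$ is Kähler of real dimension $2n$, $g=\omega(\cdot,J\cdot)$, $\nabla$ its Levi-Civita connection. $Y\subset X$ is coisotropic: $(TY)^\omega\subset TY$, where $(TY)^\omega$ is the $\omega$-orthogonal complement; $\dim Y=n+k$, $\operatorname{rank}(TY)^\omega=n-k$. $E=T\mathcal F:=(TY)^\omega$ is integrable, tangent to the null foliation $\mathcal F$. Indices: $i,j$ run over $1,\dots,n$; $a,b$ over $1,\dots,k$; $\alpha,\beta$ over $k+1,\dots,n$; repeated indices are summed. Adapted frame: a local orthonormal frame $\{e_1,\dots,e_n,f_1,\dots,f_n\}$ of $TX$ along $Y$, $f_j=Je_j$, such that $e_1,\dots,e_n,f_1,\dots,f_k$ span $TY$ and $e_{k+1},\dots,e_n$ span $T\mathcal F$. Put $u_j=\frac12(e_j-\sqrt{-1}f_j)$ and $\theta^j=e_j^*+\sqrt{-1}f_j^*$. Connection forms $\omega^i_j$: $\nabla u_j=\omega^i_j\otimes u_i$; then $d\theta^j=-\omega^j_i\wedge\theta^i$ and $d\omega^i_j=-\omega^i_l\wedge\omega^l_j+K^i_j$. $\mathcal E=T\mathcal F\oplus J(T\mathcal F)\subset TX|_Y$ (here $J(T\mathcal F)$ is the normal bundle of $Y$); $\mathcal E^{1,0}$ is the $(1,0)$ part of $\mathcal E\otimes\mathbb C$. The line bundle $\det\mathcal E^{1,0}$, with local frame $u_{k+1}\wedge\cdots\wedge u_n$, has the connection induced from $\nabla$, $\nabla(u_{k+1}\wedge\cdots\wedge u_n)=\iota^*(\omega^\alpha_\alpha)\,u_{k+1}\wedge\cdots\wedge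 u_n$. The transverse canonical bundle is $K_Y=\det\big((N^*\mathcal F)^{1,0}\big)$, where $N^*\mathcal F\subset T^*X|_Y$ is the annihilator of $T\mathcal F\oplus J(T\mathcal F)$; it has local frame $\theta^1\wedge\cdots\wedge\theta^k$ and induced connection $\nabla(\theta^1\wedge\cdots\wedge\theta^k)=-\iota^*(\omega^a_a)\,\theta^1\wedge\cdots\wedge\theta^k$. $\mathrm{curv}$ denotes the curvature two-form on $Y$ of these connections. $d_{\mathcal F}$ is the exterior derivative along the leaves of $\mathcal F$ (on sections of $\Lambda^\bullet T^*\mathcal F$), $\iota_{\mathcal F}^*$ is restriction of forms to $T\mathcal F$, and ${}^E\mathrm{curv}$ is the leafwise curvature, i.e. the curvature of the restriction of the connection to directions in $E=T\mathcal F$; so ${}^E\mathrm{curv}(K_Y)=-d_{\mathcal F}(\iota^*_{\mathcal F}\omega^a_a)$. With $S$ the second fundamental form of $Y\subset(X,g)$ (normal-bundle valued), the leafwise mean curvature vector is $\vec H^{\parallel}=\sum_\beta S(e_\beta,e_\beta)$ and the leafwise mean curvature one-form is $\alpha_Y^{\parallel}=(\vec H^{\parallel}\rfloor\omega)|_{TY}$ (regarded as a section of $T^*\mathcal F$ when $d_{\mathcal F}$ is applied). *)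

theory Defs
  imports "HOL-Analysis.Analysis"
begin

section \<open>Smooth manifolds\<close>

text \<open>Smoothness is used on open sets only, where \<open>at x\<close> and \<open>at x within S\<close> agree.\<close>

primrec Ck_on :: "nat \<Rightarrow> 'a::real_normed_vector set \<Rightarrow> ('a \<Rightarrow> 'b::real_normed_vector) \<Rightarrow> bool" where
  "Ck_on 0 S f \<longleftrightarrow> continuous_on S f"
| "Ck_on (Suc m) S f \<longleftrightarrow> (\<forall>x\<in>S. f differentiable (at x)) \<and>
     (\<forall>v. Ck_on m S (\<lambda>x. frechet_derivative f (at x) v))"

definition smooth_on :: "'a::real_normed_vector set \<Rightarrow> ('a \<Rightarrow> 'b::real_normed_vector) \<Rightarrow> bool" where
  "smooth_on S f \<longleftrightarrow> (\<forall>m. Ck_on m S f)"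

text \<open>
  The points of a manifold are all elements of a (Hausdorff, second countable) topological type
  \<open>'x\<close>, and an atlas is indexed by the points: \<open>A p\<close> is a chart (domain, coordinate map) around
  \<open>p\<close>. The tangent space at \<open>p\<close> is the model space \<open>'e\<close>, a vector being identified with its
  coordinates in the chart \<open>A p\<close>. So a vector field is a map \<open>'x \<Rightarrow> 'e\<close> and a tensor field of
  type (0,2) is a map \<open>'x \<Rightarrow> 'e \<Rightarrow> 'e \<Rightarrow> real\<close>. Differentiation always takes place after
  passing to the coordinates of one fixed chart \<open>A q\<close>, by means of \<open>to_chart A q p\<close> and its inverse
  \<open>from_chart A q p\<close> (for \<open>p\<close> in the domain of \<open>A q\<close>).
\<close>

type_synonym ('x, 'e) atlas = "'x \<Rightarrow> 'x set \<times> ('x \<Rightarrow> 'e)"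

definition chart_dom :: "('x, 'e) atlas \<Rightarrow> 'x \<Rightarrow> 'x set" where
  "chart_dom A q = fst (A q)"

definition chart_map :: "('x, 'e) atlas \<Rightarrow> 'x \<Rightarrow> 'x \<Rightarrow> 'e" where
  "chart_map A q = snd (A q)"

definition chart_inv :: "('x, 'e) atlas \<Rightarrow> 'x \<Rightarrow> 'e \<Rightarrow> 'x" where
  "chart_inv A q = inv_into (chart_dom A q) (chart_map A q)"

definition chart_img :: "('x, 'e) atlas \<Rightarrow> 'x \<Rightarrow> 'e set" where
  "chart_img A q = chart_map A q ` chart_dom A q"

definition transition :: "('x, 'e) atlas \<Rightarrow> 'x \<Rightarrow> 'x \<Rightarrow> 'e \<Rightarrow> 'e" where
  "transition A q r = chart_map A r \<circ> chart_inv A q"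

definition smooth_manifold :: "('x::topological_space, 'e::euclidean_space) atlas \<Rightarrow> bool" where
  "smooth_manifold A \<longleftrightarrow>
     (\<forall>q. q \<in> chart_dom A q \<and> open (chart_dom A q) \<and> open (chart_img A q) \<and>
          homeomorphism (chart_dom A q) (chart_img A q) (chart_map A q) (chart_inv A q)) \<and>
     (\<forall>q r. smooth_on (chart_map A q ` (chart_dom A q \<inter> chart_dom A r)) (transition A q r))"

definition to_chart :: "('x, 'e::euclidean_space) atlas \<Rightarrow> 'x \<Rightarrow> 'x \<Rightarrow> 'e \<Rightarrow> 'e" where
  "to_chart A q p v = frechet_derivative (transition A p q) (at (chart_map A p p)) v"

definition from_chart :: "('x, 'e::euclidean_space) atlas \<Rightarrow> 'x \<Rightarrow> 'x \<Rightarrow> 'e \<Rightarrow> 'e" where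
  "from_chart A q p u = frechet_derivative (transition A q p) (at (chart_map A q p)) u"

definition tensor_in_chart ::
  "('x, 'e::euclidean_space) atlas \<Rightarrow> ('x \<Rightarrow> 'e \<Rightarrow> 'e \<Rightarrow> real) \<Rightarrow> 'x \<Rightarrow> 'e \<Rightarrow> 'e \<Rightarrow> 'e \<Rightarrow> real" where
  "tensor_in_chart A h q x u v =
     h (chart_inv A q x) (from_chart A q (chart_inv A q x) u) (from_chart A q (chart_inv A q x) v)"

definition field_in_chart :: "('x, 'e::euclidean_space) atlas \<Rightarrow> 'x \<Rightarrow> ('x \<Rightarrow> 'e) \<Rightarrow> 'e \<Rightarrow> 'e" where
  "field_in_chart A q W x = to_chart A q (chart_inv A q x) (W (chart_inv A q x))"

text \<open>An affine connection is given by its Christoffel symbols: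
  \<open>\<Gamma> q x u v\<close> is the value of \<open>\<nabla>\<^sub>u v\<close> at the coordinate point \<open>x\<close> of the chart \<open>A q\<close>,
  for fields \<open>u\<close>, \<open>v\<close> with constant coordinates.\<close>

type_synonym ('x, 'e) christoffel = "'x \<Rightarrow> 'e \<Rightarrow> 'e \<Rightarrow> 'e \<Rightarrow> 'e"

definition affine_connection ::
  "('x::topological_space, 'e::euclidean_space) atlas \<Rightarrow> ('x, 'e) christoffel \<Rightarrow> bool" where
  "affine_connection A \<Gamma> \<longleftrightarrow>
     (\<forall>q. \<forall>x\<in>chart_img A q. bilinear (\<Gamma> q x)) \<and>
     (\<forall>q u v. smooth_on (chart_img A q) (\<lambda>x. \<Gamma> q x u v)) \<and>
     (\<forall>q r. \<forall>p \<in> chart_dom A q \<inter> chart_dom A r. \<forall>u v.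
        let x = chart_map A q p; \<tau> = transition A q r; D = (\<lambda>z. frechet_derivative \<tau> (at z)) in
        \<Gamma> r (chart_map A r p) (D x u) (D x v) =
          D x (\<Gamma> q x u v) - frechet_derivative (\<lambda>z. D z v) (at x) u)"

definition levi_civita ::
  "('x::topological_space, 'e::euclidean_space) atlas \<Rightarrow> ('x \<Rightarrow> 'e \<Rightarrow> 'e \<Rightarrow> real)
     \<Rightarrow> ('x, 'e) christoffel \<Rightarrow> bool" where
  "levi_civita A g \<Gamma> \<longleftrightarrow> affine_connection A \<Gamma> \<and>
     (\<forall>q. \<forall>x\<in>chart_img A q. \<forall>u v w.
        \<Gamma> q x u v = \<Gamma> q x v u \<and>
        frechet_derivative (\<lambda>x. tensor_in_chart A g q x v w) (at x) u =
          tensor_in_chart A g q x (\<Gamma> q x u v) w + tensor_in_chart A g q x v (\<Gamma> q x u w))"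

text \<open>The chart around \<open>p\<close> itself is used, so no change of coordinates is needed.\<close>

definition riemann ::
  "('x, 'e::euclidean_space) atlas \<Rightarrow> ('x, 'e) christoffel \<Rightarrow> 'x \<Rightarrow> 'e \<Rightarrow> 'e \<Rightarrow> 'e \<Rightarrow> 'e" where
  "riemann A \<Gamma> p u v w =
     (let x = chart_map A p p in
       frechet_derivative (\<lambda>z. \<Gamma> p z v w) (at x) u - frechet_derivative (\<lambda>z. \<Gamma> p z u w) (at x) v
       + \<Gamma> p x u (\<Gamma> p x v w) - \<Gamma> p x v (\<Gamma> p x u w))"


section \<open>Kaehler manifolds\<close>

text \<open>
  A complex manifold has an atlas with values in \<open>complex ^ 'n\<close> and holomorphic transition maps. As
  these have complex linear derivatives, the complex structure on every tangent space
  is multiplication by the imaginary unit.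
\<close>

definition J :: "complex ^ 'n \<Rightarrow> complex ^ 'n" where
  "J v = \<i> *s v"

definition complex_manifold :: "('x::topological_space, complex ^ 'n::finite) atlas \<Rightarrow> bool" where
  "complex_manifold A \<longleftrightarrow> smooth_manifold A \<and>
     (\<forall>q r. \<forall>x \<in> chart_map A q ` (chart_dom A q \<inter> chart_dom A r). \<forall>v.
        frechet_derivative (transition A q r) (at x) (J v) =
        J (frechet_derivative (transition A q r) (at x) v))"

definition closed_2form ::
  "('x::topological_space, 'e::euclidean_space) atlas \<Rightarrow> ('x \<Rightarrow> 'e \<Rightarrow> 'e \<Rightarrow> real) \<Rightarrow> bool" where
  "closed_2form A \<omega> \<longleftrightarrow>
     (\<forall>p. bilinear (\<omega> p)) \<and> (\<forall>p u v. \<omega> p u v = - \<omega> p v u) \<and>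
     (\<forall>q u v. smooth_on (chart_img A q) (\<lambda>x. tensor_in_chart A \<omega> q x u v)) \<and>
     (\<forall>q. \<forall>x\<in>chart_img A q. \<forall>u v w.
        frechet_derivative (\<lambda>x. tensor_in_chart A \<omega> q x v w) (at x) u +
        frechet_derivative (\<lambda>x. tensor_in_chart A \<omega> q x w u) (at x) v +
        frechet_derivative (\<lambda>x. tensor_in_chart A \<omega> q x u v) (at x) w = 0)"

definition kmetric :: "('x \<Rightarrow> complex ^ 'n \<Rightarrow> complex ^ 'n \<Rightarrow> real) \<Rightarrow> 'x \<Rightarrow> complex ^ 'n \<Rightarrow> complex ^ 'n \<Rightarrow> real" where
  "kmetric \<omega> p u v = \<omega> p u (J v)"

definition kaehler ::
  "('x::topological_space, complex ^ 'n::finite) atlas \<Rightarrow> ('x \<Rightarrow> complex ^ 'n \<Rightarrow> complex ^ 'n \<Rightarrow> real) \<Rightarrow> bool" where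
  "kaehler A \<omega> \<longleftrightarrow> complex_manifold A \<and> closed_2form A \<omega> \<and>
     (\<forall>p u v. \<omega> p (J u) (J v) = \<omega> p u v) \<and> (\<forall>p v. v \<noteq> 0 \<longrightarrow> kmetric \<omega> p v v > 0)"

text \<open>
  The complexification of a real vector space \<open>'e\<close> is \<open>'e \<times> 'e\<close>, with \<open>(a, b)\<close> standing for
  \<open>a + \<i> b\<close>. Real linear maps between real spaces, and real linear maps to \<open>complex\<close>, are
  extended complex linearly.
\<close>

definition cscale :: "complex \<Rightarrow> 'e::real_vector \<times> 'e \<Rightarrow> 'e \<times> 'e" where
  "cscale c z = (Re c *\<^sub>R fst z - Im c *\<^sub>R snd z, Re c *\<^sub>R snd z + Im c *\<^sub>R fst z)"

definition cext :: "('e \<Rightarrow> 'd) \<Rightarrow> 'e \<times> 'e \<Rightarrow> 'd \<times> 'd" where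
  "cext f z = (f (fst z), f (snd z))"

definition cpair :: "'e \<times> 'e \<Rightarrow> ('e \<Rightarrow> complex) \<Rightarrow> complex" where
  "cpair z l = l (fst z) + \<i> * l (snd z)"

definition u_frame :: "(nat \<Rightarrow> complex ^ 'n) \<Rightarrow> nat \<Rightarrow> (complex ^ 'n) \<times> (complex ^ 'n)" where
  "u_frame e j = ((1/2) *\<^sub>R e j, - ((1/2) *\<^sub>R J (e j)))"

definition unitary_frame_at ::
  "('x \<Rightarrow> complex ^ 'n \<Rightarrow> complex ^ 'n \<Rightarrow> real) \<Rightarrow> 'x \<Rightarrow> (nat \<Rightarrow> complex ^ 'n::finite) \<Rightarrow> bool" where
  "unitary_frame_at \<omega> p e \<longleftrightarrow> (\<forall>i\<in>{1..CARD('n)}. \<forall>j\<in>{1..CARD('n)}.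
     kmetric \<omega> p (e i) (e j) = (if i = j then 1 else 0) \<and>
     kmetric \<omega> p (J (e i)) (J (e j)) = (if i = j then 1 else 0) \<and>
     kmetric \<omega> p (e i) (J (e j)) = 0)"

definition curvature_forms_at ::
  "('x, complex ^ 'n::finite) atlas \<Rightarrow> ('x, complex ^ 'n) christoffel \<Rightarrow> 'x \<Rightarrow> (nat \<Rightarrow> complex ^ 'n)
     \<Rightarrow> (nat \<Rightarrow> nat \<Rightarrow> complex ^ 'n \<Rightarrow> complex ^ 'n \<Rightarrow> complex) \<Rightarrow> bool" where
  "curvature_forms_at A \<Gamma> p e K \<longleftrightarrow> (\<forall>u v. \<forall>j\<in>{1..CARD('n)}.
     cext (riemann A \<Gamma> p u v) (u_frame e j) = (\<Sum>i=1..CARD('n). cscale (K i j u v) (u_frame e i)))"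

text \<open>
  The sign of the Ricci form is fixed by \<open>\<i> \<rho> = K\<^sup>j\<^sub>j\<close>. With \<open>g = \<omega>(\<cdot>, J \<cdot>)\<close> this
  gives \<open>\<rho> = - Ric(J \<cdot>, \<cdot>)\<close>. The trace does not depend on the unitary frame.
\<close>

definition ricci_form ::
  "('x, complex ^ 'n::finite) atlas \<Rightarrow> ('x \<Rightarrow> complex ^ 'n \<Rightarrow> complex ^ 'n \<Rightarrow> real) \<Rightarrow>
   ('x, complex ^ 'n) christoffel \<Rightarrow> ('x \<Rightarrow> complex ^ 'n \<Rightarrow> complex ^ 'n \<Rightarrow> real) \<Rightarrow> bool" where
  "ricci_form A \<omega> \<Gamma> \<rho> \<longleftrightarrow>
     (\<forall>p e K. unitary_frame_at \<omega> p e \<and> curvature_forms_at A \<Gamma> p e K \<longrightarrow>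
        (\<forall>u v. \<i> * complex_of_real (\<rho> p u v) = (\<Sum>j=1..CARD('n). K j j u v)))"


section \<open>Coisotropic submanifolds\<close>

text \<open>The submanifold is a manifold with atlas \<open>B\<close> on the type \<open>'y\<close>, embedded by \<open>\<iota>\<close>;
  \<open>push\<close> is the differential of \<open>\<iota>\<close>.\<close>

definition push ::
  "('x, 'e::euclidean_space) atlas \<Rightarrow> ('y, 'f::euclidean_space) atlas \<Rightarrow> ('y \<Rightarrow> 'x) \<Rightarrow> 'y \<Rightarrow> 'f \<Rightarrow> 'e" where
  "push A B \<iota> y v =
     frechet_derivative (chart_map A (\<iota> y) \<circ> \<iota> \<circ> chart_inv B y) (at (chart_map B y y)) v"

definition embedded_submanifold ::
  "('x::topological_space, 'e::euclidean_space) atlas \<Rightarrow> ('y::topological_space, 'f::euclidean_space) atlas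
     \<Rightarrow> ('y \<Rightarrow> 'x) \<Rightarrow> bool" where
  "embedded_submanifold A B \<iota> \<longleftrightarrow> smooth_manifold B \<and>
     (\<forall>q r. smooth_on (chart_map B r ` (chart_dom B r \<inter> \<iota> -` chart_dom A q))
              (chart_map A q \<circ> \<iota> \<circ> chart_inv B r)) \<and>
     (\<forall>y. inj (push A B \<iota> y)) \<and>
     homeomorphism UNIV (range \<iota>) \<iota> (inv \<iota>)"

definition TY ::
  "('x, 'e::euclidean_space) atlas \<Rightarrow> ('y, 'f::euclidean_space) atlas \<Rightarrow> ('y \<Rightarrow> 'x) \<Rightarrow> 'y \<Rightarrow> 'e set" where
  "TY A B \<iota> y = range (push A B \<iota> y)"

definition symplectic_orthogonal :: "('e \<Rightarrow> 'e \<Rightarrow> real) \<Rightarrow> 'e set \<Rightarrow> 'e set" where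
  "symplectic_orthogonal \<Omega> S = {u. \<forall>v\<in>S. \<Omega> u v = 0}"

definition TF ::
  "('x, 'e::euclidean_space) atlas \<Rightarrow> ('x \<Rightarrow> 'e \<Rightarrow> 'e \<Rightarrow> real) \<Rightarrow> ('y, 'f::euclidean_space) atlas
     \<Rightarrow> ('y \<Rightarrow> 'x) \<Rightarrow> 'y \<Rightarrow> 'e set" where
  "TF A \<omega> B \<iota> y = symplectic_orthogonal (\<omega> (\<iota> y)) (TY A B \<iota> y)"

definition coisotropic ::
  "('x, 'e::euclidean_space) atlas \<Rightarrow> ('x \<Rightarrow> 'e \<Rightarrow> 'e \<Rightarrow> real) \<Rightarrow> ('y, 'f::euclidean_space) atlas
     \<Rightarrow> ('y \<Rightarrow> 'x) \<Rightarrow> bool" where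
  "coisotropic A \<omega> B \<iota> \<longleftrightarrow> (\<forall>y. TF A \<omega> B \<iota> y \<subseteq> TY A B \<iota> y)"

text \<open>\<open>leaf_dir\<close> is the tangent space of the null foliation seen inside the tangent space of
  the submanifold, \<open>TF\<close> is its image under \<open>push\<close>.\<close>

definition leaf_dir ::
  "('x, 'e::euclidean_space) atlas \<Rightarrow> ('x \<Rightarrow> 'e \<Rightarrow> 'e \<Rightarrow> real) \<Rightarrow> ('y, 'f::euclidean_space) atlas
     \<Rightarrow> ('y \<Rightarrow> 'x) \<Rightarrow> 'y \<Rightarrow> 'f set" where
  "leaf_dir A \<omega> B \<iota> y = {v. push A B \<iota> y v \<in> TF A \<omega> B \<iota> y}"

definition orth_proj :: "('e \<Rightarrow> 'e \<Rightarrow> real) \<Rightarrow> 'e set \<Rightarrow> 'e \<Rightarrow> 'e::real_vector" where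
  "orth_proj g S v = (THE w. w \<in> S \<and> (\<forall>z\<in>S. g (v - w) z = 0))"

text \<open>
  \<open>U\<close> is a vector field along an open set \<open>V\<close> of the submanifold, smooth, and with values in the
  distribution \<open>D\<close>. \<open>D\<close> is either everything or \<open>leaf_dir\<close>.
\<close>

definition smooth_field_in ::
  "('y, 'f::euclidean_space) atlas \<Rightarrow> 'y \<Rightarrow> 'y set \<Rightarrow> ('y \<Rightarrow> 'f set) \<Rightarrow> ('y \<Rightarrow> 'f) \<Rightarrow> bool" where
  "smooth_field_in B r V D U \<longleftrightarrow>
     smooth_on (chart_map B r ` V) (field_in_chart B r U) \<and> (\<forall>y\<in>V. U y \<in> D y)"

definition dir_deriv ::
  "('y, 'f::euclidean_space) atlas \<Rightarrow> 'y \<Rightarrow> ('y \<Rightarrow> 'c::real_normed_vector) \<Rightarrow> 'y \<Rightarrow> 'f \<Rightarrow> 'c" where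
  "dir_deriv B r h y v =
     frechet_derivative (h \<circ> chart_inv B r) (at (chart_map B r y)) (to_chart B r y v)"

definition lie_bracket ::
  "('y, 'f::euclidean_space) atlas \<Rightarrow> 'y \<Rightarrow> ('y \<Rightarrow> 'f) \<Rightarrow> ('y \<Rightarrow> 'f) \<Rightarrow> 'y \<Rightarrow> 'f" where
  "lie_bracket B r U W y =
     (let x = chart_map B r y; U' = field_in_chart B r U; W' = field_in_chart B r W in
      from_chart B r y (frechet_derivative W' (at x) (U' x) - frechet_derivative U' (at x) (W' x)))"

text \<open>
  On the open set \<open>V\<close>, the two-form \<open>F\<close> along an involutive distribution \<open>D\<close> is the exterior
  derivative of the one-form \<open>\<eta>\<close> along \<open>D\<close>, as determined by
  \<open>d \<eta> (U, W) = U (\<eta> W) - W (\<eta> U) - \<eta> [U, W]\<close> for fields \<open>U\<close>, \<open>W\<close> in \<open>D\<close>.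
  Taking \<open>D\<close> to be everything gives \<open>d\<close>; taking \<open>leaf_dir\<close> gives the leafwise derivative
  \<open>d\<^sub>\<F>\<close>. The values of \<open>\<eta>\<close> and \<open>F\<close> outside \<open>D\<close> play no role.
\<close>

definition is_ext_deriv ::
  "('y::topological_space, 'f::euclidean_space) atlas \<Rightarrow> ('y \<Rightarrow> 'f set) \<Rightarrow> 'y set \<Rightarrow>
   ('y \<Rightarrow> 'f \<Rightarrow> 'c::real_normed_vector) \<Rightarrow> ('y \<Rightarrow> 'f \<Rightarrow> 'f \<Rightarrow> 'c) \<Rightarrow> bool" where
  "is_ext_deriv B D V \<eta> F \<longleftrightarrow>
     (\<forall>r V' U W. open V' \<and> V' \<subseteq> V \<inter> chart_dom B r \<and>
        smooth_field_in B r V' D U \<and> smooth_field_in B r V' D W \<longrightarrow>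
        (\<forall>y\<in>V'. F y (U y) (W y) =
           dir_deriv B r (\<lambda>y. \<eta> y (W y)) y (U y) - dir_deriv B r (\<lambda>y. \<eta> y (U y)) y (W y)
           - \<eta> y (lie_bracket B r U W y)))"


section \<open>The Levi-Civita connection along the submanifold\<close>

text \<open>
  Sections of the restricted tangent bundle are maps \<open>'y \<Rightarrow> 'e\<close>. The covariant derivative is
  written in a chart \<open>A q\<close> of the ambient manifold and a chart \<open>B r\<close> of the submanifold;
  its value does not depend on the choice of \<open>q\<close> and \<open>r\<close>.
\<close>

definition coord_nbhd ::
  "('x, 'e) atlas \<Rightarrow> ('y::topological_space, 'f) atlas \<Rightarrow> ('y \<Rightarrow> 'x) \<Rightarrow> 'x \<Rightarrow> 'y \<Rightarrow> 'y set \<Rightarrow> bool" where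
  "coord_nbhd A B \<iota> q r V \<longleftrightarrow> open V \<and> V \<subseteq> chart_dom B r \<inter> \<iota> -` chart_dom A q"

definition section_in_charts ::
  "('x, 'e::euclidean_space) atlas \<Rightarrow> ('y, 'f::euclidean_space) atlas \<Rightarrow> ('y \<Rightarrow> 'x) \<Rightarrow> 'x \<Rightarrow> 'y \<Rightarrow>
   ('y \<Rightarrow> 'e) \<Rightarrow> 'f \<Rightarrow> 'e" where
  "section_in_charts A B \<iota> q r Z x =
     to_chart A q (\<iota> (chart_inv B r x)) (Z (chart_inv B r x))"

definition nabla ::
  "('x, 'e::euclidean_space) atlas \<Rightarrow> ('x, 'e) christoffel \<Rightarrow> ('y, 'f::euclidean_space) atlas \<Rightarrow>
   ('y \<Rightarrow> 'x) \<Rightarrow> 'x \<Rightarrow> 'y \<Rightarrow> ('y \<Rightarrow> 'e) \<Rightarrow> 'y \<Rightarrow> 'f \<Rightarrow> 'e" where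
  "nabla A \<Gamma> B \<iota> q r Z y v =
     from_chart A q (\<iota> y)
       (frechet_derivative (section_in_charts A B \<iota> q r Z) (at (chart_map B r y)) (to_chart B r y v)
        + \<Gamma> q (chart_map A q (\<iota> y)) (to_chart A q (\<iota> y) (push A B \<iota> y v)) (to_chart A q (\<iota> y) (Z y)))"

text \<open>
  The dual connection \<open>(\<nabla>\<^sub>v \<theta>)(z) = v (\<theta> Z) - \<theta> (\<nabla>\<^sub>v Z)\<close>, where \<open>Z\<close> extends \<open>z\<close> with constant
  coordinates in the chart \<open>A q\<close>.
\<close>

definition nabla_dual ::
  "('x, 'e::euclidean_space) atlas \<Rightarrow> ('x, 'e) christoffel \<Rightarrow> ('y, 'f::euclidean_space) atlas \<Rightarrow>
   ('y \<Rightarrow> 'x) \<Rightarrow> 'x \<Rightarrow> 'y \<Rightarrow> ('y \<Rightarrow> 'e \<Rightarrow> complex) \<Rightarrow> 'y \<Rightarrow> 'f \<Rightarrow> 'e \<Rightarrow> complex" where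
  "nabla_dual A \<Gamma> B \<iota> q r \<theta> y v z =
     (let Z = (\<lambda>y'. from_chart A q (\<iota> y') (to_chart A q (\<iota> y) z)) in
      dir_deriv B r (\<lambda>y'. \<theta> y' (Z y')) y v - \<theta> y (nabla A \<Gamma> B \<iota> q r Z y v))"

definition is_second_fundamental_form ::
  "('x, complex ^ 'n::finite) atlas \<Rightarrow> ('x \<Rightarrow> complex ^ 'n \<Rightarrow> complex ^ 'n \<Rightarrow> real) \<Rightarrow>
   ('x, complex ^ 'n) christoffel \<Rightarrow> ('y::topological_space, 'f::euclidean_space) atlas \<Rightarrow> ('y \<Rightarrow> 'x) \<Rightarrow>
   ('y \<Rightarrow> 'f \<Rightarrow> 'f \<Rightarrow> complex ^ 'n) \<Rightarrow> bool" where
  "is_second_fundamental_form A \<omega> \<Gamma> B \<iota> S \<longleftrightarrow>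
     (\<forall>q r V W. coord_nbhd A B \<iota> q r V \<and> smooth_field_in B r V (\<lambda>_. UNIV) W \<longrightarrow>
        (\<forall>y\<in>V. \<forall>v. S y v (W y) =
           (let Z = nabla A \<Gamma> B \<iota> q r (\<lambda>y. push A B \<iota> y (W y)) y v in
            Z - orth_proj (kmetric \<omega> (\<iota> y)) (TY A B \<iota> y) Z)))"

text \<open>The leaves have dimension \<open>n - k\<close>, where \<open>n + k\<close> is the dimension of the submanifold.\<close>

definition leaf_orthonormal_basis ::
  "('x, complex ^ 'n::finite) atlas \<Rightarrow> ('x \<Rightarrow> complex ^ 'n \<Rightarrow> complex ^ 'n \<Rightarrow> real) \<Rightarrow>
   ('y, 'f::euclidean_space) atlas \<Rightarrow> ('y \<Rightarrow> 'x) \<Rightarrow> nat \<Rightarrow> 'y \<Rightarrow> (nat \<Rightarrow> 'f) \<Rightarrow> bool" where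
  "leaf_orthonormal_basis A \<omega> B \<iota> k y e \<longleftrightarrow>
     (\<forall>\<beta>\<in>{k+1..CARD('n)}. \<forall>\<gamma>\<in>{k+1..CARD('n)}.
        kmetric \<omega> (\<iota> y) (push A B \<iota> y (e \<beta>)) (push A B \<iota> y (e \<gamma>)) = (if \<beta> = \<gamma> then 1 else 0)) \<and>
     span (e ` {k+1..CARD('n)}) = leaf_dir A \<omega> B \<iota> y"

definition is_leafwise_mean_curvature ::
  "('x, complex ^ 'n::finite) atlas \<Rightarrow> ('x \<Rightarrow> complex ^ 'n \<Rightarrow> complex ^ 'n \<Rightarrow> real) \<Rightarrow>
   ('y, 'f::euclidean_space) atlas \<Rightarrow> ('y \<Rightarrow> 'x) \<Rightarrow> nat \<Rightarrow> ('y \<Rightarrow> 'f \<Rightarrow> 'f \<Rightarrow> complex ^ 'n) \<Rightarrow>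
   ('y \<Rightarrow> complex ^ 'n) \<Rightarrow> bool" where
  "is_leafwise_mean_curvature A \<omega> B \<iota> k S H \<longleftrightarrow>
     (\<forall>y e. leaf_orthonormal_basis A \<omega> B \<iota> k y e \<longrightarrow>
        H y = (\<Sum>\<beta>\<in>{k+1..CARD('n)}. S y (e \<beta>) (e \<beta>)))"

definition mean_curvature_form ::
  "('x, complex ^ 'n::finite) atlas \<Rightarrow> ('x \<Rightarrow> complex ^ 'n \<Rightarrow> complex ^ 'n \<Rightarrow> real) \<Rightarrow>
   ('y, 'f::euclidean_space) atlas \<Rightarrow> ('y \<Rightarrow> 'x) \<Rightarrow> ('y \<Rightarrow> complex ^ 'n) \<Rightarrow> 'y \<Rightarrow> 'f \<Rightarrow> real" where
  "mean_curvature_form A \<omega> B \<iota> H y v = \<omega> (\<iota> y) (H y) (push A B \<iota> y v)"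


section \<open>The two determinant line bundles\<close>

text \<open>
  The exterior product of \<open>a\<^sub>i\<close> (\<open>i \<in> I\<close>) as an alternating function on families of
  dual elements, \<open>(b\<^sub>i) \<mapsto> det (a\<^sub>i(b\<^sub>j))\<close>, the pairing being passed as an argument. For
  covectors \<open>b\<close> is a family of vectors; for (complexified) vectors it is a family of covectors.
\<close>

definition wedge :: "nat set \<Rightarrow> ('a \<Rightarrow> 'b \<Rightarrow> complex) \<Rightarrow> (nat \<Rightarrow> 'a) \<Rightarrow> (nat \<Rightarrow> 'b) \<Rightarrow> complex" where
  "wedge I pair a b =
     (\<Sum>\<pi> | \<pi> permutes I. of_int (sign \<pi>) * (\<Prod>i\<in>I. pair (a i) (b (\<pi> i))))"

definition EE ::
  "('x, complex ^ 'n::finite) atlas \<Rightarrow> ('x \<Rightarrow> complex ^ 'n \<Rightarrow> complex ^ 'n \<Rightarrow> real) \<Rightarrow>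
   ('y, 'f::euclidean_space) atlas \<Rightarrow> ('y \<Rightarrow> 'x) \<Rightarrow> 'y \<Rightarrow> (complex ^ 'n) set" where
  "EE A \<omega> B \<iota> y = {a + J b | a b. a \<in> TF A \<omega> B \<iota> y \<and> b \<in> TF A \<omega> B \<iota> y}"

text \<open>The (1,0) part is the eigenspace of the complexified \<open>J\<close> for the eigenvalue \<open>\<i>\<close>.\<close>

definition E10 ::
  "('x, complex ^ 'n::finite) atlas \<Rightarrow> ('x \<Rightarrow> complex ^ 'n \<Rightarrow> complex ^ 'n \<Rightarrow> real) \<Rightarrow>
   ('y, 'f::euclidean_space) atlas \<Rightarrow> ('y \<Rightarrow> 'x) \<Rightarrow> 'y \<Rightarrow> ((complex ^ 'n) \<times> (complex ^ 'n)) set" where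
  "E10 A \<omega> B \<iota> y = {z. fst z \<in> EE A \<omega> B \<iota> y \<and> snd z \<in> EE A \<omega> B \<iota> y \<and> cext J z = cscale \<i> z}"

definition N10 ::
  "('x, complex ^ 'n::finite) atlas \<Rightarrow> ('x \<Rightarrow> complex ^ 'n \<Rightarrow> complex ^ 'n \<Rightarrow> real) \<Rightarrow>
   ('y, 'f::euclidean_space) atlas \<Rightarrow> ('y \<Rightarrow> 'x) \<Rightarrow> 'y \<Rightarrow> (complex ^ 'n \<Rightarrow> complex) set" where
  "N10 A \<omega> B \<iota> y = {\<theta>. linear \<theta> \<and> (\<forall>v\<in>EE A \<omega> B \<iota> y. \<theta> v = 0) \<and> (\<forall>v. \<theta> (J v) = \<i> * \<theta> v)}"

text \<open>
  Neither bundle is parallel along the submanifold. The connections induced from \<open>\<nabla>\<close> are obtained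
  by orthogonal projection: for \<open>E10\<close> onto \<open>EE\<close>, and for \<open>N10\<close> onto the annihilator of \<open>EE\<close>, i.e.
  by composing a covector with the orthogonal projection of vectors to the complement of \<open>EE\<close>.
  In an adapted frame they read \<open>\<nabla> u\<^sub>\<alpha> = \<omega>\<^sup>\<beta>\<^sub>\<alpha> u\<^sub>\<beta>\<close> and \<open>\<nabla> \<theta>\<^sup>a = - \<omega>\<^sup>a\<^sub>b \<theta>\<^sup>b\<close>.
\<close>

definition nabla_E ::
  "('x, complex ^ 'n::finite) atlas \<Rightarrow> ('x \<Rightarrow> complex ^ 'n \<Rightarrow> complex ^ 'n \<Rightarrow> real) \<Rightarrow>
   ('x, complex ^ 'n) christoffel \<Rightarrow> ('y, 'f::euclidean_space) atlas \<Rightarrow> ('y \<Rightarrow> 'x) \<Rightarrow> 'x \<Rightarrow> 'y \<Rightarrow>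
   ('y \<Rightarrow> (complex ^ 'n) \<times> (complex ^ 'n)) \<Rightarrow> 'y \<Rightarrow> 'f \<Rightarrow> (complex ^ 'n) \<times> (complex ^ 'n)" where
  "nabla_E A \<omega> \<Gamma> B \<iota> q r w y v =
     cext (orth_proj (kmetric \<omega> (\<iota> y)) (EE A \<omega> B \<iota> y))
       (nabla A \<Gamma> B \<iota> q r (\<lambda>y. fst (w y)) y v, nabla A \<Gamma> B \<iota> q r (\<lambda>y. snd (w y)) y v)"

definition nabla_N ::
  "('x, complex ^ 'n::finite) atlas \<Rightarrow> ('x \<Rightarrow> complex ^ 'n \<Rightarrow> complex ^ 'n \<Rightarrow> real) \<Rightarrow>
   ('x, complex ^ 'n) christoffel \<Rightarrow> ('y, 'f::euclidean_space) atlas \<Rightarrow> ('y \<Rightarrow> 'x) \<Rightarrow> 'x \<Rightarrow> 'y \<Rightarrow>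
   ('y \<Rightarrow> complex ^ 'n \<Rightarrow> complex) \<Rightarrow> 'y \<Rightarrow> 'f \<Rightarrow> complex ^ 'n \<Rightarrow> complex" where
  "nabla_N A \<omega> \<Gamma> B \<iota> q r \<theta> y v z =
     nabla_dual A \<Gamma> B \<iota> q r \<theta> y v (z - orth_proj (kmetric \<omega> (\<iota> y)) (EE A \<omega> B \<iota> y) z)"

definition E10_frame ::
  "('x, complex ^ 'n::finite) atlas \<Rightarrow> ('x \<Rightarrow> complex ^ 'n \<Rightarrow> complex ^ 'n \<Rightarrow> real) \<Rightarrow>
   ('y, 'f::euclidean_space) atlas \<Rightarrow> ('y \<Rightarrow> 'x) \<Rightarrow> nat \<Rightarrow> 'x \<Rightarrow> 'y \<Rightarrow> 'y set \<Rightarrow>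
   (nat \<Rightarrow> 'y \<Rightarrow> (complex ^ 'n) \<times> (complex ^ 'n)) \<Rightarrow> bool" where
  "E10_frame A \<omega> B \<iota> k q r V w \<longleftrightarrow>
     (\<forall>\<alpha>\<in>{k+1..CARD('n)}.
        smooth_on (chart_map B r ` V) (section_in_charts A B \<iota> q r (\<lambda>y. fst (w \<alpha> y))) \<and>
        smooth_on (chart_map B r ` V) (section_in_charts A B \<iota> q r (\<lambda>y. snd (w \<alpha> y)))) \<and>
     (\<forall>y\<in>V.
        E10 A \<omega> B \<iota> y = {\<Sum>\<alpha>\<in>{k+1..CARD('n)}. cscale (c \<alpha>) (w \<alpha> y) | c. True} \<and>
        (\<forall>c. (\<Sum>\<alpha>\<in>{k+1..CARD('n)}. cscale (c \<alpha>) (w \<alpha> y)) = 0 \<longrightarrow> (\<forall>\<alpha>\<in>{k+1..CARD('n)}. c \<alpha> = 0)))"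

definition N10_frame ::
  "('x, complex ^ 'n::finite) atlas \<Rightarrow> ('x \<Rightarrow> complex ^ 'n \<Rightarrow> complex ^ 'n \<Rightarrow> real) \<Rightarrow>
   ('y, 'f::euclidean_space) atlas \<Rightarrow> ('y \<Rightarrow> 'x) \<Rightarrow> nat \<Rightarrow> 'x \<Rightarrow> 'y \<Rightarrow> 'y set \<Rightarrow>
   (nat \<Rightarrow> 'y \<Rightarrow> complex ^ 'n \<Rightarrow> complex) \<Rightarrow> bool" where
  "N10_frame A \<omega> B \<iota> k q r V \<theta> \<longleftrightarrow>
     (\<forall>a\<in>{1..k}. \<forall>z. smooth_on (chart_map B r ` V)
        (\<lambda>x. \<theta> a (chart_inv B r x) (from_chart A q (\<iota> (chart_inv B r x)) z))) \<and>
     (\<forall>y\<in>V.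
        N10 A \<omega> B \<iota> y = {\<lambda>z. \<Sum>a=1..k. c a * \<theta> a y z | c. True} \<and>
        (\<forall>c. (\<forall>z. (\<Sum>a=1..k. c a * \<theta> a y z) = 0) \<longrightarrow> (\<forall>a\<in>{1..k}. c a = 0)))"

text \<open>
  A local frame \<open>w\<close> of a bundle gives the local frame \<open>\<And>\<^sub>i w\<^sub>i\<close> of its determinant. The connection on the
  determinant is given by the Leibniz rule, so its connection form \<open>\<eta>\<close> is characterised by
  \<open>\<Sum>\<^sub>i w\<^sub>1 \<and> \<dots> \<and> \<nabla>\<^sub>v w\<^sub>i \<and> \<dots> = \<eta>(v) (w\<^sub>1 \<and> w\<^sub>2 \<and> \<dots>)\<close>. Only directions \<open>v\<close> in \<open>D\<close> are considered.
\<close>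

definition detE_connection_form ::
  "('x, complex ^ 'n::finite) atlas \<Rightarrow> ('x \<Rightarrow> complex ^ 'n \<Rightarrow> complex ^ 'n \<Rightarrow> real) \<Rightarrow>
   ('x, complex ^ 'n) christoffel \<Rightarrow> ('y, 'f::euclidean_space) atlas \<Rightarrow> ('y \<Rightarrow> 'x) \<Rightarrow> nat \<Rightarrow>
   ('y \<Rightarrow> 'f set) \<Rightarrow> 'x \<Rightarrow> 'y \<Rightarrow> 'y set \<Rightarrow> (nat \<Rightarrow> 'y \<Rightarrow> (complex ^ 'n) \<times> (complex ^ 'n)) \<Rightarrow>
   ('y \<Rightarrow> 'f \<Rightarrow> complex) \<Rightarrow> bool" where
  "detE_connection_form A \<omega> \<Gamma> B \<iota> k D q r V w \<eta> \<longleftrightarrow>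
     (let I = {k+1..CARD('n)} in
      \<forall>y\<in>V. \<forall>v\<in>D y. \<forall>l. (\<forall>i\<in>I. linear (l i)) \<longrightarrow>
        (\<Sum>\<alpha>\<in>I. wedge I cpair ((\<lambda>i. w i y)(\<alpha> := nabla_E A \<omega> \<Gamma> B \<iota> q r (w \<alpha>) y v)) l)
        = \<eta> y v * wedge I cpair (\<lambda>i. w i y) l)"

definition KY_connection_form ::
  "('x, complex ^ 'n::finite) atlas \<Rightarrow> ('x \<Rightarrow> complex ^ 'n \<Rightarrow> complex ^ 'n \<Rightarrow> real) \<Rightarrow>
   ('x, complex ^ 'n) christoffel \<Rightarrow> ('y, 'f::euclidean_space) atlas \<Rightarrow> ('y \<Rightarrow> 'x) \<Rightarrow> nat \<Rightarrow>
   ('y \<Rightarrow> 'f set) \<Rightarrow> 'x \<Rightarrow> 'y \<Rightarrow> 'y set \<Rightarrow> (nat \<Rightarrow> 'y \<Rightarrow> complex ^ 'n \<Rightarrow> complex) \<Rightarrow>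
   ('y \<Rightarrow> 'f \<Rightarrow> complex) \<Rightarrow> bool" where
  "KY_connection_form A \<omega> \<Gamma> B \<iota> k D q r V \<theta> \<eta> \<longleftrightarrow>
     (let I = {1..k} in
      \<forall>y\<in>V. \<forall>v\<in>D y. \<forall>z.
        (\<Sum>a\<in>I. wedge I (\<lambda>\<theta> z. \<theta> z) ((\<lambda>i. \<theta> i y)(a := nabla_N A \<omega> \<Gamma> B \<iota> q r (\<theta> a) y v)) z)
        = \<eta> y v * wedge I (\<lambda>\<theta> z. \<theta> z) (\<lambda>i. \<theta> i y) z)"

text \<open>
  \<open>F\<close> is the curvature two-form of the line bundle connection restricted to directions in \<open>D\<close>: it is the
  exterior derivative of the connection form in every local frame. Such an \<open>F\<close> exists and its
  values on \<open>D\<close> are unique, since multiplying a frame of the line bundle by a function \<open>h\<close> adds the closed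
  form \<open>dh / h\<close> to \<open>\<eta>\<close>.
\<close>

definition is_curv_detE ::
  "('x, complex ^ 'n::finite) atlas \<Rightarrow> ('x \<Rightarrow> complex ^ 'n \<Rightarrow> complex ^ 'n \<Rightarrow> real) \<Rightarrow>
   ('x, complex ^ 'n) christoffel \<Rightarrow> ('y::topological_space, 'f::euclidean_space) atlas \<Rightarrow> ('y \<Rightarrow> 'x) \<Rightarrow>
   nat \<Rightarrow> ('y \<Rightarrow> 'f set) \<Rightarrow> ('y \<Rightarrow> 'f \<Rightarrow> 'f \<Rightarrow> complex) \<Rightarrow> bool" where
  "is_curv_detE A \<omega> \<Gamma> B \<iota> k D F \<longleftrightarrow>
     (\<forall>q r V w \<eta>. coord_nbhd A B \<iota> q r V \<and> E10_frame A \<omega> B \<iota> k q r V w \<and>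
        detE_connection_form A \<omega> \<Gamma> B \<iota> k D q r V w \<eta> \<longrightarrow> is_ext_deriv B D V \<eta> F)"

definition is_curv_KY ::
  "('x, complex ^ 'n::finite) atlas \<Rightarrow> ('x \<Rightarrow> complex ^ 'n \<Rightarrow> complex ^ 'n \<Rightarrow> real) \<Rightarrow>
   ('x, complex ^ 'n) christoffel \<Rightarrow> ('y::topological_space, 'f::euclidean_space) atlas \<Rightarrow> ('y \<Rightarrow> 'x) \<Rightarrow>
   nat \<Rightarrow> ('y \<Rightarrow> 'f set) \<Rightarrow> ('y \<Rightarrow> 'f \<Rightarrow> 'f \<Rightarrow> complex) \<Rightarrow> bool" where
  "is_curv_KY A \<omega> \<Gamma> B \<iota> k D F \<longleftrightarrow>
     (\<forall>q r V \<theta> \<eta>. coord_nbhd A B \<iota> q r V \<and> N10_frame A \<omega> B \<iota> k q r V \<theta> \<and>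
        KY_connection_form A \<omega> \<Gamma> B \<iota> k D q r V \<theta> \<eta> \<longrightarrow> is_ext_deriv B D V \<eta> F)"

end

theory Submission
  imports Defs
begin

text \<open>
  In an adapted unitary frame with connection matrix \<open>\<omega>\<^sup>i\<^sub>j\<close> the connection forms of \<open>det \<E>\<close> and \<open>K\<^sub>Y\<close> are
  \<open>\<omega>\<^sup>\<alpha>\<^sub>\<alpha>\<close> and \<open>- \<omega>\<^sup>a\<^sub>a\<close>. Their difference is the full trace, and the quadratic terms cancel in
  \<open>d (tr \<omega>) = tr K = \<i> \<rho>\<close>; this is the first identity. Along the leaves, symmetry of the second
  fundamental form gives \<open>\<omega>\<^sup>\<alpha>\<^sub>\<alpha> = - \<i> \<alpha>\<^sub>Y\<close>, which turns it into the second one. All of this takes place in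
  one chart of \<open>Y\<close> and one of \<open>X\<close>; that \<open>J\<close> is parallel follows from \<open>d \<omega> = 0\<close> and the vanishing of the
  Nijenhuis tensor, and the frames come from Gram--Schmidt.
\<close>

section \<open>Smooth maps\<close>

text \<open>The curvature hypotheses quantify over all local frames, so one convenient frame near
  each point suffices, once its connection forms are computed. A tangent vector at \<open>p\<close>
  is stored in the coordinates of the chart \<open>A p\<close>, while derivatives need one fixed
  chart. Hence the geometry is first moved to a Euclidean model (\<open>coisotropic_chart\<close>),
  and in the end the charts are those centred at \<open>\<iota> y\<close> and \<open>y\<close>:
  there the changes of coordinates are the identity and \<open>riemann\<close> can be read off
  directly. Since \<open>J\<close> is parallel, a frame \<open>u\<^sub>j\<close> can be replaced by
  the vectors \<open>e\<^sub>j\<close> of \<open>complex ^ 'n\<close> with a Hermitian form;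
  complexified vectors appear only through \<open>part10\<close>. \<open>is_ext_deriv\<close> gives
  the value of a two-form on fields, so a pair of vectors must be extended: with constant
  coordinates for the first identity, with constant coefficients in the leaf frame for the second,
  because the mean curvature form is related to the connection only along the leaves. For the same
  reason the bracket of two leaf fields has to be shown to be a leaf field.\<close>

abbreviation fd :: "('a::real_normed_vector \<Rightarrow> 'b::real_normed_vector) \<Rightarrow> 'a \<Rightarrow> 'a \<Rightarrow> 'b" where
  "fd f x \<equiv> frechet_derivative f (at x)"

lemma fd_eq: "(f has_derivative f') (at x) \<Longrightarrow> fd f x = f'"
  by (metis frechet_derivative_at)

lemma has_fd: "f differentiable (at x) \<Longrightarrow> (f has_derivative fd f x) (at x)"
  by (simp add: frechet_derivative_works)

text \<open>\<open>frechet_derivative\<close> is a choice among all derivatives at the point, and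
  functions that agree nearby have exactly the same ones; this holds also where there are
  none.\<close>

lemma fd_cong_open:
  assumes "open S" "x \<in> S" "\<And>z. z \<in> S \<Longrightarrow> f z = g z"
  shows "fd f x = fd g x"
proof -
  have "(f has_derivative h) (at x) \<longleftrightarrow> (g has_derivative h) (at x)" for h
    using assms has_derivative_transform_within_open[of f h x UNIV S g]
      has_derivative_transform_within_open[of g h x UNIV S f] by auto
  then show ?thesis by (simp add: frechet_derivative_def)
qed

lemma differentiable_cong_open:
  assumes "open S" "x \<in> S" "\<And>z. z \<in> S \<Longrightarrow> f z = g z" "f differentiable (at x)"
  shows "g differentiable (at x)"
  using assms has_derivative_transform_within_open[of f _ x UNIV S g]
  unfolding differentiable_def by blast

lemma Ck_on_SucD: "Ck_on (Suc m) S f \<Longrightarrow> Ck_on m S f"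
proof (induction m arbitrary: f)
  case 0
  then show ?case
    by (auto intro!: continuous_at_imp_continuous_on differentiable_imp_continuous_within)
next
  case (Suc m)
  then show ?case by (metis Ck_on.simps(2))
qed

lemma Ck_on_subset: "Ck_on m S f \<Longrightarrow> T \<subseteq> S \<Longrightarrow> Ck_on m T f"
  by (induction m arbitrary: f) (auto intro: continuous_on_subset)

lemma Ck_on_cong:
  assumes "open S" "\<And>x. x \<in> S \<Longrightarrow> f x = g x" "Ck_on m S f"
  shows "Ck_on m S g"
  using assms(2,3)
proof (induction m arbitrary: f g)
  case 0
  then show ?case by (metis Ck_on.simps(1) continuous_on_cong)
next
  case (Suc m)
  have "Ck_on m S (\<lambda>x. fd g x v)" for v
    by (rule Suc.IH[of "\<lambda>x. fd f x v"])
      (use Suc.prems fd_cong_open[OF assms(1), of _ f g] in auto)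
  then show ?case
    using Suc.prems differentiable_cong_open[OF assms(1), of _ f g] by auto
qed

text \<open>\<open>Ck_on\<close> speaks of \<open>frechet_derivative\<close>, whereas the calculus
  rules produce some explicit derivative \<open>f'\<close>. This rule bridges the two and drives the
  inductions below.\<close>

lemma Ck_on_SucI:
  assumes "open S" "\<And>x. x \<in> S \<Longrightarrow> (f has_derivative f' x) (at x)"
    "\<And>v. Ck_on m S (\<lambda>x. f' x v)"
  shows "Ck_on (Suc m) S f"
proof -
  have "Ck_on m S (\<lambda>x. fd f x v)" for v
    by (rule Ck_on_cong[OF assms(1) _ assms(3)[of v]]) (use fd_eq[OF assms(2)] in auto)
  then show ?thesis using assms(2) by (auto simp: differentiable_def)
qed

lemma Ck_on_const: "Ck_on m S (\<lambda>x. c)"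
  by (induction m arbitrary: c) auto

lemma Ck_on_bounded_linear:
  assumes "open S" "bounded_linear h" "Ck_on m S f"
  shows "Ck_on m S (\<lambda>x. h (f x))"
  using assms(3)
proof (induction m arbitrary: f)
  case 0
  then show ?case
    using bounded_linear.continuous_on[OF assms(2)] by simp
next
  case (Suc m)
  show ?case
    by (rule Ck_on_SucI[OF assms(1), where f' = "\<lambda>x v. h (fd f x v)"])
      (use Suc in \<open>auto intro: bounded_linear.has_derivative[OF assms(2) has_fd]\<close>)
qed

lemma Ck_on_add:
  assumes "open S" "Ck_on m S f" "Ck_on m S g"
  shows "Ck_on m S (\<lambda>x. f x + g x)"
  using assms(2,3)
proof (induction m arbitrary: f g)
  case 0
  then show ?case by (auto intro: continuous_on_add)
next
  case (Suc m)
  show ?case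
    by (rule Ck_on_SucI[OF assms(1), where f' = "\<lambda>x v. fd f x v + fd g x v"])
      (use Suc in \<open>auto intro!: has_derivative_add has_fd\<close>)
qed

lemma Ck_on_bilinear:
  assumes "open S" "bounded_bilinear h" "Ck_on m S f" "Ck_on m S g"
  shows "Ck_on m S (\<lambda>x. h (f x) (g x))"
  using assms(3,4)
proof (induction m arbitrary: f g)
  case 0
  then show ?case by (auto intro: bounded_bilinear.continuous_on[OF assms(2)])
next
  case (Suc m)
  have "Ck_on m S f" "Ck_on m S g" using Suc.prems Ck_on_SucD by blast+
  then show ?case
    using Suc
    by (intro Ck_on_SucI[OF assms(1), where f' = "\<lambda>x v. h (f x) (fd g x v) + h (fd f x v) (g x)"]
        bounded_bilinear.FDERIV[OF assms(2)] has_fd Ck_on_add[OF assms(1)]) auto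
qed

lemma Ck_on_sum:
  assumes "open S" "\<And>i. i \<in> I \<Longrightarrow> Ck_on m S (f i)"
  shows "Ck_on m S (\<lambda>x. \<Sum>i\<in>I. f i x)"
  using assms(2)
  by (induction I rule: infinite_finite_induct) (auto intro: Ck_on_const Ck_on_add[OF assms(1)])

lemma linear_basis_expansion:
  assumes "linear (f :: 'a::euclidean_space \<Rightarrow> 'b::real_vector)"
  shows "f v = (\<Sum>b\<in>Basis. (v \<bullet> b) *\<^sub>R f b)"
proof -
  have "f v = f (\<Sum>b\<in>Basis. (v \<bullet> b) *\<^sub>R b)" by (simp add: euclidean_representation)
  also have "\<dots> = (\<Sum>b\<in>Basis. (v \<bullet> b) *\<^sub>R f b)"
    by (simp add: linear_sum[OF assms] linear_cmul[OF assms])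
  finally show ?thesis .
qed

text \<open>The chain rule evaluates \<open>fd g (f x)\<close> in a direction that moves with
  \<open>x\<close>, whereas \<open>Ck_on\<close> controls fixed directions. Expanding in
  \<open>Basis\<close> turns the moving direction into smooth scalar coefficients, which is why the
  middle space is Euclidean.\<close>

lemma Ck_on_compose:
  fixes g :: "'b::euclidean_space \<Rightarrow> 'c::real_normed_vector"
  assumes "open S" "Ck_on m S f" "Ck_on m T g" "f ` S \<subseteq> T"
  shows "Ck_on m S (\<lambda>x. g (f x))"
  using assms(2,3)
proof (induction m arbitrary: g)
  case 0
  then show ?case using assms(4) by (auto intro: continuous_on_compose2)
next
  case (Suc m)
  have f: "Ck_on m S f" using Suc.prems Ck_on_SucD by blast
  show ?case
  proof (rule Ck_on_SucI[OF assms(1), where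
        f' = "\<lambda>x v. \<Sum>b\<in>Basis. (fd f x v \<bullet> b) *\<^sub>R fd g (f x) b"])
    fix x assume x: "x \<in> S"
    have g': "g differentiable at (f x)" using Suc.prems x assms(4) by auto
    have "((\<lambda>x. g (f x)) has_derivative (\<lambda>v. fd g (f x) (fd f x v))) (at x)"
      using Suc.prems x by (intro has_derivative_compose[where f = f and g = g] has_fd g') auto
    moreover have "(\<lambda>v. fd g (f x) (fd f x v)) = (\<lambda>v. \<Sum>b\<in>Basis. (fd f x v \<bullet> b) *\<^sub>R fd g (f x) b)"
      by (rule ext) (rule linear_basis_expansion[OF linear_frechet_derivative[OF g']])
    ultimately show "((\<lambda>x. g (f x)) has_derivative
        (\<lambda>v. \<Sum>b\<in>Basis. (fd f x v \<bullet> b) *\<^sub>R fd g (f x) b)) (at x)" by simp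
  next
    fix v
    have "Ck_on m S (\<lambda>x. fd f x v \<bullet> b)" for b
      using Suc.prems by (auto intro: Ck_on_bounded_linear[OF assms(1) bounded_linear_inner_left])
    moreover have "Ck_on m S (\<lambda>x. fd g (f x) b)" for b
      using Suc.IH[of "\<lambda>z. fd g z b"] f Suc.prems by auto
    ultimately show "Ck_on m S (\<lambda>x. \<Sum>b\<in>Basis. (fd f x v \<bullet> b) *\<^sub>R fd g (f x) b)"
      by (auto intro!: Ck_on_sum[OF assms(1)] Ck_on_bilinear[OF assms(1) bounded_bilinear_scaleR])
  qed
qed

lemma smooth_on_differentiable: "smooth_on S f \<Longrightarrow> x \<in> S \<Longrightarrow> f differentiable (at x)"
  unfolding smooth_on_def by (metis Ck_on.simps(2))

lemma smooth_on_has_fd: "smooth_on S f \<Longrightarrow> x \<in> S \<Longrightarrow> (f has_derivative fd f x) (at x)"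
  by (simp add: has_fd smooth_on_differentiable)

lemma smooth_on_linear_fd: "smooth_on S f \<Longrightarrow> x \<in> S \<Longrightarrow> linear (fd f x)"
  by (simp add: linear_frechet_derivative smooth_on_differentiable)

lemma smooth_on_continuous_on: "smooth_on S f \<Longrightarrow> continuous_on S f"
  unfolding smooth_on_def by (metis Ck_on.simps(1))

lemma smooth_on_fd: "smooth_on S f \<Longrightarrow> smooth_on S (\<lambda>x. fd f x v)"
  unfolding smooth_on_def by (metis Ck_on.simps(2))

lemma smooth_on_subset: "smooth_on S f \<Longrightarrow> T \<subseteq> S \<Longrightarrow> smooth_on T f"
  unfolding smooth_on_def by (metis Ck_on_subset)

lemma smooth_on_cong:
  "open S \<Longrightarrow> (\<And>x. x \<in> S \<Longrightarrow> f x = g x) \<Longrightarrow> smooth_on S f \<Longrightarrow> smooth_on S g"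
  unfolding smooth_on_def by (metis Ck_on_cong)

lemma smooth_on_const: "smooth_on S (\<lambda>x. c)"
  unfolding smooth_on_def by (simp add: Ck_on_const)

lemma smooth_on_bounded_linear:
  "open S \<Longrightarrow> bounded_linear h \<Longrightarrow> smooth_on S f \<Longrightarrow> smooth_on S (\<lambda>x. h (f x))"
  unfolding smooth_on_def by (simp add: Ck_on_bounded_linear)

lemma smooth_on_linear:
  fixes h :: "'b::euclidean_space \<Rightarrow> 'c::real_normed_vector"
  shows "open S \<Longrightarrow> linear h \<Longrightarrow> smooth_on S f \<Longrightarrow> smooth_on S (\<lambda>x. h (f x))"
  by (simp add: smooth_on_bounded_linear linear_conv_bounded_linear)

lemma smooth_on_add:
  "open S \<Longrightarrow> smooth_on S f \<Longrightarrow> smooth_on S g \<Longrightarrow> smooth_on S (\<lambda>x. f x + g x)"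
  unfolding smooth_on_def by (simp add: Ck_on_add)

lemma smooth_on_bilinear:
  "open S \<Longrightarrow> bounded_bilinear h \<Longrightarrow> smooth_on S f \<Longrightarrow> smooth_on S g \<Longrightarrow>
    smooth_on S (\<lambda>x. h (f x) (g x))"
  unfolding smooth_on_def by (simp add: Ck_on_bilinear)

lemmas smooth_on_scaleR = smooth_on_bilinear[OF _ bounded_bilinear_scaleR]

lemma smooth_on_minus: "open S \<Longrightarrow> smooth_on S f \<Longrightarrow> smooth_on S (\<lambda>x. - f x)"
  by (rule smooth_on_bounded_linear[OF _ bounded_linear_minus[OF bounded_linear_ident]])

lemma smooth_on_diff:
  "open S \<Longrightarrow> smooth_on S f \<Longrightarrow> smooth_on S g \<Longrightarrow> smooth_on S (\<lambda>x. f x - g x)"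
  using smooth_on_add[of S f "\<lambda>x. - g x"] smooth_on_minus[of S g] by simp

lemma smooth_on_sum:
  "open S \<Longrightarrow> (\<And>i. i \<in> I \<Longrightarrow> smooth_on S (f i)) \<Longrightarrow> smooth_on S (\<lambda>x. \<Sum>i\<in>I. f i x)"
  unfolding smooth_on_def by (simp add: Ck_on_sum)

lemma smooth_on_compose:
  fixes g :: "'b::euclidean_space \<Rightarrow> 'c::real_normed_vector"
  shows "open S \<Longrightarrow> smooth_on S f \<Longrightarrow> smooth_on T g \<Longrightarrow> f ` S \<subseteq> T \<Longrightarrow> smooth_on S (\<lambda>x. g (f x))"
  unfolding smooth_on_def by (metis Ck_on_compose)

text \<open>The exponent is general because differentiation lowers it by one; the case of interest
  is the normalising factor with exponent -1/2 in Gram-Schmidt.\<close>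

lemma Ck_on_powr: "Ck_on m {0<..} (\<lambda>s::real. s powr a)"
proof (induction m arbitrary: a)
  case 0
  show ?case by (auto intro!: continuous_intros)
next
  case (Suc m)
  show ?case
  proof (rule Ck_on_SucI[where f' = "\<lambda>s v. v *\<^sub>R (a *\<^sub>R (s powr (a - 1)))"])
    fix s :: real assume "s \<in> {0<..}"
    then have "((\<lambda>s. s powr a) has_real_derivative a * s powr (a - 1)) (at s)"
      by (auto intro: has_real_derivative_powr)
    then show "((\<lambda>s. s powr a) has_derivative (\<lambda>v. v *\<^sub>R (a *\<^sub>R (s powr (a - 1))))) (at s)"
      by (simp add: has_field_derivative_def mult.commute[of _ "a * _"])
  next
    show "Ck_on m {0<..} (\<lambda>s. v *\<^sub>R a *\<^sub>R s powr (a - 1))" for v :: real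
      by (intro Ck_on_bounded_linear[OF _ bounded_linear_scaleR_right]) (auto intro: Suc.IH)
  qed auto
qed

lemma smooth_on_powr:
  fixes f :: "'a::real_normed_vector \<Rightarrow> real"
  assumes "open S" "smooth_on S f" "\<And>x. x \<in> S \<Longrightarrow> 0 < f x"
  shows "smooth_on S (\<lambda>x. f x powr a)"
  by (rule smooth_on_compose[OF assms(1,2), where T = "{0<..}" and g = "\<lambda>s. s powr a"])
    (use assms(3) Ck_on_powr in \<open>auto simp: smooth_on_def\<close>)

section \<open>Linear and bilinear maps depending smoothly on a point\<close>

lemma smooth_on_linear_family:
  fixes P :: "'a::real_normed_vector \<Rightarrow> 'b::euclidean_space \<Rightarrow> 'c::real_normed_vector"
  assumes "open S" "\<And>x. x \<in> S \<Longrightarrow> linear (P x)" "\<And>u. smooth_on S (\<lambda>x. P x u)" "smooth_on S Z"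
  shows "smooth_on S (\<lambda>x. P x (Z x))"
proof (rule smooth_on_cong[OF assms(1)])
  show "smooth_on S (\<lambda>x. \<Sum>b\<in>Basis. (Z x \<bullet> b) *\<^sub>R P x b)"
    using assms
    by (auto intro!: smooth_on_sum smooth_on_scaleR smooth_on_bounded_linear[OF _ bounded_linear_inner_left])
  show "x \<in> S \<Longrightarrow> (\<Sum>b\<in>Basis. (Z x \<bullet> b) *\<^sub>R P x b) = P x (Z x)" for x
    using linear_basis_expansion[OF assms(2)] by metis
qed

text \<open>Product rule with \<open>P\<close> known through its values on fixed vectors. Expanding
  \<open>Z z\<close> in \<open>Basis\<close> reduces it to finitely many of them; linearity
  throughout \<open>S\<close> also makes the derivative of \<open>P z u\<close> in \<open>z\<close>
  linear in \<open>u\<close>.\<close>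

lemma has_derivative_linear_family:
  fixes P :: "'a::real_normed_vector \<Rightarrow> 'b::euclidean_space \<Rightarrow> 'c::real_normed_vector"
  assumes "open S" "x \<in> S" "\<And>z. z \<in> S \<Longrightarrow> linear (P z)"
    and P: "\<And>u. (\<lambda>z. P z u) differentiable (at x)" and Z: "(Z has_derivative Z') (at x)"
  shows "((\<lambda>z. P z (Z z)) has_derivative (\<lambda>v. fd (\<lambda>z. P z (Z x)) x v + P x (Z' v))) (at x)"
proof -
  have fdP: "fd (\<lambda>z. P z u) x v = (\<Sum>b\<in>Basis. (u \<bullet> b) *\<^sub>R fd (\<lambda>z. P z b) x v)" for u v
  proof -
    have "((\<lambda>z. \<Sum>b\<in>Basis. (u \<bullet> b) *\<^sub>R P z b) has_derivative
        (\<lambda>v. \<Sum>b\<in>Basis. (u \<bullet> b) *\<^sub>R fd (\<lambda>z. P z b) x v)) (at x)"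
      by (intro has_derivative_sum has_derivative_scaleR_right has_fd P)
    moreover have "fd (\<lambda>z. P z u) x = fd (\<lambda>z. \<Sum>b\<in>Basis. (u \<bullet> b) *\<^sub>R P z b) x"
      by (rule fd_cong_open[OF assms(1,2)]) (rule linear_basis_expansion[OF assms(3)])
    ultimately show ?thesis by (simp add: fd_eq)
  qed
  have "((\<lambda>z. \<Sum>b\<in>Basis. (Z z \<bullet> b) *\<^sub>R P z b) has_derivative
      (\<lambda>v. \<Sum>b\<in>Basis. (Z x \<bullet> b) *\<^sub>R fd (\<lambda>z. P z b) x v + (Z' v \<bullet> b) *\<^sub>R P x b)) (at x)"
    by (intro has_derivative_sum has_derivative_scaleR[OF has_derivative_inner_left[OF Z] has_fd[OF P]])
  moreover have "(\<lambda>v. \<Sum>b\<in>Basis. (Z x \<bullet> b) *\<^sub>R fd (\<lambda>z. P z b) x v + (Z' v \<bullet> b) *\<^sub>R P x b) =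
      (\<lambda>v. fd (\<lambda>z. P z (Z x)) x v + P x (Z' v))"
  proof
    fix v
    show "(\<Sum>b\<in>Basis. (Z x \<bullet> b) *\<^sub>R fd (\<lambda>z. P z b) x v + (Z' v \<bullet> b) *\<^sub>R P x b) =
        fd (\<lambda>z. P z (Z x)) x v + P x (Z' v)"
      by (simp only: fdP[of "Z x"] linear_basis_expansion[OF assms(3)[OF assms(2)], of "Z' v"] sum.distrib)
  qed
  ultimately have "((\<lambda>z. \<Sum>b\<in>Basis. (Z z \<bullet> b) *\<^sub>R P z b) has_derivative
      (\<lambda>v. fd (\<lambda>z. P z (Z x)) x v + P x (Z' v))) (at x)" by simp
  then show ?thesis
    by (rule has_derivative_transform_within_open[OF _ assms(1,2)])
      (metis linear_basis_expansion[OF assms(3)])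
qed

lemma bilinear_linear_left: "bilinear h \<Longrightarrow> linear (\<lambda>u. h u v)"
  and bilinear_linear_right: "bilinear h \<Longrightarrow> linear (h u)"
  by (auto simp: bilinear_def)

lemma smooth_on_bilinear_family:
  fixes G :: "'a::real_normed_vector \<Rightarrow> 'b::euclidean_space \<Rightarrow> 'd::euclidean_space \<Rightarrow> 'c::real_normed_vector"
  assumes "open S" "\<And>x. x \<in> S \<Longrightarrow> bilinear (G x)" "\<And>u v. smooth_on S (\<lambda>x. G x u v)"
    "smooth_on S Z" "smooth_on S W"
  shows "smooth_on S (\<lambda>x. G x (Z x) (W x))"
proof (rule smooth_on_linear_family[OF assms(1) _ _ assms(5), where P = "\<lambda>x. G x (Z x)"])
  show "smooth_on S (\<lambda>x. G x (Z x) u)" for u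
    by (rule smooth_on_linear_family[OF assms(1) _ _ assms(4), where P = "\<lambda>x z. G x z u"])
      (use assms(3) in \<open>auto intro: bilinear_linear_left assms(2)\<close>)
qed (use assms(2) bilinear_linear_right in auto)

lemma has_derivative_bilinear_family:
  fixes G :: "'a::real_normed_vector \<Rightarrow> 'b::euclidean_space \<Rightarrow> 'd::euclidean_space \<Rightarrow> 'c::real_normed_vector"
  assumes S: "open S" "x \<in> S" and G: "\<And>z. z \<in> S \<Longrightarrow> bilinear (G z)"
    and dG: "\<And>u v. (\<lambda>z. G z u v) differentiable (at x)"
    and Z: "(Z has_derivative Z') (at x)" and W: "(W has_derivative W') (at x)"
  shows "((\<lambda>z. G z (Z z) (W z)) has_derivative
      (\<lambda>v. fd (\<lambda>z. G z (Z x) (W x)) x v + G x (Z' v) (W x) + G x (Z x) (W' v))) (at x)"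
proof -
  have *: "((\<lambda>z. G z (Z z) w) has_derivative (\<lambda>v. fd (\<lambda>z. G z (Z x) w) x v + G x (Z' v) w)) (at x)" for w
    by (rule has_derivative_linear_family[OF S _ _ Z, where P = "\<lambda>z u. G z u w"])
      (use dG in \<open>auto intro: bilinear_linear_left G\<close>)
  have "((\<lambda>z. G z (Z z) (W z)) has_derivative
      (\<lambda>v. fd (\<lambda>z. G z (Z z) (W x)) x v + G x (Z x) (W' v))) (at x)"
    by (rule has_derivative_linear_family[OF S _ _ W, where P = "\<lambda>z. G z (Z z)"])
      (use G * bilinear_linear_right in \<open>auto simp: differentiable_def\<close>)
  then show ?thesis unfolding fd_eq[OF *] .
qed

section \<open>Symmetry of second derivatives\<close>

lemma second_difference_mean_value:
  fixes f :: "'a::real_normed_vector \<Rightarrow> real"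
  assumes "smooth_on S f" "0 < t"
    and S: "\<And>a b. 0 \<le> a \<Longrightarrow> a \<le> t \<Longrightarrow> 0 \<le> b \<Longrightarrow> b \<le> t \<Longrightarrow> x + a *\<^sub>R u + b *\<^sub>R v \<in> S"
  shows "\<exists>a b. 0 < a \<and> a < t \<and> 0 < b \<and> b < t \<and>
    f (x + t *\<^sub>R u + t *\<^sub>R v) - f (x + t *\<^sub>R u) - f (x + t *\<^sub>R v) + f x =
    t * (t * fd (\<lambda>z. fd f z u) (x + a *\<^sub>R u + b *\<^sub>R v) v)"
proof -
  have d1: "((\<lambda>a. h (x + a *\<^sub>R u + b *\<^sub>R v)) has_real_derivative fd h (x + a *\<^sub>R u + b *\<^sub>R v) u) (at a)"
    if "smooth_on S h" "0 \<le> a" "a \<le> t" "0 \<le> b" "b \<le> t" for h :: "'a \<Rightarrow> real" and a b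
  proof -
    have "(h has_derivative fd h (x + a *\<^sub>R u + b *\<^sub>R v)) (at (x + a *\<^sub>R u + b *\<^sub>R v))"
      using that S by (auto intro: smooth_on_has_fd)
    then have "((\<lambda>a. h (x + a *\<^sub>R u + b *\<^sub>R v)) has_derivative
        (\<lambda>s. fd h (x + a *\<^sub>R u + b *\<^sub>R v) (s *\<^sub>R u))) (at a)"
      by (intro has_derivative_compose[where g = h and f = "\<lambda>a. x + a *\<^sub>R u + b *\<^sub>R v"])
        (auto intro!: derivative_eq_intros)
    then show ?thesis
      using linear_cmul[OF smooth_on_linear_fd[OF that(1) S[OF that(2-5)]]]
      by (simp add: has_field_derivative_def mult.commute[of _ "fd _ _ _"])
  qed
  have d2: "((\<lambda>b. h (x + a *\<^sub>R u + b *\<^sub>R v)) has_real_derivative fd h (x + a *\<^sub>R u + b *\<^sub>R v) v) (at b)"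
    if "smooth_on S h" "0 \<le> a" "a \<le> t" "0 \<le> b" "b \<le> t" for h :: "'a \<Rightarrow> real" and a b
  proof -
    have "(h has_derivative fd h (x + a *\<^sub>R u + b *\<^sub>R v)) (at (x + a *\<^sub>R u + b *\<^sub>R v))"
      using that S by (auto intro: smooth_on_has_fd)
    then have "((\<lambda>b. h (x + a *\<^sub>R u + b *\<^sub>R v)) has_derivative
        (\<lambda>s. fd h (x + a *\<^sub>R u + b *\<^sub>R v) (s *\<^sub>R v))) (at b)"
      by (intro has_derivative_compose[where g = h and f = "\<lambda>b. x + a *\<^sub>R u + b *\<^sub>R v"])
        (auto intro!: derivative_eq_intros)
    then show ?thesis
      using linear_cmul[OF smooth_on_linear_fd[OF that(1) S[OF that(2-5)]]]
      by (simp add: has_field_derivative_def mult.commute[of _ "fd _ _ _"])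
  qed
  \<comment> \<open>\<open>p\<close> is the difference across the \<open>v\<close> side of the
    parallelogram. The mean value theorem is applied to it along \<open>u\<close>, then along
    \<open>v\<close> to the derivative that results. The summand \<open>0 *\<^sub>R v\<close> brings
    the terms into the shape of \<open>d1\<close>.\<close>
  define p where "p a = f (x + a *\<^sub>R u + t *\<^sub>R v) - f (x + a *\<^sub>R u + 0 *\<^sub>R v)" for a
  have "\<exists>a>0. a < t \<and> p t - p 0 =
      (t - 0) * (fd f (x + a *\<^sub>R u + t *\<^sub>R v) u - fd f (x + a *\<^sub>R u + 0 *\<^sub>R v) u)"
    unfolding p_def by (rule MVT2[OF assms(2)], intro DERIV_diff d1) (use assms(1,2) in auto)
  then obtain a where a: "0 < a" "a < t"
    "p t - p 0 = t * (fd f (x + a *\<^sub>R u + t *\<^sub>R v) u - fd f (x + a *\<^sub>R u + 0 *\<^sub>R v) u)" by auto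
  have "\<exists>b>0. b < t \<and> fd f (x + a *\<^sub>R u + t *\<^sub>R v) u - fd f (x + a *\<^sub>R u + 0 *\<^sub>R v) u =
      (t - 0) * fd (\<lambda>z. fd f z u) (x + a *\<^sub>R u + b *\<^sub>R v) v"
    by (rule MVT2[OF assms(2)]) (use assms a d2[OF smooth_on_fd] in auto)
  then obtain b where "0 < b" "b < t" "fd f (x + a *\<^sub>R u + t *\<^sub>R v) u - fd f (x + a *\<^sub>R u + 0 *\<^sub>R v) u =
      t * fd (\<lambda>z. fd f z u) (x + a *\<^sub>R u + b *\<^sub>R v) v" by auto
  with a show ?thesis by (auto simp: p_def algebra_simps)
qed

text \<open>The second difference over a small parallelogram is symmetric in \<open>u\<close> and
  \<open>v\<close>, and by the mean value theorem it is \<open>t * t\<close> times either mixed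
  derivative at some nearby point. Continuity of both at \<open>x\<close> then excludes a gap
  between them.\<close>

lemma second_derivative_symmetric_real:
  fixes f :: "'a::real_normed_vector \<Rightarrow> real"
  assumes "open S" "smooth_on S f" "x \<in> S"
  shows "fd (\<lambda>z. fd f z u) x v = fd (\<lambda>z. fd f z v) x u"
proof (rule ccontr)
  assume ne: "\<not> ?thesis"
  let ?A = "\<lambda>z. fd (\<lambda>z. fd f z u) z v" and ?B = "\<lambda>z. fd (\<lambda>z. fd f z v) z u"
  \<comment> \<open>Half the gap: two errors smaller than \<open>e\<close> cannot bridge it.\<close>
  define e where "e = \<bar>?A x - ?B x\<bar> / 2"
  have e: "e > 0" using ne by (simp add: e_def)
  have near: "\<exists>d>0. \<forall>z. dist z x < d \<longrightarrow> z \<in> S \<and> \<bar>h z - h x\<bar> < e" if "smooth_on S h" for h :: "'a \<Rightarrow> real"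
  proof -
    have "isCont h x"
      using smooth_on_continuous_on[OF that] assms(1,3) continuous_on_eq_continuous_at by blast
    then obtain d where "d > 0" "\<And>z. dist z x < d \<Longrightarrow> \<bar>h z - h x\<bar> < e"
      using e by (auto simp: continuous_at_eps_delta dist_real_def)
    moreover obtain d' where "d' > 0" "\<And>z. dist z x < d' \<Longrightarrow> z \<in> S"
      using assms(1,3) by (meson open_dist)
    ultimately show ?thesis by (intro exI[of _ "min d d'"]) auto
  qed
  obtain d1 where d1: "d1 > 0" "\<And>z. dist z x < d1 \<Longrightarrow> z \<in> S \<and> \<bar>?A z - ?A x\<bar> < e"
    using near[OF smooth_on_fd[OF smooth_on_fd[OF assms(2)]]] by blast
  obtain d2 where d2: "d2 > 0" "\<And>z. dist z x < d2 \<Longrightarrow> z \<in> S \<and> \<bar>?B z - ?B x\<bar> < e"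
    using near[OF smooth_on_fd[OF smooth_on_fd[OF assms(2)]]] by blast
  \<comment> \<open>\<open>t\<close> is chosen so that the whole parallelogram lies in both balls.
    The summand 1 keeps \<open>N\<close> positive if \<open>u\<close> and \<open>v\<close> are zero;
    the factor 1/2 in \<open>t\<close> makes \<open>t * N < min d1 d2\<close> strict.\<close>
  define N where "N = norm u + norm v + 1"
  have N: "N > 0" unfolding N_def by (smt (verit) norm_ge_zero)
  define t where "t = min d1 d2 / N / 2"
  have t: "t > 0" using N d1 d2 by (simp add: t_def)
  have tN: "t * N < min d1 d2" using N d1(1) d2(1) by (simp add: t_def min_def)
  have close: "dist (x + a *\<^sub>R u + b *\<^sub>R v) x < min d1 d2"
    if "0 \<le> a" "a \<le> t" "0 \<le> b" "b \<le> t" for a b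
  proof -
    have "dist (x + a *\<^sub>R u + b *\<^sub>R v) x \<le> a * norm u + b * norm v"
      using that norm_triangle_ineq[of "a *\<^sub>R u" "b *\<^sub>R v"] by (simp add: dist_norm add.assoc)
    also have "\<dots> \<le> t * norm u + t * norm v"
      using that by (intro add_mono mult_right_mono) auto
    also have "\<dots> \<le> t * N" using t by (simp add: N_def algebra_simps)
    finally show ?thesis using tN by linarith
  qed
  obtain a b where ab: "0 < a" "a < t" "0 < b" "b < t"
    "f (x + t *\<^sub>R u + t *\<^sub>R v) - f (x + t *\<^sub>R u) - f (x + t *\<^sub>R v) + f x = t * (t * ?A (x + a *\<^sub>R u + b *\<^sub>R v))"
    using second_difference_mean_value[OF assms(2) t, of x u v] close d1(2) by auto
  have close': "dist (x + b *\<^sub>R v + a *\<^sub>R u) x < min d1 d2"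
    if "0 \<le> a" "a \<le> t" "0 \<le> b" "b \<le> t" for a b
    using close[OF that] by (simp add: algebra_simps)
  obtain a' b' where ab': "0 < a'" "a' < t" "0 < b'" "b' < t"
    "f (x + t *\<^sub>R v + t *\<^sub>R u) - f (x + t *\<^sub>R v) - f (x + t *\<^sub>R u) + f x = t * (t * ?B (x + a' *\<^sub>R v + b' *\<^sub>R u))"
    using second_difference_mean_value[OF assms(2) t, of x v u] close' d1(2) by auto
  have "t * (t * ?A (x + a *\<^sub>R u + b *\<^sub>R v)) = t * (t * ?B (x + a' *\<^sub>R v + b' *\<^sub>R u))"
    using ab(5) ab'(5) by (simp add: algebra_simps)
  then have "?A (x + a *\<^sub>R u + b *\<^sub>R v) = ?B (x + a' *\<^sub>R v + b' *\<^sub>R u)" using t by simp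
  moreover have "\<bar>?A (x + a *\<^sub>R u + b *\<^sub>R v) - ?A x\<bar> < e" using close[of a b] ab d1(2) by auto
  moreover have "\<bar>?B (x + a' *\<^sub>R v + b' *\<^sub>R u) - ?B x\<bar> < e" using close'[of b' a'] ab' d2(2) by auto
  ultimately show False unfolding e_def by argo
qed

lemma second_derivative_symmetric:
  fixes f :: "'a::real_normed_vector \<Rightarrow> 'b::euclidean_space"
  assumes "open S" "smooth_on S f" "x \<in> S"
  shows "fd (\<lambda>z. fd f z u) x v = fd (\<lambda>z. fd f z v) x u"
proof (rule euclidean_eqI)
  fix b :: 'b assume "b \<in> Basis"
  have sm: "smooth_on S (\<lambda>z. f z \<bullet> b)"
    by (rule smooth_on_bounded_linear[OF assms(1) bounded_linear_inner_left assms(2)])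
  have 1: "fd (\<lambda>z. h z \<bullet> b) z w = fd h z w \<bullet> b" if "smooth_on S h" "z \<in> S" for h :: "'a \<Rightarrow> 'b" and z w
    using fd_eq[OF has_derivative_inner_left[OF smooth_on_has_fd[OF that], of b]] by simp
  have 2: "fd (\<lambda>z. fd (\<lambda>z. f z \<bullet> b) z w) x w' = fd (\<lambda>z. fd f z w) x w' \<bullet> b" for w w'
  proof -
    have "fd (\<lambda>z. fd (\<lambda>z. f z \<bullet> b) z w) x = fd (\<lambda>z. fd f z w \<bullet> b) x"
      by (rule fd_cong_open[OF assms(1,3)]) (simp add: 1[OF assms(2)])
    then show ?thesis using 1[OF smooth_on_fd[OF assms(2)] assms(3)] by simp
  qed
  show "fd (\<lambda>z. fd f z u) x v \<bullet> b = fd (\<lambda>z. fd f z v) x u \<bullet> b"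
    using second_derivative_symmetric_real[OF assms(1) sm assms(3), of u v] by (simp add: 2)
qed

section \<open>Hermitian linear algebra and determinants\<close>

lemma J_add: "J (u + v) = J u + J v"
  and J_diff: "J (u - v) = J u - J v"
  and J_minus: "J (- v) = - J v"
  and J_scaleR: "J (r *\<^sub>R v) = r *\<^sub>R J v"
  and J_J: "J (J v) = - v"
  and J_0: "J 0 = 0"
  by (simp_all add: J_def vec_eq_iff algebra_simps)

lemma linear_J: "linear J"
  by (simp add: linear_iff J_add J_scaleR)

lemma J_sum: "J (\<Sum>i\<in>I. f i) = (\<Sum>i\<in>I. J (f i))"
  by (rule linear_sum[OF linear_J])

lemma scale_eq: "c *s v = Re c *\<^sub>R v + Im c *\<^sub>R J v"
  by (simp add: J_def vec_eq_iff complex_eq_iff)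

lemma linear_complex_linear:
  assumes "linear f" "\<And>v. f (J v) = J (f v)"
  shows "f (c *s v) = c *s f v"
  by (simp add: scale_eq linear_add[OF assms(1)] linear_cmul[OF assms(1)] assms(2))

section \<open>Orthonormal and unitary families for one inner product\<close>

locale inner_prod =
  fixes g :: "'v::euclidean_space \<Rightarrow> 'v \<Rightarrow> real"
  assumes bilin: "bilinear g" and sym: "g u v = g v u" and pos: "v \<noteq> 0 \<Longrightarrow> 0 < g v v"
begin

lemmas g_simps = bilinear_ladd[OF bilin] bilinear_radd[OF bilin] bilinear_lsub[OF bilin]
  bilinear_rsub[OF bilin] bilinear_lmul[OF bilin] bilinear_rmul[OF bilin] bilinear_lneg[OF bilin]
  bilinear_rneg[OF bilin] bilinear_lzero[OF bilin] bilinear_rzero[OF bilin]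

lemma g_sum_left: "g (\<Sum>i\<in>I. f i) v = (\<Sum>i\<in>I. g (f i) v)"
  by (rule linear_sum[OF bilinear_linear_left[OF bilin]])

lemma g_sum_right: "g v (\<Sum>i\<in>I. f i) = (\<Sum>i\<in>I. g v (f i))"
  by (rule linear_sum[OF bilinear_linear_right[OF bilin]])

lemma g_eq_0: "g v v = 0 \<longleftrightarrow> v = 0"
  using pos[of v] g_simps by force

definition orthonormal :: "'i set \<Rightarrow> ('i \<Rightarrow> 'v) \<Rightarrow> bool" where
  "orthonormal I F \<longleftrightarrow> (\<forall>i\<in>I. \<forall>j\<in>I. g (F i) (F j) = (if i = j then 1 else 0))"

lemma orthonormal_inj: "orthonormal I F \<Longrightarrow> inj_on F I"
  unfolding orthonormal_def inj_on_def by (metis zero_neq_one)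

lemma orthonormal_coeff:
  assumes "orthonormal I F" "finite I" "j \<in> I"
  shows "g (\<Sum>i\<in>I. c i *\<^sub>R F i) (F j) = c j"
proof -
  have "g (\<Sum>i\<in>I. c i *\<^sub>R F i) (F j) = (\<Sum>i\<in>I. if i = j then c i else 0)"
    unfolding g_sum_left using assms by (intro sum.cong) (auto simp: g_simps orthonormal_def)
  then show ?thesis using assms by simp
qed

lemma orthonormal_independent:
  assumes "orthonormal I F" "finite I"
  shows "independent (F ` I)"
proof
  assume "dependent (F ` I)"
  then obtain u v where u: "(\<Sum>v\<in>F ` I. u v *\<^sub>R v) = 0" and v: "v \<in> F ` I" "u v \<noteq> 0"
    using dependent_finite[of "F ` I"] assms(2) by auto
  have "(\<Sum>i\<in>I. u (F i) *\<^sub>R F i) = 0"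
    using u by (simp add: sum.reindex[OF orthonormal_inj[OF assms(1)]])
  then have "u (F j) = 0" if "j \<in> I" for j
    using orthonormal_coeff[OF assms that, of "\<lambda>i. u (F i)"] by (simp add: g_simps)
  then show False using v by auto
qed

text \<open>Membership in the span is phrased as being fixed by the projection formula, so that it
  can be used as an expansion with explicit coefficients.\<close>

lemma orthonormal_span:
  assumes "orthonormal I F" "finite I"
  shows "span (F ` I) = {z. z = (\<Sum>i\<in>I. g z (F i) *\<^sub>R F i)}"
proof safe
  fix z assume "z \<in> span (F ` I)"
  then obtain u where "z = (\<Sum>v\<in>F ` I. u v *\<^sub>R v)"
    using assms(2) by (auto simp: span_finite)
  then have z: "z = (\<Sum>i\<in>I. u (F i) *\<^sub>R F i)"
    by (simp add: sum.reindex[OF orthonormal_inj[OF assms(1)]])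
  show "z = (\<Sum>i\<in>I. g z (F i) *\<^sub>R F i)"
    using orthonormal_coeff[OF assms, of _ "\<lambda>i. u (F i)"] z by (metis (no_types, lifting) sum.cong)
next
  fix z assume "z = (\<Sum>i\<in>I. g z (F i) *\<^sub>R F i)"
  also have "\<dots> \<in> span (F ` I)" by (intro span_sum span_scale span_base) auto
  finally show "z \<in> span (F ` I)" .
qed

lemma orthonormal_basis_expansion:
  assumes "orthonormal I F" "finite I" "card I = DIM('v)"
  shows "z = (\<Sum>i\<in>I. g z (F i) *\<^sub>R F i)"
proof -
  have "UNIV \<subseteq> span (F ` I)"
    by (rule card_ge_dim_independent[OF _ orthonormal_independent[OF assms(1,2)]])
      (simp_all add: card_image[OF orthonormal_inj[OF assms(1)]] assms(3))
  then show ?thesis using orthonormal_span[OF assms(1,2)] by blast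
qed

text \<open>Fewer vectors than the dimension leave some \<open>X\<close> outside their span; its
  residual after projection is the seed of the next Gram-Schmidt vector.\<close>

lemma orthonormal_extend:
  assumes "orthonormal I F" "finite I" "card I < DIM('v)"
  obtains X where "X - (\<Sum>i\<in>I. g X (F i) *\<^sub>R F i) \<noteq> 0"
proof -
  have "dim (span (F ` I)) \<le> card (F ` I)"
    by (metis assms(2) dim_le_card' dim_span finite_imageI)
  then have "span (F ` I) \<noteq> UNIV"
    using assms(2,3) card_image_le[of I F] by (metis dim_UNIV le_trans not_le)
  then show ?thesis using that orthonormal_span[OF assms(1,2)] by auto
qed

lemma orth_proj_eqI:
  assumes "w \<in> S" "subspace S" "\<And>z. z \<in> S \<Longrightarrow> g (v - w) z = 0"
  shows "orth_proj g S v = w"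
  unfolding orth_proj_def
proof (rule the_equality)
  fix w' assume w': "w' \<in> S \<and> (\<forall>z\<in>S. g (v - w') z = 0)"
  then have "w - w' \<in> S" using assms by (simp add: subspace_diff)
  then have "g (v - w') (w - w') - g (v - w) (w - w') = 0" using w' assms by simp
  then have "g (w - w') (w - w') = 0" by (simp add: g_simps)
  then show "w' = w" by (simp add: g_eq_0)
qed (use assms in auto)

end

locale hermitian = inner_prod g for g :: "complex ^ 'n::finite \<Rightarrow> complex ^ 'n \<Rightarrow> real" +
  assumes g_J: "g (J u) (J v) = g u v"
begin

lemma g_J_left: "g (J u) v = - g u (J v)"
  using g_J[of u "J v"] by (simp add: J_J g_simps)

lemma g_J_self: "g u (J u) = 0"
  using g_J_left[of u u] sym[of u "J u"] by simp

text \<open>The sign of the imaginary part makes \<open>h\<close> complex linear in the first slot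
  and antilinear in the second.\<close>

definition h :: "complex ^ 'n \<Rightarrow> complex ^ 'n \<Rightarrow> complex" where
  "h z w = Complex (g z w) (g z (J w))"

lemma Re_h [simp]: "Re (h z w) = g z w" and Im_h [simp]: "Im (h z w) = g z (J w)"
  by (simp_all add: h_def)

lemma h_add_left: "h (z + z') w = h z w + h z' w"
  and h_diff_left: "h (z - z') w = h z w - h z' w"
  and h_add_right: "h z (w + w') = h z w + h z w'"
  and h_scaleR_left: "h (r *\<^sub>R z) w = of_real r * h z w"
  and h_0_left: "h 0 w = 0" and h_0_right: "h z 0 = 0"
  and h_J_left: "h (J z) w = \<i> * h z w"
  by (simp_all add: complex_eq_iff g_simps J_add J_J J_0 g_J g_J_left)

lemma h_scale_left: "h (c *s z) w = c * h z w"
  by (simp add: complex_eq_iff scale_eq g_simps g_J g_J_left J_J)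

lemma h_cnj: "cnj (h z w) = h w z"
  using g_J_left[of w z] by (simp add: complex_eq_iff sym[of w z] sym[of z "J w"])

lemma h_scale_right: "h z (c *s w) = cnj c * h z w"
  using h_scale_left[of c w z] h_cnj[of z w] h_cnj[of z "c *s w"]
  by (metis complex_cnj_cnj complex_cnj_mult)

lemma h_sum_left: "h (\<Sum>i\<in>I. f i) w = (\<Sum>i\<in>I. h (f i) w)"
  by (induction I rule: infinite_finite_induct) (auto simp: h_add_left h_0_left)

lemma h_sum_right: "h w (\<Sum>i\<in>I. f i) = (\<Sum>i\<in>I. h w (f i))"
  by (induction I rule: infinite_finite_induct) (auto simp: h_add_right h_0_right)

lemma linear_h_left: "linear (\<lambda>z. h z w)"
  by (simp add: linear_iff h_add_left h_scaleR_left scaleR_conv_of_real[where 'a = complex])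

definition unitary :: "'i set \<Rightarrow> ('i \<Rightarrow> complex ^ 'n) \<Rightarrow> bool" where
  "unitary I e \<longleftrightarrow> (\<forall>i\<in>I. \<forall>j\<in>I. h (e i) (e j) = (if i = j then 1 else 0))"

lemma unitary_iff:
  "unitary I e \<longleftrightarrow>
    (\<forall>i\<in>I. \<forall>j\<in>I. g (e i) (e j) = (if i = j then 1 else 0) \<and> g (e i) (J (e j)) = 0)"
  unfolding unitary_def by (auto simp: complex_eq_iff)

text \<open>The family of all \<open>e\<^sub>i\<close> and \<open>J e\<^sub>i\<close>, with
  \<open>True\<close> marking the \<open>J\<close> member; it reduces unitary families to real
  orthonormal ones of twice the size.\<close>

definition realify :: "('i \<Rightarrow> complex ^ 'n) \<Rightarrow> 'i \<times> bool \<Rightarrow> complex ^ 'n" where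
  "realify e p = (if snd p then J (e (fst p)) else e (fst p))"

lemma unitary_orthonormal: "unitary I e \<Longrightarrow> orthonormal (I \<times> UNIV) (realify e)"
  unfolding unitary_iff orthonormal_def realify_def by (auto simp: g_J g_J_left J_J g_simps)

lemma sum_realify:
  "(\<Sum>p\<in>I \<times> UNIV. g z (realify e p) *\<^sub>R realify e p) = (\<Sum>i\<in>I. h z (e i) *s e i)"
proof -
  have "(\<Sum>p\<in>I \<times> UNIV. g z (realify e p) *\<^sub>R realify e p) =
      (\<Sum>i\<in>I. \<Sum>b\<in>UNIV. g z (realify e (i, b)) *\<^sub>R realify e (i, b))"
    by (simp add: sum.cartesian_product)
  then show ?thesis by (simp add: UNIV_bool realify_def scale_eq add.commute)
qed

lemma unitary_expansion:
  assumes "unitary I e" "finite I" "card I = CARD('n)"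
  shows "z = (\<Sum>i\<in>I. h z (e i) *s e i)"
  using orthonormal_basis_expansion[OF unitary_orthonormal[OF assms(1)], of z] assms
  by (simp add: sum_realify)

lemma unitary_coeff:
  assumes "unitary I e" "finite L" "L \<subseteq> I" "j \<in> I"
  shows "h (\<Sum>i\<in>L. c i *s e i) (e j) = (if j \<in> L then c j else 0)"
proof -
  have "h (\<Sum>i\<in>L. c i *s e i) (e j) = (\<Sum>i\<in>L. if i = j then c i else 0)"
    unfolding h_sum_left using assms by (intro sum.cong) (auto simp: h_scale_left unitary_def)
  then show ?thesis using assms by simp
qed

text \<open>\<open>orth_proj\<close> is the real orthogonal projection for \<open>g\<close>, but
  orthogonality to a complex span means the same for \<open>g\<close> and for \<open>h\<close>, so
  the complex expansion computes it. In this form the projection is visibly complex linear.\<close>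

lemma orth_proj_unitary:
  assumes "unitary L e" "finite L" "S = {\<Sum>i\<in>L. c i *s e i | c. True}"
  shows "orth_proj g S z = (\<Sum>i\<in>L. h z (e i) *s e i)"
proof (rule orth_proj_eqI)
  show "subspace S"
    unfolding subspace_def
  proof (intro conjI ballI allI)
    show "0 \<in> S" unfolding assms(3) by (auto intro!: exI[of _ "\<lambda>_. 0"])
  next
    fix x y assume "x \<in> S" "y \<in> S"
    then obtain c d where "x = (\<Sum>i\<in>L. c i *s e i)" "y = (\<Sum>i\<in>L. d i *s e i)" using assms(3) by auto
    then have "x + y = (\<Sum>i\<in>L. (c i + d i) *s e i)"
      by (simp add: sum.distrib[symmetric] vector_sadd_rdistrib)
    then show "x + y \<in> S" unfolding assms(3) by (intro CollectI exI[of _ "\<lambda>i. c i + d i"]) auto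
  next
    fix r x assume "x \<in> S"
    then obtain c where "x = (\<Sum>i\<in>L. c i *s e i)" using assms(3) by auto
    then have "r *\<^sub>R x = (\<Sum>i\<in>L. (of_real r * c i) *s e i)"
      using scale_eq[of "of_real r" x] by (simp add: vec.scale_sum_right)
    then show "r *\<^sub>R x \<in> S" unfolding assms(3) by (intro CollectI exI[of _ "\<lambda>i. of_real r * c i"]) auto
  qed
next
  fix y assume "y \<in> S"
  then obtain c where "y = (\<Sum>i\<in>L. c i *s e i)" using assms(3) by auto
  moreover have "h (z - (\<Sum>i\<in>L. h z (e i) *s e i)) (e j) = 0" if "j \<in> L" for j
    using unitary_coeff[OF assms(1,2) _ that] that by (simp add: h_diff_left)
  ultimately have "h (z - (\<Sum>i\<in>L. h z (e i) *s e i)) y = 0"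
    by (simp add: h_sum_right h_scale_right)
  then show "g (z - (\<Sum>i\<in>L. h z (e i) *s e i)) y = 0" by (metis Re_h zero_complex.sel(1))
next
  show "(\<Sum>i\<in>L. h z (e i) *s e i) \<in> S"
    unfolding assms(3) by (intro CollectI exI[of _ "\<lambda>i. h z (e i)"]) simp
qed

end

text \<open>The map \<open>v \<mapsto> (v - \<i> J v) / 2\<close>, a complex linear isomorphism from
  the tangent space with \<open>J\<close> onto its (1,0) part. Through it \<open>u\<^sub>j\<close>
  is represented by \<open>e\<^sub>j\<close>, and complex coefficients act by
  \<open>*s\<close>.\<close>

definition part10 :: "complex ^ 'n \<Rightarrow> (complex ^ 'n) \<times> (complex ^ 'n)" where
  "part10 v = ((1/2) *\<^sub>R v, - ((1/2) *\<^sub>R J v))"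

lemma u_frame_part10: "u_frame e j = part10 (e j)"
  by (simp add: u_frame_def part10_def)

lemma part10_add: "part10 (u + v) = part10 u + part10 v"
  and part10_0: "part10 0 = 0"
  by (simp_all add: part10_def J_add J_0 algebra_simps zero_prod_def)

lemma part10_sum: "part10 (\<Sum>i\<in>I. f i) = (\<Sum>i\<in>I. part10 (f i))"
  by (induction I rule: infinite_finite_induct) (auto simp: part10_add part10_0)

lemma cscale_part10: "cscale c (part10 v) = part10 (c *s v)"
  by (simp add: cscale_def part10_def scale_eq J_add J_scaleR J_J algebra_simps)

lemma part10_inject: "part10 u = part10 v \<longleftrightarrow> u = v"
  by (auto simp: part10_def)

lemma cext_part10:
  assumes "linear f" "\<And>v. f (J v) = J (f v)"
  shows "cext f (part10 v) = part10 (f v)"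
  by (simp add: cext_def part10_def linear_cmul[OF assms(1)] linear_neg[OF assms(1)] assms(2))

lemma cpair_part10_sum:
  assumes "linear l"
  shows "cpair (part10 (\<Sum>i\<in>I. c i *s f i)) l = (\<Sum>i\<in>I. c i * cpair (part10 (f i)) l)"
proof -
  have add: "cpair (a + b) l = cpair a l + cpair b l" for a b
    by (simp add: cpair_def linear_add[OF assms] algebra_simps)
  have scale: "cpair (cscale c a) l = c * cpair a l" for c a
  proof -
    have "cpair (cscale c a) l = (of_real (Re c) + \<i> * of_real (Im c)) * cpair a l"
      by (simp add: cpair_def cscale_def linear_add[OF assms] linear_diff[OF assms]
          linear_cmul[OF assms] scaleR_conv_of_real[where 'a = complex] algebra_simps)
    then show ?thesis by (simp add: complex_eq[symmetric])
  qed
  have "cpair 0 l = 0" by (simp add: cpair_def linear_0[OF assms])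
  then have "cpair (\<Sum>i\<in>I. f i) l = (\<Sum>i\<in>I. cpair (f i) l)" for f
    by (induction I rule: infinite_finite_induct) (auto simp: add)
  then show ?thesis by (simp add: part10_sum cscale_part10[symmetric] scale)
qed

section \<open>Determinants of pairings\<close>

lemma wedge_repeated:
  assumes "finite I" "i \<in> I" "j \<in> I" "i \<noteq> j" "a i = a j"
  shows "wedge I pair a b = 0"
proof -
  let ?q = "Transposition.transpose i j"
  let ?t = "\<lambda>p. of_int (sign p) * (\<Prod>m\<in>I. pair (a m) (b (p m)))"
  have q: "?q permutes I" using assms by (intro permutes_swap_id)
  have aq: "a (?q m) = a m" for m using assms(5) by (auto simp: Transposition.transpose_def)
  \<comment> \<open>Swapping the two equal entries matches each permutation with one of opposite
    sign and otherwise equal term.\<close>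
  have "?t (p \<circ> ?q) = - ?t p" if "p permutes I" for p
  proof -
    have "permutation p" "permutation ?q" using that q assms(1) permutation_permutes by blast+
    then have "sign (p \<circ> ?q) = - sign p" using assms(4) by (simp add: sign_compose sign_swap_id)
    moreover have "(\<Prod>m\<in>I. pair (a m) (b ((p \<circ> ?q) m))) = (\<Prod>m\<in>I. pair (a m) (b (p m)))"
      using prod.permute[OF q, of "\<lambda>m. pair (a m) (b (p m))"] by (simp add: comp_def aq)
    ultimately show ?thesis by simp
  qed
  then have "wedge I pair a b = - wedge I pair a b"
    unfolding wedge_def
    by (subst sum_permutations_compose_right[OF q]) (simp add: sum_negf[symmetric])
  then show ?thesis by simp
qed

text \<open>Cramer's rule: once the replaced entry is expanded in the \<open>a \<beta>\<close>,
  every term with \<beta> different from \<alpha> repeats an entry. The expansion is stated through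
  the pairing, which lets one lemma serve complexified vectors and covectors alike.\<close>

lemma wedge_update:
  assumes "finite I" "\<alpha> \<in> I"
    and "\<And>j. j \<in> I \<Longrightarrow> pair z (b j) = (\<Sum>\<beta>\<in>I. c \<beta> * pair (a \<beta>) (b j))"
  shows "wedge I pair (a(\<alpha> := z)) b = c \<alpha> * wedge I pair a b"
proof -
  have split: "(\<Prod>i\<in>I. pair ((a(\<alpha> := y)) i) (b (p i))) =
      pair y (b (p \<alpha>)) * (\<Prod>i\<in>I - {\<alpha>}. pair (a i) (b (p i)))" for y p
    by (subst prod.remove[OF assms(1,2)]) (auto intro!: prod.cong)
  have "wedge I pair (a(\<alpha> := z)) b =
      (\<Sum>p | p permutes I. \<Sum>\<beta>\<in>I. c \<beta> * (of_int (sign p) * (\<Prod>i\<in>I. pair ((a(\<alpha> := a \<beta>)) i) (b (p i)))))"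
    unfolding wedge_def split
  proof (rule sum.cong[OF refl])
    fix p assume "p \<in> {p. p permutes I}"
    then have "p \<alpha> \<in> I" using assms(2) by (simp add: permutes_in_image)
    then show "of_int (sign p) * (pair z (b (p \<alpha>)) * (\<Prod>i\<in>I - {\<alpha>}. pair (a i) (b (p i)))) =
        (\<Sum>\<beta>\<in>I. c \<beta> * (of_int (sign p) * (pair (a \<beta>) (b (p \<alpha>)) * (\<Prod>i\<in>I - {\<alpha>}. pair (a i) (b (p i))))))"
      by (simp add: assms(3) sum_distrib_left sum_distrib_right mult_ac)
  qed
  also have "\<dots> = (\<Sum>\<beta>\<in>I. c \<beta> * wedge I pair (a(\<alpha> := a \<beta>)) b)"
    unfolding wedge_def by (subst sum.swap) (simp add: sum_distrib_left)
  also have "\<dots> = (\<Sum>\<beta>\<in>I. if \<beta> = \<alpha> then c \<alpha> * wedge I pair a b else 0)"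
    using wedge_repeated[OF assms(1,2), of _ "a(\<alpha> := a _)"] by (intro sum.cong) auto
  finally show ?thesis using assms by simp
qed

text \<open>The Leibniz sum of a determinant picks out the diagonal of the coefficient matrix; this
  is why the connection forms of both determinant bundles are traces.\<close>

lemma wedge_trace:
  assumes "finite I" "\<And>\<alpha> j. \<alpha> \<in> I \<Longrightarrow> j \<in> I \<Longrightarrow> pair (z \<alpha>) (b j) = (\<Sum>\<beta>\<in>I. c \<beta> \<alpha> * pair (a \<beta>) (b j))"
  shows "(\<Sum>\<alpha>\<in>I. wedge I pair (a(\<alpha> := z \<alpha>)) b) = (\<Sum>\<alpha>\<in>I. c \<alpha> \<alpha>) * wedge I pair a b"
  using wedge_update[OF assms(1), where pair = pair and a = a and b = b] assms(2)
  by (simp add: sum_distrib_right)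

section \<open>Orthonormal frames and connections in a chart\<close>

text \<open>A constant vector \<open>X\<close> whose residual is nonzero at \<open>x0\<close> has
  nonzero residual nearby; normalising the residual there gives the next frame vector.\<close>

lemma gram_schmidt_step:
  fixes G :: "'f::euclidean_space \<Rightarrow> 'v::euclidean_space \<Rightarrow> 'v \<Rightarrow> real"
  assumes S: "open S" "x0 \<in> S" and G: "\<And>x. x \<in> S \<Longrightarrow> inner_prod (G x)"
    and Gs: "\<And>u v. smooth_on S (\<lambda>x. G x u v)"
    and I: "finite I" "card I < DIM('v)" and F: "\<And>i. i \<in> I \<Longrightarrow> smooth_on S (F i)"
    and on: "\<And>x. x \<in> S \<Longrightarrow> inner_prod.orthonormal (G x) I (\<lambda>i. F i x)"
  obtains T Z where "open T" "x0 \<in> T" "T \<subseteq> S" "smooth_on T Z"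
    "\<And>x. x \<in> T \<Longrightarrow> G x (Z x) (Z x) = 1" "\<And>x i. x \<in> T \<Longrightarrow> i \<in> I \<Longrightarrow> G x (Z x) (F i x) = 0"
proof -
  obtain X where X: "X - (\<Sum>i\<in>I. G x0 X (F i x0) *\<^sub>R F i x0) \<noteq> 0"
    by (rule inner_prod.orthonormal_extend[OF G[OF S(2)] on[OF S(2)] I])
  define Y where "Y x = X - (\<Sum>i\<in>I. G x X (F i x) *\<^sub>R F i x)" for x
  have bil: "bilinear (G x)" if "x \<in> S" for x using inner_prod.bilin[OF G[OF that]] .
  have Y: "smooth_on S Y"
    unfolding Y_def
    by (intro smooth_on_diff smooth_on_sum smooth_on_scaleR smooth_on_const F S(1)
        smooth_on_bilinear_family[where G = G, OF S(1) bil Gs])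
  define T where "T = S \<inter> Y -` (- {0})"
  have T: "open T"
    unfolding T_def by (intro continuous_open_preimage smooth_on_continuous_on Y S) auto
  have TS: "T \<subseteq> S" by (auto simp: T_def)
  have posY: "0 < G x (Y x) (Y x)" if "x \<in> T" for x
    using that inner_prod.pos[OF G] by (auto simp: T_def)
  define Z where "Z x = (G x (Y x) (Y x)) powr (-1/2) *\<^sub>R Y x" for x
  have YT: "smooth_on T Y" using Y TS by (rule smooth_on_subset)
  have "smooth_on T (\<lambda>x. G x (Y x) (Y x))"
    by (rule smooth_on_bilinear_family[where G = G, OF T bil smooth_on_subset[OF Gs TS] YT YT])
      (use TS in auto)
  then have Z: "smooth_on T Z"
    unfolding Z_def by (intro smooth_on_scaleR smooth_on_powr T posY YT)
  have Y_ortho: "G x (Y x) (F j x) = 0" if "x \<in> S" "j \<in> I" for x j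
    using inner_prod.orthonormal_coeff[OF G on I(1), of x j "\<lambda>i. G x X (F i x)"] that
    by (simp add: Y_def inner_prod.g_simps[OF G])
  show thesis
  proof (rule that[OF T _ TS Z])
    show "x0 \<in> T" using X S by (simp add: T_def Y_def)
  next
    fix x assume x: "x \<in> T"
    have "G x (Z x) (Z x) = (G x (Y x) (Y x)) powr (-1/2) * (G x (Y x) (Y x)) powr (-1/2) * G x (Y x) (Y x)"
      unfolding Z_def using x TS by (auto simp: inner_prod.g_simps[OF G])
    also have "\<dots> = 1"
      using posY[OF x] by (simp only: powr_add[symmetric]) (simp add: powr_minus)
    finally show "G x (Z x) (Z x) = 1" .
  next
    fix x i assume "x \<in> T" "i \<in> I"
    then show "G x (Z x) (F i x) = 0"
      using Y_ortho[of x i] TS inner_prod.g_simps(5)[OF G, of x] unfolding Z_def by auto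
  qed
qed

text \<open>Iteration of the Gram-Schmidt step, one index of \<open>L\<close> at a time, on
  shrinking neighbourhoods. The given members are kept as functions, so a tangent frame can be
  completed by normal vectors without being altered.\<close>

lemma orthonormal_frame_extend:
  fixes G :: "'f::euclidean_space \<Rightarrow> 'v::euclidean_space \<Rightarrow> 'v \<Rightarrow> real"
  assumes "finite L" "finite I" "I \<inter> L = {}" "card (I \<union> L) \<le> DIM('v)"
    and S: "open S" "x0 \<in> S" and G: "\<And>x. x \<in> S \<Longrightarrow> inner_prod (G x)"
    and Gs: "\<And>u v. smooth_on S (\<lambda>x. G x u v)"
    and F: "\<And>i. i \<in> I \<Longrightarrow> smooth_on S (F i)"
    and on: "\<And>x. x \<in> S \<Longrightarrow> inner_prod.orthonormal (G x) I (\<lambda>i. F i x)"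
  shows "\<exists>T F'. open T \<and> x0 \<in> T \<and> T \<subseteq> S \<and> (\<forall>i\<in>I \<union> L. smooth_on T (F' i)) \<and> (\<forall>i\<in>I. F' i = F i) \<and>
    (\<forall>x\<in>T. inner_prod.orthonormal (G x) (I \<union> L) (\<lambda>i. F' i x))"
  using assms(1,3,4)
proof (induction L)
  case empty
  then show ?case using S F on by (intro exI[of _ S] exI[of _ F]) auto
next
  case (insert a L)
  have c: "card (I \<union> insert a L) = Suc (card (I \<union> L))" using insert.hyps insert.prems(1) assms(2) by auto
  have "I \<inter> L = {}" "card (I \<union> L) \<le> DIM('v)" using insert.prems c by auto
  note IH = insert.IH[OF this]
  obtain T F' where T: "open T" "x0 \<in> T" "T \<subseteq> S" "\<forall>i\<in>I \<union> L. smooth_on T (F' i)"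
    "\<forall>i\<in>I. F' i = F i" "\<forall>x\<in>T. inner_prod.orthonormal (G x) (I \<union> L) (\<lambda>i. F' i x)"
    using IH by (elim exE conjE) (rule that)
  have GT: "inner_prod (G x)" if "x \<in> T" for x using G T that by auto
  obtain T' Z where Z: "open T'" "x0 \<in> T'" "T' \<subseteq> T" "smooth_on T' Z"
    "\<And>x. x \<in> T' \<Longrightarrow> G x (Z x) (Z x) = 1" "\<And>x i. x \<in> T' \<Longrightarrow> i \<in> I \<union> L \<Longrightarrow> G x (Z x) (F' i x) = 0"
    by (rule gram_schmidt_step[OF T(1,2) GT smooth_on_subset[OF Gs T(3)], where I = "I \<union> L" and F = F'])
      (use T(4,6) c insert.prems insert.hyps(1) assms(2) in auto)
  define F'' where "F'' = F'(a := Z)"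
  have "inner_prod.orthonormal (G x) (I \<union> insert a L) (\<lambda>i. F'' i x)" if x: "x \<in> T'" for x
  proof -
    interpret inner_prod "G x" using GT x Z by auto
    have "orthonormal (I \<union> L) (\<lambda>i. F' i x)" using T(6) Z(3) x by auto
    moreover have "G x (F' i x) (Z x) = 0" if "i \<in> I \<union> L" for i
      using Z(6)[OF x that] sym[of "F' i x" "Z x"] by simp
    ultimately show ?thesis
      using Z(5,6)[OF x] insert.hyps insert.prems(1) unfolding orthonormal_def F''_def by auto
  qed
  moreover have "\<forall>i\<in>I. F'' i = F i" using T insert by (auto simp: F''_def)
  moreover have "\<forall>i\<in>I \<union> insert a L. smooth_on T' (F'' i)"
    using T(4) Z(4) smooth_on_subset[OF _ Z(3)] by (auto simp: F''_def)
  ultimately show ?case using Z T by (intro exI[of _ T'] exI[of _ F'']) auto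
qed

text \<open>Gram-Schmidt is run on the real family of all \<open>e\<^sub>i\<close> and
  \<open>J e\<^sub>i\<close>. The new vector \<open>Z\<close> is orthogonal to all of them, and so
  is \<open>J Z\<close> by invariance of the metric; hence \<open>Z\<close> extends the unitary
  family.\<close>

lemma unitary_frame_extend:
  fixes G :: "'f::euclidean_space \<Rightarrow> complex ^ 'n::finite \<Rightarrow> complex ^ 'n \<Rightarrow> real"
  assumes "finite L" "finite I" "I \<inter> L = {}" "card (I \<union> L) \<le> CARD('n)"
    and S: "open S" "x0 \<in> S" and G: "\<And>x. x \<in> S \<Longrightarrow> hermitian (G x)"
    and Gs: "\<And>u v. smooth_on S (\<lambda>x. G x u v)"
    and F: "\<And>i. i \<in> I \<Longrightarrow> smooth_on S (e i)"
    and on: "\<And>x. x \<in> S \<Longrightarrow> hermitian.unitary (G x) I (\<lambda>i. e i x)"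
  shows "\<exists>T e'. open T \<and> x0 \<in> T \<and> T \<subseteq> S \<and> (\<forall>i\<in>I \<union> L. smooth_on T (e' i)) \<and> (\<forall>i\<in>I. e' i = e i) \<and>
    (\<forall>x\<in>T. hermitian.unitary (G x) (I \<union> L) (\<lambda>i. e' i x))"
  using assms(1,3,4)
proof (induction L)
  case empty
  then show ?case using S F on by (intro exI[of _ S] exI[of _ e]) auto
next
  case (insert a L)
  have c: "card (I \<union> insert a L) = Suc (card (I \<union> L))" using insert.hyps insert.prems(1) assms(2) by auto
  have "I \<inter> L = {}" "card (I \<union> L) \<le> CARD('n)" using insert.prems c by auto
  note IH = insert.IH[OF this]
  obtain T e' where T: "open T" "x0 \<in> T" "T \<subseteq> S" "\<forall>i\<in>I \<union> L. smooth_on T (e' i)"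
    "\<forall>i\<in>I. e' i = e i" "\<forall>x\<in>T. hermitian.unitary (G x) (I \<union> L) (\<lambda>i. e' i x)"
    using IH by (elim exE conjE) (rule that)
  have GT: "hermitian (G x)" if "x \<in> T" for x using G T that by auto
  define R where "R p x = (if snd p then J (e' (fst p) x) else e' (fst p) x)" for p x
  have R: "(\<lambda>p. R p x) = hermitian.realify (\<lambda>i. e' i x)" if "x \<in> T" for x
    by (rule ext) (simp add: R_def hermitian.realify_def[OF GT[OF that]])
  \<comment> \<open>The real dimension of \<open>complex ^ 'n\<close> is twice
    \<open>CARD('n)\<close>, which leaves room for a further vector.\<close>
  have cR: "card ((I \<union> L) \<times> (UNIV :: bool set)) < DIM(complex ^ 'n)"
    using c insert.prems by (simp add: card_cartesian_product)
  have sR: "smooth_on T (R p)" if "p \<in> (I \<union> L) \<times> UNIV" for p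
    using that T unfolding R_def by (cases "snd p") (auto intro!: smooth_on_linear[OF _ linear_J])
  have ip: "inner_prod (G x)" if "x \<in> T" for x
    using GT[OF that] by (simp add: hermitian_def)
  have oR: "inner_prod.orthonormal (G x) ((I \<union> L) \<times> UNIV) (\<lambda>p. R p x)" if "x \<in> T" for x
    unfolding R[OF that] using hermitian.unitary_orthonormal[OF GT[OF that]] T that by blast
  have fR: "finite ((I \<union> L) \<times> (UNIV :: bool set))" using insert.hyps assms(2) by simp
  obtain T' Z where Z: "open T'" "x0 \<in> T'" "T' \<subseteq> T" "smooth_on T' Z"
    "\<And>x. x \<in> T' \<Longrightarrow> G x (Z x) (Z x) = 1"
    "\<And>x p. x \<in> T' \<Longrightarrow> p \<in> (I \<union> L) \<times> UNIV \<Longrightarrow> G x (Z x) (R p x) = 0"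
    by (rule gram_schmidt_step[OF T(1,2) ip smooth_on_subset[OF Gs T(3)] fR cR sR oR], assumption+)
      (rule that)
  have Ze: "G x (Z x) (e' i x) = 0" "G x (Z x) (J (e' i x)) = 0" if "x \<in> T'" "i \<in> I \<union> L" for x i
    using Z(6)[OF that(1), of "(i, False)"] Z(6)[OF that(1), of "(i, True)"] that by (auto simp: R_def)
  define e'' where "e'' = e'(a := Z)"
  have "hermitian.unitary (G x) (I \<union> insert a L) (\<lambda>i. e'' i x)" if x: "x \<in> T'" for x
  proof -
    interpret hermitian "G x" using GT x Z by auto
    have "unitary (I \<union> L) (\<lambda>i. e' i x)" using T(6) Z(3) x by auto
    moreover have "G x (e' i x) (Z x) = 0" "G x (e' i x) (J (Z x)) = 0" if "i \<in> I \<union> L" for i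
      using Ze[OF x that] g_J_left[of "e' i x" "Z x"] sym[of "e' i x" "Z x"] sym[of "J (e' i x)" "Z x"]
      by simp_all
    ultimately show ?thesis
      using Z(5)[OF x] Ze[OF x] insert.hyps insert.prems(1) g_J_self
      unfolding unitary_iff e''_def by auto
  qed
  moreover have "\<forall>i\<in>I. e'' i = e i" using T insert by (auto simp: e''_def)
  moreover have "\<forall>i\<in>I \<union> insert a L. smooth_on T' (e'' i)"
    using T(4) Z(4) smooth_on_subset[OF _ Z(3)] by (auto simp: e''_def)
  ultimately show ?case using Z T by (intro exI[of _ T'] exI[of _ e'']) auto
qed

text \<open>The geometry of a coisotropic submanifold of a Kaehler manifold, read in one chart \<open>S\<close> of the
  submanifold and one ambient chart: \<open>G\<close> is the metric along the submanifold, \<open>C x v z\<close> the Christoffel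
  term of the pulled back connection, and \<open>P x\<close> the differential of the embedding.\<close>

locale coisotropic_chart =
  fixes S :: "'f::euclidean_space set"
    and G :: "'f \<Rightarrow> complex ^ 'n::finite \<Rightarrow> complex ^ 'n \<Rightarrow> real"
    and C :: "'f \<Rightarrow> 'f \<Rightarrow> complex ^ 'n \<Rightarrow> complex ^ 'n"
    and P :: "'f \<Rightarrow> 'f \<Rightarrow> complex ^ 'n"
    and k :: nat
  assumes open_S: "open S"
    and hermitian_G: "x \<in> S \<Longrightarrow> hermitian (G x)"
    and smooth_G: "smooth_on S (\<lambda>x. G x a b)"
    and bilinear_C: "x \<in> S \<Longrightarrow> bilinear (C x)"
    and smooth_C: "smooth_on S (\<lambda>x. C x v a)"
    and C_J: "x \<in> S \<Longrightarrow> C x v (J a) = J (C x v a)"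
    and metric: "x \<in> S \<Longrightarrow> fd (\<lambda>x. G x a b) x v = G x (C x v a) b + G x a (C x v b)"
    and linear_P: "x \<in> S \<Longrightarrow> linear (P x)"
    and inj_P: "x \<in> S \<Longrightarrow> inj (P x)"
    and smooth_P: "smooth_on S (\<lambda>x. P x v)"
    and torsion: "x \<in> S \<Longrightarrow> fd (\<lambda>x. P x v) x u + C x u (P x v) = fd (\<lambda>x. P x u) x v + C x v (P x u)"
    and coisotropic: "x \<in> S \<Longrightarrow> (\<And>v. G x (J a) (P x v) = 0) \<Longrightarrow> a \<in> range (P x)"
    and dim: "DIM('f) = CARD('n) + k"
begin

lemma coisotropic_chart_subset:
  assumes "open T" "T \<subseteq> S"
  shows "coisotropic_chart T G C P k"
proof (rule coisotropic_chart.intro)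
  show "open T" "DIM('f) = CARD('n) + k" by (rule assms dim)+
  show "smooth_on T (\<lambda>x. G x a b)" "smooth_on T (\<lambda>x. C x v a)" "smooth_on T (\<lambda>x. P x v)" for a b v
    by (rule smooth_on_subset[OF _ assms(2)], rule smooth_G smooth_C smooth_P)+
  fix x assume "x \<in> T"
  then have x: "x \<in> S" using assms by auto
  show "hermitian (G x)" "bilinear (C x)" "linear (P x)" "inj (P x)"
    by (rule hermitian_G bilinear_C linear_P inj_P x)+
  show "C x v (J a) = J (C x v a)" "fd (\<lambda>x. G x a b) x v = G x (C x v a) b + G x a (C x v b)"
    "fd (\<lambda>x. P x v) x u + C x u (P x v) = fd (\<lambda>x. P x u) x v + C x v (P x u)" for a b u v
    by (rule C_J metric torsion x)+
  show "a \<in> range (P x)" if "\<And>v. G x (J a) (P x v) = 0" for a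
    by (rule coisotropic[OF x that])
qed

lemma inner_prod_G: "x \<in> S \<Longrightarrow> inner_prod (G x)"
  using hermitian_G by (simp add: hermitian_def)

lemmas g_simps = inner_prod.g_simps[OF inner_prod_G]

lemma bilinear_G: "x \<in> S \<Longrightarrow> bilinear (G x)"
  using inner_prod.bilin[OF inner_prod_G] .

definition nab :: "('f \<Rightarrow> complex ^ 'n) \<Rightarrow> 'f \<Rightarrow> 'f \<Rightarrow> complex ^ 'n" where
  "nab Z x v = fd Z x v + C x v (Z x)"

text \<open>Curvature of the pulled-back connection in the constant coordinate directions
  \<open>u\<close> and \<open>v\<close>; these commute, hence no bracket term.\<close>

definition curv :: "'f \<Rightarrow> 'f \<Rightarrow> 'f \<Rightarrow> complex ^ 'n \<Rightarrow> complex ^ 'n" where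
  "curv x u v z = fd (\<lambda>x. C x v z) x u - fd (\<lambda>x. C x u z) x v + C x u (C x v z) - C x v (C x u z)"

text \<open>\<open>G x (J a) b\<close> is the Kaehler form, so this is the symplectic complement of
  the tangent space, in coordinates.\<close>

definition tf :: "'f \<Rightarrow> (complex ^ 'n) set" where
  "tf x = {a. \<forall>v. G x (J a) (P x v) = 0}"

lemma C_simps:
  assumes "x \<in> S"
  shows "C x (u + u') a = C x u a + C x u' a" "C x u (a + b) = C x u a + C x u b"
    "C x (r *\<^sub>R u) a = r *\<^sub>R C x u a" "C x u (r *\<^sub>R a) = r *\<^sub>R C x u a"
  using bilinear_C[OF assms] by (auto simp: bilinear_ladd bilinear_radd bilinear_lmul bilinear_rmul)

lemma smooth_on_nab: "smooth_on S Z \<Longrightarrow> smooth_on S (\<lambda>x. nab Z x v)"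
  unfolding nab_def
  by (intro smooth_on_add smooth_on_fd open_S smooth_on_linear_family[where P = "\<lambda>x. C x v", OF open_S
      bilinear_linear_right[OF bilinear_C] smooth_C])

lemma linear_nab: "smooth_on S Z \<Longrightarrow> x \<in> S \<Longrightarrow> linear (nab Z x)"
  unfolding nab_def
  by (intro linear_compose_add smooth_on_linear_fd bilinear_linear_left[OF bilinear_C]) auto

lemma nab_cong:
  assumes "x \<in> S" "\<And>x. x \<in> S \<Longrightarrow> Z x = W x"
  shows "nab Z x v = nab W x v"
  using fd_cong_open[OF open_S assms(1), of Z W] assms by (simp add: nab_def)

lemma nab_scaleR:
  assumes "smooth_on S Z" "x \<in> S"
  shows "nab (\<lambda>x. c *\<^sub>R Z x) x v = c *\<^sub>R nab Z x v"
  unfolding nab_def fd_eq[OF has_derivative_scaleR_right[OF smooth_on_has_fd[OF assms]]]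
  by (simp add: C_simps[OF assms(2)] scaleR_add_right)

lemma nab_J:
  assumes "smooth_on S Z" "x \<in> S"
  shows "nab (\<lambda>x. J (Z x)) x v = J (nab Z x v)"
  using fd_eq[OF bounded_linear.has_derivative[OF linear_J[unfolded linear_conv_bounded_linear]
      smooth_on_has_fd[OF assms]]]
  by (simp add: nab_def C_J[OF assms(2)] J_add)

lemma fd_G:
  assumes "smooth_on S Z" "smooth_on S W" "x \<in> S"
  shows "((\<lambda>x. G x (Z x) (W x)) has_derivative (\<lambda>v. G x (nab Z x v) (W x) + G x (Z x) (nab W x v))) (at x)"
proof -
  have "((\<lambda>x. G x (Z x) (W x)) has_derivative
      (\<lambda>v. fd (\<lambda>x'. G x' (Z x) (W x)) x v + G x (fd Z x v) (W x) + G x (Z x) (fd W x v))) (at x)"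
    by (rule has_derivative_bilinear_family[OF open_S assms(3) bilinear_G
        smooth_on_differentiable[OF smooth_G assms(3)] smooth_on_has_fd[OF assms(1,3)]
        smooth_on_has_fd[OF assms(2,3)]])
  then show ?thesis
    unfolding metric[OF assms(3)] nab_def
    by (rule has_derivative_eq_rhs) (simp add: g_simps[OF assms(3)] algebra_simps)
qed

text \<open>The Hermitian form \<open>h\<close> of \<open>G x\<close>, written out so that the
  defining equation holds at every \<open>x\<close> and the form can be differentiated in
  \<open>x\<close>.\<close>

definition hh :: "'f \<Rightarrow> complex ^ 'n \<Rightarrow> complex ^ 'n \<Rightarrow> complex" where
  "hh x a b = of_real (G x a b) + \<i> * of_real (G x a (J b))"

lemma hh_h: "x \<in> S \<Longrightarrow> hh x a b = hermitian.h (G x) a b"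
  using hermitian.h_def[OF hermitian_G] by (simp add: hh_def complex_eq_iff)

lemma fd_hh:
  assumes "smooth_on S Z" "smooth_on S W" "x \<in> S"
  shows "((\<lambda>x. hh x (Z x) (W x)) has_derivative (\<lambda>v. hh x (nab Z x v) (W x) + hh x (Z x) (nab W x v))) (at x)"
proof -
  have JW: "smooth_on S (\<lambda>x. J (W x))" using assms open_S by (intro smooth_on_linear[OF _ linear_J])
  show ?thesis unfolding hh_def
    by (rule has_derivative_eq_rhs[OF has_derivative_add[OF
        has_derivative_of_real[OF fd_G[OF assms]]
        has_derivative_mult_right[OF has_derivative_of_real[OF fd_G[OF assms(1) JW assms(3)]]]]])
      (simp add: nab_J[OF assms(2,3)] algebra_simps)
qed

lemma smooth_on_hh:
  assumes "smooth_on S Z" "smooth_on S W"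
  shows "smooth_on S (\<lambda>x. hh x (Z x) (W x))"
  unfolding hh_def
  by (intro smooth_on_add smooth_on_bounded_linear[OF _ bounded_linear_of_real]
      smooth_on_bounded_linear[OF _ bounded_linear_mult_right]
      smooth_on_bilinear_family[where G = G, OF open_S bilinear_G smooth_G]
      smooth_on_linear[OF _ linear_J] open_S assms)

lemma fd_nab:
  assumes "smooth_on S Z" "x \<in> S"
  shows "fd (\<lambda>x. nab Z x w) x u =
    fd (\<lambda>x. fd Z x w) x u + fd (\<lambda>x'. C x' w (Z x)) x u + C x w (fd Z x u)"
proof -
  have "((\<lambda>x. nab Z x w) has_derivative
      (\<lambda>u. fd (\<lambda>x. fd Z x w) x u + (fd (\<lambda>x'. C x' w (Z x)) x u + C x w (fd Z x u)))) (at x)"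
    unfolding nab_def
    by (rule has_derivative_add[OF smooth_on_has_fd[OF smooth_on_fd[OF assms(1)] assms(2)]
        has_derivative_linear_family[OF open_S assms(2), where P = "\<lambda>x. C x w",
          OF bilinear_linear_right[OF bilinear_C] smooth_on_differentiable[OF smooth_C assms(2)]
          smooth_on_has_fd[OF assms]]])
  then show ?thesis by (simp add: fd_eq algebra_simps)
qed

text \<open>The second derivatives of \<open>Z\<close> cancel by symmetry, and the terms with one
  derivative of \<open>Z\<close> occur in both orders; only terms of order zero in \<open>Z\<close>
  survive.\<close>

lemma nab_nab:
  assumes "smooth_on S Z" "x \<in> S"
  shows "nab (\<lambda>x. nab Z x w) x u - nab (\<lambda>x. nab Z x u) x w = curv x u w (Z x)"
  using second_derivative_symmetric[OF open_S assms, of w u]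
  unfolding nab_def[of "\<lambda>x. nab Z x _"] fd_nab[OF assms] curv_def
  by (simp add: nab_def C_simps[OF assms(2)])

lemma has_derivative_P:
  assumes "smooth_on S W" "x \<in> S"
  shows "((\<lambda>x. P x (W x)) has_derivative (\<lambda>v. fd (\<lambda>x'. P x' (W x)) x v + P x (fd W x v))) (at x)"
  by (rule has_derivative_linear_family[OF open_S assms(2) linear_P
      smooth_on_differentiable[OF smooth_P assms(2)] smooth_on_has_fd[OF assms]])

lemma smooth_on_P: "smooth_on S W \<Longrightarrow> smooth_on S (\<lambda>x. P x (W x))"
  by (rule smooth_on_linear_family[where P = P, OF open_S linear_P smooth_P])

text \<open>\<open>fd W x (U x) - fd U x (W x)\<close> is the coordinate form of the bracket of
  \<open>U\<close> and \<open>W\<close>; the axiom \<open>torsion\<close> is the case of constant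
  fields.\<close>

lemma torsion_free:
  assumes "smooth_on S U" "smooth_on S W" "x \<in> S"
  shows "nab (\<lambda>x. P x (W x)) x (U x) - nab (\<lambda>x. P x (U x)) x (W x) = P x (fd W x (U x) - fd U x (W x))"
  using torsion[OF assms(3), of "W x" "U x"]
  by (simp add: nab_def fd_eq[OF has_derivative_P[OF assms(1,3)]] fd_eq[OF has_derivative_P[OF assms(2,3)]]
      linear_diff[OF linear_P[OF assms(3)]] algebra_simps)

lemma tf_tangent: "x \<in> S \<Longrightarrow> a \<in> tf x \<Longrightarrow> a \<in> range (P x)"
  using coisotropic by (auto simp: tf_def)

lemma tf_ortho: "a \<in> tf x \<Longrightarrow> G x (J a) (P x v) = 0"
  by (simp add: tf_def)

lemma subspace_tf: "x \<in> S \<Longrightarrow> subspace (tf x)"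
  by (auto simp: subspace_def tf_def J_0 J_add J_scaleR g_simps)

text \<open>With \<open>\<Omega> a b = G (J a) b\<close>, both terms of \<open>[U, W]\<close> pair with \<open>P v\<close> to \<open>\<Omega> (\<nabla>\<^sub>v W) U\<close>.\<close>

lemma tf_involutive:
  assumes "smooth_on S U" "smooth_on S W" "x \<in> S"
    and U: "\<And>x. x \<in> S \<Longrightarrow> P x (U x) \<in> tf x" and W: "\<And>x. x \<in> S \<Longrightarrow> P x (W x) \<in> tf x"
  shows "P x (fd W x (U x) - fd U x (W x)) \<in> tf x"
  unfolding tf_def
proof (intro CollectI allI)
  fix v
  interpret hermitian "G x" using hermitian_G assms(3) .
  have key: "G x (J (nab (\<lambda>x. P x (W x)) x (U x))) (P x v) = - G x (J (P x (W x))) (nab (\<lambda>x. P x (U x)) x v)"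
    if UW: "smooth_on S U" "smooth_on S W" and W: "\<And>x. x \<in> S \<Longrightarrow> P x (W x) \<in> tf x" for U W
  proof -
    note PW = smooth_on_P[OF UW(2)]
    have sJ: "smooth_on S (\<lambda>x. J (P x (W x)))" by (intro smooth_on_linear[OF open_S linear_J] PW)
    have "fd (\<lambda>x. G x (J (P x (W x))) (P x v)) x (U x) = fd (\<lambda>x. 0) x (U x)"
      by (rule arg_cong[where f = "\<lambda>f. f _"], rule fd_cong_open[OF open_S assms(3)]) (rule tf_ortho[OF W])
    then have "G x (J (nab (\<lambda>x. P x (W x)) x (U x))) (P x v)
        + G x (J (P x (W x))) (nab (\<lambda>x. P x v) x (U x)) = 0"
      by (simp add: fd_eq[OF fd_G[OF sJ smooth_P assms(3)]] nab_J[OF PW assms(3)])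
    moreover have "nab (\<lambda>x. P x v) x (U x) = nab (\<lambda>x. P x (U x)) x v + P x (fd (\<lambda>x. v) x (U x) - fd U x v)"
      using torsion_free[OF UW(1) smooth_on_const assms(3), of v] by (simp add: algebra_simps)
    ultimately show ?thesis
      using tf_ortho[OF W[OF assms(3)]] by (simp add: g_simps)
  qed
  \<comment> \<open>The Kaehler form vanishes identically on the pair of leaf fields. Its derivative
    along \<open>v\<close> trades the derivative of \<open>U\<close> for that of \<open>W\<close>,
    after which the two instances of \<open>key\<close> cancel.\<close>
  have "smooth_on S (\<lambda>x. J (P x (W x)))"
    by (intro smooth_on_linear[OF open_S linear_J] smooth_on_P assms)
  then have "fd (\<lambda>x. G x (J (P x (W x))) (P x (U x))) x v
      = G x (J (nab (\<lambda>x. P x (W x)) x v)) (P x (U x)) + G x (J (P x (W x))) (nab (\<lambda>x. P x (U x)) x v)"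
    by (simp add: fd_eq[OF fd_G[OF _ smooth_on_P assms(3)]] nab_J[OF smooth_on_P assms(3)] assms)
  moreover have "fd (\<lambda>x. G x (J (P x (W x))) (P x (U x))) x = fd (\<lambda>x. 0) x"
    by (rule fd_cong_open[OF open_S assms(3)]) (rule tf_ortho[OF W])
  ultimately have "G x (J (nab (\<lambda>x. P x (W x)) x v)) (P x (U x)) =
      - G x (J (P x (W x))) (nab (\<lambda>x. P x (U x)) x v)" by simp
  moreover have "G x (J (nab (\<lambda>x. P x (W x)) x v)) (P x (U x)) =
      - G x (J (P x (U x))) (nab (\<lambda>x. P x (W x)) x v)"
    using g_J_left sym by metis
  ultimately show "G x (J (P x (fd W x (U x) - fd U x (W x)))) (P x v) = 0"
    using key[OF assms(1,2) W] key[OF assms(2,1) U]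
    unfolding torsion_free[OF assms(1,2,3), symmetric] by (simp add: J_diff g_simps)
qed

end

section \<open>Adapted frames\<close>

text \<open>Only the \<open>e\<^sub>i\<close> are recorded, as
  \<open>f\<^sub>i = J e\<^sub>i\<close>. The fields \<open>l\<close> are the leaf vectors seen in
  the chart of the submanifold, so that derivatives can be taken along them;
  \<open>normal_J_e\<close> says that the normal space is contained in the span of the
  \<open>J e\<^sub>\<beta>\<close>.\<close>

locale adapted_frame = coisotropic_chart S G C P k
  for S :: "'f::euclidean_space set"
    and G :: "'f \<Rightarrow> complex ^ 'n::finite \<Rightarrow> complex ^ 'n \<Rightarrow> real"
    and C :: "'f \<Rightarrow> 'f \<Rightarrow> complex ^ 'n \<Rightarrow> complex ^ 'n"
    and P :: "'f \<Rightarrow> 'f \<Rightarrow> complex ^ 'n"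
    and k :: nat +
  fixes e :: "nat \<Rightarrow> 'f \<Rightarrow> complex ^ 'n" and l :: "nat \<Rightarrow> 'f \<Rightarrow> 'f"
  assumes k_le: "k \<le> CARD('n)"
    and smooth_e: "i \<in> {1..CARD('n)} \<Longrightarrow> smooth_on S (e i)"
    and smooth_l: "\<beta> \<in> {k+1..CARD('n)} \<Longrightarrow> smooth_on S (l \<beta>)"
    and P_l: "\<beta> \<in> {k+1..CARD('n)} \<Longrightarrow> x \<in> S \<Longrightarrow> P x (l \<beta> x) = e \<beta> x"
    and unitary_e: "x \<in> S \<Longrightarrow> hermitian.unitary (G x) {1..CARD('n)} (\<lambda>i. e i x)"
    and normal_J_e: "x \<in> S \<Longrightarrow> (\<And>\<beta>. \<beta> \<in> {k+1..CARD('n)} \<Longrightarrow> G x a (J (e \<beta> x)) = 0) \<Longrightarrow> a \<in> range (P x)"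
    and tf_span: "x \<in> S \<Longrightarrow> tf x = span ((\<lambda>\<beta>. e \<beta> x) ` {k+1..CARD('n)})"

context coisotropic_chart
begin

text \<open>The injective linear map \<open>P x\<close> bounds the dimension n + k of the
  submanifold by the ambient dimension 2n.\<close>

lemma k_le_card:
  assumes "x \<in> S"
  shows "k \<le> CARD('n)"
proof -
  have "DIM('f) \<le> DIM(complex ^ 'n)"
    using dim_image_eq[OF linear_P[OF assms], of UNIV] inj_P[OF assms]
      dim_subset_UNIV[of "range (P x)"] by (simp add: dim_UNIV)
  then show ?thesis by (simp add: dim)
qed

text \<open>Gram--Schmidt gives an orthonormal tangent frame \<open>P s\<^sub>b\<close>, completed by a normal frame \<open>\<nu>\<^sub>\<beta>\<close>.
  Then \<open>T\<F> = J(N Y)\<close> is framed by \<open>e\<^sub>\<beta> = J \<nu>\<^sub>\<beta>\<close>, which is tangent since \<open>Y\<close> is coisotropic.\<close>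

lemma adapted_frame_exists:
  assumes x0: "x0 \<in> S"
  shows "\<exists>T e l. x0 \<in> T \<and> T \<subseteq> S \<and> adapted_frame T G C P k e l"
proof -
  note k = k_le_card[OF x0]
  let ?B = "Basis :: 'f set" and ?A = "{k+1..CARD('n)}"
  \<comment> \<open>The induced metric on the submanifold, positive definite because
    \<open>P x\<close> is injective.\<close>
  define g where "g x u v = G x (P x u) (P x v)" for x u v
  have g: "inner_prod (g x)" if x: "x \<in> S" for x
  proof -
    interpret inner_prod "G x" by (rule inner_prod_G[OF x])
    show ?thesis
    proof
      show "bilinear (g x)"
        unfolding g_def bilinear_def
        using linear_compose[OF linear_P[OF x] bilinear_linear_left[OF bilin]]
          linear_compose[OF linear_P[OF x] bilinear_linear_right[OF bilin]]
        by (auto simp: comp_def)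
      show "g x u v = g x v u" for u v by (simp add: g_def sym)
      show "0 < g x v v" if "v \<noteq> 0" for v
        using that pos[of "P x v"] linear_injective_0[OF linear_P[OF x]] inj_P[OF x] by (auto simp: g_def)
    qed
  qed
  have gs: "smooth_on S (\<lambda>x. g x u v)" for u v
    unfolding g_def
    by (rule smooth_on_bilinear_family[where G = G, OF open_S bilinear_G smooth_G smooth_P smooth_P])
  have "\<exists>T s. open T \<and> x0 \<in> T \<and> T \<subseteq> S \<and> (\<forall>b\<in>{} \<union> ?B. smooth_on T (s b)) \<and> (\<forall>b\<in>{}. s b = undefined) \<and>
      (\<forall>x\<in>T. inner_prod.orthonormal (g x) ({} \<union> ?B) (\<lambda>b. s b x))"
    by (rule orthonormal_frame_extend[OF _ _ _ _ open_S x0 g gs])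
      (auto simp: inner_prod.orthonormal_def[OF g])
  then obtain T1 s where T1: "open T1" "x0 \<in> T1" "T1 \<subseteq> S" and s': "\<forall>b\<in>{} \<union> ?B. smooth_on T1 (s b)"
    and "\<forall>b\<in>{}. s b = undefined"
    and so': "\<forall>x\<in>T1. inner_prod.orthonormal (g x) ({} \<union> ?B) (\<lambda>b. s b x)"
    by (elim exE conjE) (rule that)
  have s: "smooth_on T1 (s b)" if "b \<in> ?B" for b using s' that by simp
  have so: "inner_prod.orthonormal (g x) ?B (\<lambda>b. s b x)" if "x \<in> T1" for x using so' that by simp
  interpret T1: coisotropic_chart T1 G C P k by (rule coisotropic_chart_subset[OF T1(1,3)])
  \<comment> \<open>Tangent vectors are indexed by \<open>Inl b\<close>, normal ones by
    \<open>Inr \<beta>\<close>. The zero on the \<open>Inr\<close> side is a placeholder that the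
    extension replaces.\<close>
  define t :: "'f + nat \<Rightarrow> 'f \<Rightarrow> complex ^ 'n" where "t = case_sum (\<lambda>b x. P x (s b x)) (\<lambda>_ _. 0)"
  have ts: "smooth_on T1 (t i)" if "i \<in> Inl ` ?B" for i
    using that T1.smooth_on_P[OF s] by (auto simp: t_def)
  have "\<exists>T t'. open T \<and> x0 \<in> T \<and> T \<subseteq> T1 \<and> (\<forall>i\<in>Inl ` ?B \<union> Inr ` ?A. smooth_on T (t' i)) \<and>
      (\<forall>i\<in>Inl ` ?B. t' i = t i) \<and>
      (\<forall>x\<in>T. inner_prod.orthonormal (G x) (Inl ` ?B \<union> Inr ` ?A) (\<lambda>i. t' i x))"
  proof (rule orthonormal_frame_extend[OF _ _ _ _ T1(1,2) T1.inner_prod_G T1.smooth_G ts])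
    have "card (Inl ` ?B \<union> Inr ` ?A) = card (?B <+> ?A)" by (simp add: Plus_def)
    then show "card (Inl ` ?B \<union> Inr ` ?A) \<le> DIM(complex ^ 'n)"
      using k dim by (simp add: card_Plus)
    show "inner_prod.orthonormal (G x) (Inl ` ?B) (\<lambda>i. t i x)" if x: "x \<in> T1" for x
      using so[OF x] x T1(3)
      by (auto simp: inner_prod.orthonormal_def[OF T1.inner_prod_G] inner_prod.orthonormal_def[OF g] t_def g_def)
  qed auto
  then obtain T2 t' where T2: "open T2" "x0 \<in> T2" "T2 \<subseteq> T1"
    and t's': "\<forall>i\<in>Inl ` ?B \<union> Inr ` ?A. smooth_on T2 (t' i)"
    and t't': "\<forall>i\<in>Inl ` ?B. t' i = t i"
    and t'o': "\<forall>x\<in>T2. inner_prod.orthonormal (G x) (Inl ` ?B \<union> Inr ` ?A) (\<lambda>i. t' i x)"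
    by (elim exE conjE) (rule that)
  have t's: "smooth_on T2 (t' i)" if "i \<in> Inl ` ?B \<union> Inr ` ?A" for i using t's' that by blast
  have t't: "t' (Inl b) = t (Inl b)" if "b \<in> ?B" for b using t't' that by blast
  have t'o: "inner_prod.orthonormal (G x) (Inl ` ?B \<union> Inr ` ?A) (\<lambda>i. t' i x)" if "x \<in> T2" for x
    using t'o' that by blast
  interpret T2: coisotropic_chart T2 G C P k by (rule T1.coisotropic_chart_subset[OF T2(1,3)])
  define \<nu> where "\<nu> \<beta> = t' (Inr \<beta>)" for \<beta>
  have st: "P x (s b x) = t' (Inl b) x" if "b \<in> ?B" for b x
    using t't[OF that] by (simp add: t_def)
  have P_exp: "P x v = (\<Sum>b\<in>?B. G x (P x v) (P x (s b x)) *\<^sub>R P x (s b x))" if x: "x \<in> T2" for x v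
  proof -
    have "v = (\<Sum>b\<in>?B. g x v (s b x) *\<^sub>R s b x)"
      using x T2 T1 by (intro inner_prod.orthonormal_basis_expansion[OF g so]) auto
    then have "P x v = P x (\<Sum>b\<in>?B. g x v (s b x) *\<^sub>R s b x)" by simp
    then show ?thesis
      by (simp add: linear_sum[OF T2.linear_P[OF x]] linear_cmul[OF T2.linear_P[OF x]] g_def)
  qed
  have \<nu>_s: "G x (\<nu> \<beta> x) (P x (s b x)) = 0" if "x \<in> T2" "b \<in> ?B" "\<beta> \<in> ?A" for x b \<beta>
    using t'o[OF that(1)] that(2,3) unfolding st[OF that(2)] \<nu>_def
    by (auto simp: inner_prod.orthonormal_def[OF T2.inner_prod_G[OF that(1)]])
  have \<nu>_P: "G x (\<nu> \<beta> x) (P x v) = 0" if x: "x \<in> T2" "\<beta> \<in> ?A" for x \<beta> v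
  proof -
    interpret inner_prod "G x" by (rule T2.inner_prod_G[OF x(1)])
    show ?thesis
      by (subst P_exp[OF x(1)]) (simp add: g_sum_right g_simps \<nu>_s[OF x(1) _ x(2)])
  qed
  have \<nu>o: "G x (\<nu> \<beta> x) (\<nu> \<gamma> x) = (if \<beta> = \<gamma> then 1 else 0)" if "x \<in> T2" "\<beta> \<in> ?A" "\<gamma> \<in> ?A" for x \<beta> \<gamma>
    using t'o[OF that(1)] that(2,3) unfolding \<nu>_def
    by (auto simp: inner_prod.orthonormal_def[OF T2.inner_prod_G[OF that(1)]])
  have expand: "a = (\<Sum>b\<in>?B. G x a (t' (Inl b) x) *\<^sub>R t' (Inl b) x) + (\<Sum>\<beta>\<in>?A. G x a (\<nu> \<beta> x) *\<^sub>R \<nu> \<beta> x)"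
    if x: "x \<in> T2" for a x
  proof -
    interpret inner_prod "G x" by (rule T2.inner_prod_G[OF x])
    have "a = (\<Sum>i\<in>Inl ` ?B \<union> Inr ` ?A. G x a (t' i x) *\<^sub>R t' i x)"
    proof (rule orthonormal_basis_expansion[OF t'o[OF x]])
      have "card (Inl ` ?B \<union> Inr ` ?A) = card (?B <+> ?A)" by (simp add: Plus_def)
      then show "card (Inl ` ?B \<union> Inr ` ?A) = DIM(complex ^ 'n)"
        using k dim by (simp add: card_Plus)
    qed auto
    also have "\<dots> = (\<Sum>b\<in>?B. G x a (t' (Inl b) x) *\<^sub>R t' (Inl b) x)
        + (\<Sum>\<beta>\<in>?A. G x a (\<nu> \<beta> x) *\<^sub>R \<nu> \<beta> x)"
      by (subst sum.union_disjoint) (auto simp: sum.reindex \<nu>_def)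
    finally show ?thesis .
  qed
  have tangent: "a \<in> range (P x)" if x: "x \<in> T2" and a: "\<And>\<beta>. \<beta> \<in> ?A \<Longrightarrow> G x a (\<nu> \<beta> x) = 0" for a x
  proof -
    have "(\<Sum>\<beta>\<in>?A. G x a (\<nu> \<beta> x) *\<^sub>R \<nu> \<beta> x) = 0" using a by (intro sum.neutral) auto
    then have "a = (\<Sum>b\<in>?B. G x a (t' (Inl b) x) *\<^sub>R P x (s b x))"
      using expand[OF x, of a] by (simp add: st)
    also have "\<dots> = P x (\<Sum>b\<in>?B. G x a (t' (Inl b) x) *\<^sub>R s b x)"
      by (simp add: linear_sum[OF T2.linear_P[OF x]] linear_cmul[OF T2.linear_P[OF x]])
    finally show ?thesis by blast
  qed
  define e0 where "e0 \<beta> x = J (\<nu> \<beta> x)" for \<beta> x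
  have e0s: "smooth_on T2 (e0 \<beta>)" if "\<beta> \<in> ?A" for \<beta>
    unfolding e0_def \<nu>_def by (intro smooth_on_linear[OF T2(1) linear_J] t's) (use that in auto)
  have e0_tf: "e0 \<beta> x \<in> T2.tf x" if "x \<in> T2" "\<beta> \<in> ?A" for x \<beta>
    using \<nu>_P[OF that] inner_prod.g_simps[OF T2.inner_prod_G[OF that(1)]]
    by (simp add: T2.tf_def e0_def J_J)
  have tf: "T2.tf x = span ((\<lambda>\<beta>. e0 \<beta> x) ` ?A)" if x: "x \<in> T2" for x
  proof
    show "span ((\<lambda>\<beta>. e0 \<beta> x) ` ?A) \<subseteq> T2.tf x"
      by (rule span_minimal) (use e0_tf x T2.subspace_tf in auto)
    show "T2.tf x \<subseteq> span ((\<lambda>\<beta>. e0 \<beta> x) ` ?A)"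
    proof
      fix a assume a: "a \<in> T2.tf x"
      interpret hermitian "G x" by (rule T2.hermitian_G[OF x])
      \<comment> \<open>\<open>J a\<close> is orthogonal to the tangent part of the frame, hence
        purely normal; a second application of \<open>J\<close> returns to \<open>a\<close> up to
        sign.\<close>
      have "J a = (\<Sum>b\<in>?B. G x (J a) (t' (Inl b) x) *\<^sub>R t' (Inl b) x)
          + (\<Sum>\<beta>\<in>?A. G x (J a) (\<nu> \<beta> x) *\<^sub>R \<nu> \<beta> x)" by (rule expand[OF x])
      also have "(\<Sum>b\<in>?B. G x (J a) (t' (Inl b) x) *\<^sub>R t' (Inl b) x) = 0"
        by (rule sum.neutral) (use T2.tf_ortho[OF a] st in \<open>metis scaleR_zero_left\<close>)
      finally have "J a = (\<Sum>\<beta>\<in>?A. G x (J a) (\<nu> \<beta> x) *\<^sub>R \<nu> \<beta> x)" by simp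
      then have "J (J a) = J (\<Sum>\<beta>\<in>?A. G x (J a) (\<nu> \<beta> x) *\<^sub>R \<nu> \<beta> x)" by (rule arg_cong)
      then have "J (J a) = (\<Sum>\<beta>\<in>?A. G x (J a) (\<nu> \<beta> x) *\<^sub>R e0 \<beta> x)"
        by (simp only: J_sum J_scaleR e0_def)
      then have "a = - (\<Sum>\<beta>\<in>?A. G x (J a) (\<nu> \<beta> x) *\<^sub>R e0 \<beta> x)"
        unfolding J_J by (metis minus_minus)
      also have "\<dots> \<in> span ((\<lambda>\<beta>. e0 \<beta> x) ` ?A)"
        by (intro span_neg span_sum span_scale span_base) auto
      finally show "a \<in> span ((\<lambda>\<beta>. e0 \<beta> x) ` ?A)" .
    qed
  qed
  define l where "l \<beta> x = (\<Sum>b\<in>?B. G x (e0 \<beta> x) (P x (s b x)) *\<^sub>R s b x)" for \<beta> x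
  have ls: "smooth_on T2 (l \<beta>)" if "\<beta> \<in> ?A" for \<beta>
  proof -
    have s2: "smooth_on T2 (s b)" if "b \<in> ?B" for b using s[OF that] T2(3) by (rule smooth_on_subset)
    show ?thesis
      unfolding l_def
      by (intro smooth_on_sum smooth_on_scaleR s2 T2(1)
          smooth_on_bilinear_family[where G = G, OF T2(1) T2.bilinear_G T2.smooth_G]
          e0s[OF that] T2.smooth_on_P)
  qed
  have Pl: "P x (l \<beta> x) = e0 \<beta> x" if xb: "x \<in> T2" "\<beta> \<in> ?A" for x \<beta>
  proof -
    \<comment> \<open>Coisotropy enters here: the leaf vector \<open>e0 \<beta> x\<close> is
      tangent, so it has a preimage under \<open>P x\<close>, and \<open>l\<close> produces it from
      its coefficients in the smooth frame \<open>s\<close>.\<close>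
    obtain w where "e0 \<beta> x = P x w" using T2.tf_tangent[OF xb(1) e0_tf[OF xb]] by auto
    then show ?thesis
      using P_exp[OF xb(1), of w]
      by (simp add: l_def linear_sum[OF T2.linear_P[OF xb(1)]] linear_cmul[OF T2.linear_P[OF xb(1)]])
  qed
  have e0u: "hermitian.unitary (G x) ?A (\<lambda>\<beta>. e0 \<beta> x)" if x: "x \<in> T2" for x
  proof -
    interpret hermitian "G x" by (rule T2.hermitian_G[OF x])
    \<comment> \<open>\<open>J (e0 \<gamma> x)\<close> is minus a normal vector, whereas
      \<open>e0 \<beta> x\<close> is tangent.\<close>
    have "G x (e0 \<beta> x) (J (e0 \<gamma> x)) = 0" if "\<beta> \<in> ?A" "\<gamma> \<in> ?A" for \<beta> \<gamma>
      using \<nu>_P[OF x that(2), of "l \<beta> x"] Pl[OF x that(1)] sym[of "\<nu> \<gamma> x"]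
      by (simp add: e0_def[of \<gamma>] J_J g_simps)
    then show ?thesis using \<nu>o[OF x] by (simp add: unitary_iff e0_def g_J)
  qed
  \<comment> \<open>The k transverse vectors complete the leaf frame to a unitary basis with indices
    1 to n; the leaf members stay fixed.\<close>
  have "\<exists>T e'. open T \<and> x0 \<in> T \<and> T \<subseteq> T2 \<and> (\<forall>i\<in>?A \<union> {1..k}. smooth_on T (e' i)) \<and> (\<forall>i\<in>?A. e' i = e0 i) \<and>
    (\<forall>x\<in>T. hermitian.unitary (G x) (?A \<union> {1..k}) (\<lambda>i. e' i x))"
  proof (rule unitary_frame_extend[OF _ _ _ _ T2(1,2) T2.hermitian_G T2.smooth_G e0s e0u])
    show "card (?A \<union> {1..k}) \<le> CARD('n)" using k by (subst card_Un_disjoint) auto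
  qed auto
  then obtain T e where T: "open T" "x0 \<in> T" "T \<subseteq> T2" and es': "\<forall>i\<in>?A \<union> {1..k}. smooth_on T (e i)"
    and ee: "\<forall>i\<in>?A. e i = e0 i"
    and eu': "\<forall>x\<in>T. hermitian.unitary (G x) (?A \<union> {1..k}) (\<lambda>i. e i x)"
    by (elim exE conjE) (rule that)
  have A: "?A \<union> {1..k} = {1..CARD('n)}" using k by auto
  have es: "smooth_on T (e i)" if "i \<in> {1..CARD('n)}" for i using es' that unfolding A by blast
  have eu: "hermitian.unitary (G x) {1..CARD('n)} (\<lambda>i. e i x)" if "x \<in> T" for x
    using eu' that unfolding A by blast
  interpret T: coisotropic_chart T G C P k by (rule T2.coisotropic_chart_subset[OF T(1,3)])
  have "adapted_frame T G C P k e l"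
  proof
    show "smooth_on T (l \<beta>)" if "\<beta> \<in> ?A" for \<beta> using ls[OF that] T(3) by (rule smooth_on_subset)
    show "P x (l \<beta> x) = e \<beta> x" if "\<beta> \<in> ?A" "x \<in> T" for \<beta> x
      using Pl[of x \<beta>] that ee T(3) by auto
    show "a \<in> range (P x)" if x: "x \<in> T" and a: "\<And>\<beta>. \<beta> \<in> ?A \<Longrightarrow> G x a (J (e \<beta> x)) = 0" for a x
    proof (rule tangent)
      show "x \<in> T2" using x T(3) by auto
      show "G x a (\<nu> \<beta> x) = 0" if "\<beta> \<in> ?A" for \<beta>
        using a[OF that] ee that by (simp add: e0_def J_J T.g_simps[OF x])
    qed
    show "T.tf x = span ((\<lambda>\<beta>. e \<beta> x) ` ?A)" if "x \<in> T" for x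
      using tf[of x] that T(3) ee by (auto simp: T.tf_def T2.tf_def)
  qed (use k es eu in auto)
  then show ?thesis using T T2 T1 by blast
qed

end

section \<open>Connection matrix of an adapted frame\<close>

context adapted_frame
begin

text \<open>\<open>om i j\<close> is \<open>\<omega>\<^sup>i\<^sub>j\<close>. It is computed from
  the \<open>e\<^sub>j\<close> with the Hermitian form; since \<open>J\<close> is parallel, the
  \<open>u\<^sub>j\<close> have the same matrix.\<close>

definition om :: "nat \<Rightarrow> nat \<Rightarrow> 'f \<Rightarrow> 'f \<Rightarrow> complex" where
  "om i j x v = hh x (nab (e j) x v) (e i x)"

definition tau :: "'f \<Rightarrow> 'f \<Rightarrow> complex" where
  "tau x v = (\<Sum>j=1..CARD('n). om j j x v)"

definition tauE :: "'f \<Rightarrow> 'f \<Rightarrow> complex" where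
  "tauE x v = (\<Sum>\<alpha>=k+1..CARD('n). om \<alpha> \<alpha> x v)"

definition tauN :: "'f \<Rightarrow> 'f \<Rightarrow> complex" where
  "tauN x v = (\<Sum>a=1..k. om a a x v)"

lemma tau_split: "tau x v = tauN x v + tauE x v"
proof -
  have "{1..CARD('n)} = {1..k} \<union> {k+1..CARD('n)}" using k_le by auto
  then show ?thesis unfolding tau_def tauN_def tauE_def by (simp add: sum.union_disjoint)
qed

lemma hh_e:
  assumes "x \<in> S" "i \<in> {1..CARD('n)}" "j \<in> {1..CARD('n)}"
  shows "hh x (e i x) (e j x) = (if i = j then 1 else 0)"
  using unitary_e[OF assms(1)] assms
  by (simp add: hh_h hermitian.unitary_def[OF hermitian_G])

lemma e_tf: "x \<in> S \<Longrightarrow> \<beta> \<in> {k+1..CARD('n)} \<Longrightarrow> e \<beta> x \<in> tf x"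
  unfolding tf_span by (intro span_base imageI)

lemma expansion: "x \<in> S \<Longrightarrow> z = (\<Sum>i=1..CARD('n). hh x z (e i x) *s e i x)"
  using hermitian.unitary_expansion[OF hermitian_G unitary_e, of x z] by (simp add: hh_h)

lemma nab_frame:
  "x \<in> S \<Longrightarrow> nab (e j) x v = (\<Sum>i=1..CARD('n). om i j x v *s e i x)"
  using expansion[of x "nab (e j) x v"] by (simp add: om_def)

lemma smooth_on_om:
  assumes "i \<in> {1..CARD('n)}" "j \<in> {1..CARD('n)}"
  shows "smooth_on S (\<lambda>x. om i j x v)"
  unfolding om_def by (intro smooth_on_hh smooth_on_nab smooth_e assms)

lemma linear_om:
  assumes "j \<in> {1..CARD('n)}" "x \<in> S"
  shows "linear (om i j x)"
proof -
  have "linear (\<lambda>z. hh x z (e i x))"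
    using hermitian.linear_h_left[OF hermitian_G[OF assms(2)]] by (simp add: hh_h[OF assms(2)])
  from linear_compose[OF linear_nab[OF smooth_e[OF assms(1)] assms(2)] this]
  show ?thesis by (simp add: comp_def om_def[abs_def])
qed

lemma om_skew:
  assumes "x \<in> S" "i \<in> {1..CARD('n)}" "j \<in> {1..CARD('n)}"
  shows "cnj (om i j x v) = - om j i x v"
proof -
  have "fd (\<lambda>x. hh x (e i x) (e j x)) x = fd (\<lambda>x. if i = j then 1 else 0) x"
    by (rule fd_cong_open[OF open_S assms(1)]) (rule hh_e[OF _ assms(2,3)])
  then have "hh x (nab (e i) x v) (e j x) + hh x (e i x) (nab (e j) x v) = 0"
    unfolding fd_eq[OF fd_hh[OF smooth_e[OF assms(2)] smooth_e[OF assms(3)] assms(1)]]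
    by (simp add: fun_eq_iff)
  moreover have "hh x (e i x) (nab (e j) x v) = cnj (om i j x v)"
    by (simp add: om_def hh_h[OF assms(1)] hermitian.h_cnj[OF hermitian_G[OF assms(1)]])
  ultimately show ?thesis by (simp add: om_def eq_neg_iff_add_eq_0 add.commute)
qed

text \<open>By \<open>om_skew\<close> the products of first derivatives add up to minus the trace of
  a product of the connection matrices along \<open>w\<close> and \<open>u\<close>. That trace is
  symmetric in the two directions, so only curvature survives the antisymmetrisation.\<close>

lemma om_trace_derivative:
  assumes "x \<in> S"
  shows "fd (\<lambda>x. tau x w) x u - fd (\<lambda>x. tau x u) x w =
    (\<Sum>j=1..CARD('n). hh x (curv x u w (e j x)) (e j x))"
proof -
  interpret hermitian "G x" by (rule hermitian_G[OF assms])
  let ?I = "{1..CARD('n)}"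
  have d: "fd (\<lambda>x. tau x w) x u =
      (\<Sum>j\<in>?I. hh x (nab (\<lambda>x. nab (e j) x w) x u) (e j x)) + (\<Sum>j\<in>?I. hh x (nab (e j) x w) (nab (e j) x u))"
    for u w
  proof -
    have "((\<lambda>x. \<Sum>j\<in>?I. hh x (nab (e j) x w) (e j x)) has_derivative (\<lambda>u. \<Sum>j\<in>?I.
        hh x (nab (\<lambda>x. nab (e j) x w) x u) (e j x) + hh x (nab (e j) x w) (nab (e j) x u))) (at x)"
      by (intro has_derivative_sum fd_hh smooth_on_nab smooth_e assms)
    then show ?thesis by (simp add: tau_def om_def fd_eq sum.distrib)
  qed
  have q: "(\<Sum>j\<in>?I. hh x (nab (e j) x w) (nab (e j) x u)) = - (\<Sum>j\<in>?I. \<Sum>i\<in>?I. om i j x w * om j i x u)" for u w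
  proof -
    have "hh x (nab (e j) x w) (nab (e j) x u) = (\<Sum>i\<in>?I. - (om i j x w * om j i x u))" if "j \<in> ?I" for j
    proof -
      have "hh x (nab (e j) x w) (nab (e j) x u) = (\<Sum>i\<in>?I. om i j x w * hh x (e i x) (nab (e j) x u))"
        by (subst nab_frame[OF assms, of j w]) (simp add: hh_h[OF assms] h_sum_left h_scale_left)
      also have "\<dots> = (\<Sum>i\<in>?I. om i j x w * cnj (om i j x u))"
        by (simp add: om_def hh_h[OF assms] h_cnj)
      finally show ?thesis using om_skew[OF assms _ that] by simp
    qed
    then show ?thesis by (simp add: sum_negf)
  qed
  have "(\<Sum>j\<in>?I. \<Sum>i\<in>?I. om i j x w * om j i x u) = (\<Sum>j\<in>?I. \<Sum>i\<in>?I. om i j x u * om j i x w)"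
    by (subst sum.swap) (simp add: mult.commute)
  moreover have "hh x (nab (\<lambda>x. nab (e j) x w) x u) (e j x) - hh x (nab (\<lambda>x. nab (e j) x u) x w) (e j x) =
      hh x (curv x u w (e j x)) (e j x)" if "j \<in> ?I" for j
    using nab_nab[OF smooth_e[OF that] assms] by (simp add: hh_h[OF assms] h_diff_left[symmetric])
  ultimately show ?thesis
    unfolding d q by (simp add: sum_subtractf[symmetric])
qed

text \<open>The right-hand side of \<open>is_ext_deriv\<close> in coordinates. It takes fields
  instead of vectors so that it applies to forms that are controlled along the leaves only.\<close>

definition extd :: "('f \<Rightarrow> 'f \<Rightarrow> 'c::real_normed_vector) \<Rightarrow> ('f \<Rightarrow> 'f) \<Rightarrow> ('f \<Rightarrow> 'f) \<Rightarrow> 'f \<Rightarrow> 'c" where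
  "extd \<eta> U W x = fd (\<lambda>x. \<eta> x (W x)) x (U x) - fd (\<lambda>x. \<eta> x (U x)) x (W x)
     - \<eta> x (fd W x (U x) - fd U x (W x))"

lemma smooth_on_tauE: "smooth_on S W \<Longrightarrow> smooth_on S (\<lambda>x. tauE x (W x))"
  and smooth_on_tauN: "smooth_on S W \<Longrightarrow> smooth_on S (\<lambda>x. tauN x (W x))"
  unfolding tauE_def tauN_def using k_le
  by (auto intro!: smooth_on_sum open_S smooth_on_linear_family[OF open_S linear_om smooth_on_om])

lemma linear_tau: "x \<in> S \<Longrightarrow> linear (tau x)"
  unfolding tau_def by (intro linear_compose_sum ballI linear_om) auto

lemma smooth_on_tau_const: "smooth_on S (\<lambda>x. tau x v)"
  unfolding tau_def by (intro smooth_on_sum open_S smooth_on_om)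

text \<open>The derivatives of \<open>U\<close> and \<open>W\<close> cancel against the bracket
  term, which reduces the claim to constant fields, that is, to
  \<open>om_trace_derivative\<close>.\<close>

lemma extd_tau:
  assumes "smooth_on S U" "smooth_on S W" "x \<in> S"
  shows "extd tau U W x = (\<Sum>j=1..CARD('n). hh x (curv x (U x) (W x) (e j x)) (e j x))"
proof -
  have "fd (\<lambda>x. tau x (W x)) x v = fd (\<lambda>x'. tau x' (W x)) x v + tau x (fd W x v)" if "smooth_on S W" for W v
    using fd_eq[OF has_derivative_linear_family[OF open_S assms(3) linear_tau
      smooth_on_differentiable[OF smooth_on_tau_const assms(3)] smooth_on_has_fd[OF that assms(3)]]] by simp
  then show ?thesis
    unfolding extd_def om_trace_derivative[OF assms(3), symmetric]
    by (simp add: assms linear_diff[OF linear_tau[OF assms(3)]])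
qed

text \<open>The form \<open>tauN\<close> enters with a minus sign because \<open>K\<^sub>Y\<close>
  is built from covectors and has connection form \<open>- tauN\<close>.\<close>

lemma extd_split:
  assumes "smooth_on S U" "smooth_on S W" "x \<in> S"
  shows "extd tau U W x = extd tauE U W x - extd (\<lambda>x v. - tauN x v) U W x"
proof -
  have "fd (\<lambda>x. tau x (W x)) x v = fd (\<lambda>x. tauE x (W x)) x v - fd (\<lambda>x. - tauN x (W x)) x v"
    if "smooth_on S W" for W v
  proof -
    have "((\<lambda>x. tauN x (W x) + tauE x (W x)) has_derivative
        (\<lambda>v. fd (\<lambda>x. tauN x (W x)) x v + fd (\<lambda>x. tauE x (W x)) x v)) (at x)"
      by (intro has_derivative_add smooth_on_has_fd[OF _ assms(3)] smooth_on_tauE smooth_on_tauN that)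
    moreover have "((\<lambda>x. - tauN x (W x)) has_derivative (\<lambda>v. - fd (\<lambda>x. tauN x (W x)) x v)) (at x)"
      by (intro has_derivative_minus smooth_on_has_fd[OF _ assms(3)] smooth_on_tauN that)
    ultimately show ?thesis by (simp add: tau_split fd_eq)
  qed
  then show ?thesis by (simp add: extd_def assms tau_split)
qed

text \<open>Symmetry of the second fundamental form: \<open>\<Sum>\<^sub>\<beta> S(e\<^sub>\<beta>, e\<^sub>\<beta>)\<close> pairs with \<open>J P v\<close> to
  \<open>\<Sum>\<^sub>\<beta> g(S(v, e\<^sub>\<beta>), J e\<^sub>\<beta>)\<close>, which is \<open>- \<i>\<close> times the trace of the connection matrix.\<close>

lemma tauE_mean_curvature:
  assumes x: "x \<in> S" and v: "P x v \<in> tf x"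
    and Hv: "H = (\<Sum>\<beta>=k+1..CARD('n). nab (e \<beta>) x (l \<beta> x)) + P x w"
  shows "tauE x v = - \<i> * of_real (G x (J H) (P x v))"
proof -
  interpret hermitian "G x" by (rule hermitian_G[OF x])
  have eq: "G x (J (nab (e \<beta>) x (l \<beta> x))) (P x v) = - G x (nab (e \<beta>) x v) (J (e \<beta> x))"
    if \<beta>: "\<beta> \<in> {k+1..CARD('n)}" for \<beta>
  proof -
    note sl = smooth_l[OF \<beta>]
    have \<beta>': "\<beta> \<in> {1..CARD('n)}" using \<beta> by auto
    have sJ: "smooth_on S (\<lambda>x. J (e \<beta> x))" by (intro smooth_on_linear[OF open_S linear_J] smooth_e \<beta>')
    have ntf: "G y (J (e \<beta> y)) (P y u) = 0" if "y \<in> S" for y u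
      by (rule tf_ortho[OF e_tf[OF that \<beta>]])
    have "fd (\<lambda>x. G x (J (e \<beta> x)) (P x v)) x (l \<beta> x) = fd (\<lambda>x. 0) x (l \<beta> x)"
      by (rule arg_cong[where f = "\<lambda>f. f _"], rule fd_cong_open[OF open_S x]) (rule ntf)
    then have "G x (J (nab (e \<beta>) x (l \<beta> x))) (P x v) = - G x (J (e \<beta> x)) (nab (\<lambda>x. P x v) x (l \<beta> x))"
      by (simp add: fd_eq[OF fd_G[OF sJ smooth_P x]] nab_J[OF smooth_e[OF \<beta>'] x])
    also have "nab (\<lambda>x. P x v) x (l \<beta> x) =
        nab (\<lambda>x. P x (l \<beta> x)) x v + P x (fd (\<lambda>x. v) x (l \<beta> x) - fd (l \<beta>) x v)"
      using torsion_free[OF sl smooth_on_const x, of v] by (simp add: algebra_simps)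
    also have "nab (\<lambda>x. P x (l \<beta> x)) x v = nab (e \<beta>) x v"
      by (rule nab_cong[OF x]) (rule P_l[OF \<beta>])
    finally show ?thesis
      by (simp add: ntf[OF x] bilinear_radd[OF bilin] sym[of "J (e \<beta> x)" "nab (e \<beta>) x v"])
  qed
  \<comment> \<open>The tangential part of \<open>H\<close> drops out, as \<open>v\<close> is
    symplectically orthogonal to the tangent space.\<close>
  have "G x (J (P x w)) (P x v) = 0"
    using tf_ortho[OF v, of w] g_J_left[of "P x w" "P x v"] sym[of "P x w"] by simp
  then have GH: "G x (J H) (P x v) = - (\<Sum>\<beta>=k+1..CARD('n). G x (nab (e \<beta>) x v) (J (e \<beta> x)))"
    unfolding Hv J_add J_sum using eq
    by (simp add: bilinear_ladd[OF bilin] g_sum_left sum_negf)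
  have "om \<beta> \<beta> x v = \<i> * of_real (G x (nab (e \<beta>) x v) (J (e \<beta> x)))" if "\<beta> \<in> {k+1..CARD('n)}" for \<beta>
  proof -
    have "\<beta> \<in> {1..CARD('n)}" using that by auto
    from om_skew[OF x this this, of v] have "Re (om \<beta> \<beta> x v) = 0" by (simp add: complex_eq_iff)
    then show ?thesis by (simp add: om_def hh_def)
  qed
  then show ?thesis unfolding tauE_def GH by (simp add: sum_distrib_left sum_negf)
qed

text \<open>The relation between \<open>tauE\<close> and \<open>a\<close> holds in leaf directions
  only. This is enough: \<open>U\<close> and \<open>W\<close> are leafwise on all of
  \<open>S\<close>, and by \<open>tf_involutive\<close> so is their bracket.\<close>

lemma extd_leafwise:
  assumes "smooth_on S U" "smooth_on S W" "x \<in> S"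
    and U: "\<And>x. x \<in> S \<Longrightarrow> P x (U x) \<in> tf x" and W: "\<And>x. x \<in> S \<Longrightarrow> P x (W x) \<in> tf x"
    and a: "\<And>x v. x \<in> S \<Longrightarrow> P x v \<in> tf x \<Longrightarrow> tauE x v = - \<i> * of_real (a x v :: real)"
  shows "extd tauE U W x = - \<i> * of_real (extd a U W x)"
proof -
  have "fd (\<lambda>x. tauE x (W x)) x v = - \<i> * of_real (fd (\<lambda>x. a x (W x)) x v)"
    if "smooth_on S W" and W: "\<And>x. x \<in> S \<Longrightarrow> P x (W x) \<in> tf x" for W v
  proof -
    \<comment> \<open>Differentiability of \<open>a\<close> on the field \<open>W\<close> is
      inherited from \<open>tauE\<close>: there \<open>a\<close> is minus its imaginary
      part.\<close>
    have "smooth_on S (\<lambda>x. - Im (tauE x (W x)))"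
      by (intro smooth_on_minus smooth_on_bounded_linear[OF _ bounded_linear_Im] open_S smooth_on_tauE that)
    then have "smooth_on S (\<lambda>x. a x (W x))"
      by (rule smooth_on_cong[OF open_S, rotated]) (simp add: a[OF _ W])
    from smooth_on_has_fd[OF this assms(3)]
    have "((\<lambda>x. - \<i> * complex_of_real (a x (W x))) has_derivative
        (\<lambda>v. - \<i> * of_real (fd (\<lambda>x. a x (W x)) x v))) (at x)"
      by (intro has_derivative_mult_right has_derivative_of_real)
    moreover have "fd (\<lambda>x. tauE x (W x)) x = fd (\<lambda>x. - \<i> * of_real (a x (W x))) x"
      by (rule fd_cong_open[OF open_S assms(3)]) (rule a[OF _ W])
    ultimately show ?thesis by (simp add: fd_eq)
  qed
  moreover have "P x (fd W x (U x) - fd U x (W x)) \<in> tf x"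
    by (rule tf_involutive[OF assms(1-3) U W])
  ultimately show ?thesis
    using assms by (simp add: extd_def a algebra_simps)
qed

end

section \<open>Kaehler manifolds\<close>

locale smooth_atlas =
  fixes A :: "('x::topological_space, 'e::euclidean_space) atlas"
  assumes smooth_manifold: "smooth_manifold A"
begin

lemma chart_center: "q \<in> chart_dom A q"
  and open_chart_dom: "open (chart_dom A q)"
  and open_chart_img: "open (chart_img A q)"
  and homeomorphism_chart: "homeomorphism (chart_dom A q) (chart_img A q) (chart_map A q) (chart_inv A q)"
  and smooth_transition: "smooth_on (chart_map A q ` (chart_dom A q \<inter> chart_dom A r)) (transition A q r)"
  using smooth_manifold unfolding smooth_manifold_def by blast+

lemma chart_inv_map [simp]: "p \<in> chart_dom A q \<Longrightarrow> chart_inv A q (chart_map A q p) = p"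
  by (rule homeomorphism_apply1[OF homeomorphism_chart])

lemma chart_map_inv [simp]: "x \<in> chart_img A q \<Longrightarrow> chart_map A q (chart_inv A q x) = x"
  by (rule homeomorphism_apply2[OF homeomorphism_chart])

lemma chart_inv_dom: "x \<in> chart_img A q \<Longrightarrow> chart_inv A q x \<in> chart_dom A q"
  using homeomorphism_image2[OF homeomorphism_chart] by blast

lemma chart_map_img: "p \<in> chart_dom A q \<Longrightarrow> chart_map A q p \<in> chart_img A q"
  by (simp add: chart_img_def)

lemma open_chart_image:
  assumes "open U" "U \<subseteq> chart_dom A q"
  shows "open (chart_map A q ` U)"
proof -
  have "openin (top_of_set (chart_img A q)) (chart_map A q ` U)"
    by (rule homeomorphism_imp_open_map[OF homeomorphism_chart])
      (use assms in \<open>metis open_chart_dom openin_open_eq\<close>)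
  then show ?thesis using open_chart_img openin_open_trans by blast
qed

lemma open_overlap: "open (chart_map A q ` (chart_dom A q \<inter> chart_dom A r))"
  by (intro open_chart_image open_Int open_chart_dom) auto

lemma overlapI: "p \<in> chart_dom A q \<Longrightarrow> p \<in> chart_dom A r \<Longrightarrow> chart_map A q p \<in> chart_map A q ` (chart_dom A q \<inter> chart_dom A r)"
  by blast

lemma transition_has_derivative:
  assumes "p \<in> chart_dom A q" "p \<in> chart_dom A r"
  shows "(transition A q r has_derivative fd (transition A q r) (chart_map A q p)) (at (chart_map A q p))"
  by (rule smooth_on_has_fd[OF smooth_transition overlapI[OF assms]])

text \<open>At its own centre a chart uses the very coordinates in which tangent vectors are stored;
  this is what makes centred charts convenient in the end.\<close>

lemma transition_self: "fd (transition A q q) (chart_map A q q) = id"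
proof -
  have "fd (transition A q q) (chart_map A q q) = fd id (chart_map A q q)"
    by (rule fd_cong_open[OF open_chart_img chart_map_img[OF chart_center]]) (simp add: transition_def)
  then show ?thesis by simp
qed

lemma transition_inverse:
  assumes "p \<in> chart_dom A q" "p \<in> chart_dom A r"
  shows "fd (transition A r q) (chart_map A r p) (fd (transition A q r) (chart_map A q p) v) = v"
proof -
  let ?x = "chart_map A q p"
  have x: "transition A q r ?x = chart_map A r p" using assms by (simp add: transition_def)
  have "((\<lambda>z. transition A r q (transition A q r z)) has_derivative
      (\<lambda>v. fd (transition A r q) (chart_map A r p) (fd (transition A q r) ?x v))) (at ?x)"
    by (rule has_derivative_compose[OF transition_has_derivative[OF assms]])
      (unfold x, rule transition_has_derivative[OF assms(2,1)])
  then have "fd (\<lambda>z. transition A r q (transition A q r z)) ?x v =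
      fd (transition A r q) (chart_map A r p) (fd (transition A q r) ?x v)" by (simp add: fd_eq)
  moreover have "fd (\<lambda>z. transition A r q (transition A q r z)) ?x = fd id ?x"
    by (rule fd_cong_open[OF open_overlap[of q r] overlapI[OF assms]]) (auto simp: transition_def)
  ultimately show ?thesis by simp
qed

lemma from_to_chart [simp]: "p \<in> chart_dom A q \<Longrightarrow> from_chart A q p (to_chart A q p v) = v"
  and to_from_chart [simp]: "p \<in> chart_dom A q \<Longrightarrow> to_chart A q p (from_chart A q p v) = v"
  by (simp_all add: from_chart_def to_chart_def transition_inverse chart_center)

lemma from_chart_self [simp]: "from_chart A q q v = v"
  and to_chart_self [simp]: "to_chart A q q v = v"
  by (simp_all add: from_chart_def to_chart_def transition_self)

lemma linear_from_chart: "p \<in> chart_dom A q \<Longrightarrow> linear (from_chart A q p)"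
  unfolding from_chart_def[abs_def]
  by (rule has_derivative_linear[OF transition_has_derivative]) (auto simp: chart_center)

lemma linear_to_chart: "p \<in> chart_dom A q \<Longrightarrow> linear (to_chart A q p)"
  unfolding to_chart_def[abs_def]
  by (rule has_derivative_linear[OF transition_has_derivative]) (auto simp: chart_center)

end

text \<open>\<open>T u v w\<close> stands for \<open>g((\<nabla>\<^sub>u J) v, w) = (\<nabla>\<^sub>u \<omega>)(v, w)\<close>; the second hypothesis is \<open>d\<omega> = 0\<close>, the last one says
  that the Nijenhuis tensor is zero.\<close>

lemma covariant_J_vanishes:
  fixes T :: "complex ^ 'n \<Rightarrow> complex ^ 'n \<Rightarrow> complex ^ 'n \<Rightarrow> real"
  assumes skew: "\<And>u v w. T u v w = - T u w v"
    and closed: "\<And>u v w. T u v w + T v w u + T w u v = 0"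
    and J2: "\<And>u v w. T u (J v) w = T u v (J w)"
    and minus: "\<And>u v w. T u v (- w) = - T u v w"
    and nijenhuis: "\<And>u v w. T (J u) v (J w) - T (J v) u (J w) = T u v w - T v u w"
  shows "T u v w = 0"
proof -
  \<comment> \<open>The cyclic identity for \<open>u\<close>, \<open>J v\<close>, \<open>J w\<close>
    becomes, through \<open>nijenhuis\<close>, the equation
    \<open>T v w u + T w u v = T u v w\<close>; added to the one for \<open>u\<close>,
    \<open>v\<close>, \<open>w\<close> it gives \<open>2 * T u v w = 0\<close>.\<close>
  have "T u (J v) (J w) = - T u v w" by (simp add: J2 J_J minus)
  moreover have "T (J v) (J w) u = T (J v) w (J u)" by (rule J2)
  moreover have "T (J w) u (J v) = - T (J w) v (J u)" using skew[of "J w" u "J v"] J2[of "J w" v u] by simp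
  ultimately show ?thesis
    using closed[of u v w] closed[of u "J v" "J w"] nijenhuis[of v w u] skew[of w u v] by linarith
qed

section \<open>The Levi-Civita connection of a Kaehler metric\<close>

locale kaehler_manifold =
  fixes A :: "('x::topological_space, complex ^ 'n::finite) atlas"
    and \<omega> :: "'x \<Rightarrow> complex ^ 'n \<Rightarrow> complex ^ 'n \<Rightarrow> real"
    and \<Gamma> :: "('x, complex ^ 'n) christoffel"
  assumes kaehler: "kaehler A \<omega>" and levi_civita: "levi_civita A (kmetric \<omega>) \<Gamma>"
begin

sublocale smooth_atlas A
  using kaehler by unfold_locales (simp add: kaehler_def complex_manifold_def)

lemma transition_J:
  assumes "p \<in> chart_dom A q" "p \<in> chart_dom A r"
  shows "fd (transition A q r) (chart_map A q p) (J v) = J (fd (transition A q r) (chart_map A q p) v)"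
  using kaehler overlapI[OF assms] unfolding kaehler_def complex_manifold_def by blast

lemma from_chart_J: "p \<in> chart_dom A q \<Longrightarrow> from_chart A q p (J v) = J (from_chart A q p v)"
  by (simp add: from_chart_def transition_J chart_center)

lemma closed_2form: "closed_2form A \<omega>"
  and omega_J: "\<omega> p (J u) (J v) = \<omega> p u v"
  and kmetric_pos: "v \<noteq> 0 \<Longrightarrow> 0 < kmetric \<omega> p v v"
  using kaehler unfolding kaehler_def by blast+

lemma bilinear_omega: "bilinear (\<omega> p)"
  and omega_skew: "\<omega> p u v = - \<omega> p v u"
  and smooth_omega: "smooth_on (chart_img A q) (\<lambda>x. tensor_in_chart A \<omega> q x u v)"
  and d_omega: "z \<in> chart_img A q \<Longrightarrow> fd (\<lambda>x. tensor_in_chart A \<omega> q x v w) z u +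
        fd (\<lambda>x. tensor_in_chart A \<omega> q x w u) z v + fd (\<lambda>x. tensor_in_chart A \<omega> q x u v) z w = 0"
  using closed_2form unfolding closed_2form_def by blast+

lemma omega_kmetric: "\<omega> p u v = kmetric \<omega> p (J u) v"
  by (simp add: kmetric_def omega_J)

lemma hermitian_kmetric: "hermitian (kmetric \<omega> p)"
proof unfold_locales
  show "bilinear (kmetric \<omega> p)"
    unfolding kmetric_def bilinear_def
    using bilinear_linear_left[OF bilinear_omega]
      linear_compose[OF linear_J bilinear_linear_right[OF bilinear_omega]] by (auto simp: comp_def)
  show "kmetric \<omega> p u v = kmetric \<omega> p v u" for u v
    using omega_J[of p u "J v"] omega_skew[of p "J u" v]
    by (simp add: kmetric_def J_J bilinear_rneg[OF bilinear_omega])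
  show "kmetric \<omega> p (J u) (J v) = kmetric \<omega> p u v" for u v
    by (simp add: kmetric_def omega_J)
qed (rule kmetric_pos)

definition gc :: "'x \<Rightarrow> complex ^ 'n \<Rightarrow> complex ^ 'n \<Rightarrow> complex ^ 'n \<Rightarrow> real" where
  "gc q = tensor_in_chart A (kmetric \<omega>) q"

lemma gc_from: "p \<in> chart_dom A q \<Longrightarrow>
    gc q (chart_map A q p) u v = kmetric \<omega> p (from_chart A q p u) (from_chart A q p v)"
  by (simp add: gc_def tensor_in_chart_def)

lemma hermitian_gc:
  assumes "z \<in> chart_img A q"
  shows "hermitian (gc q z)"
proof -
  obtain p where p: "p \<in> chart_dom A q" "z = chart_map A q p" using assms by (auto simp: chart_img_def)
  interpret hermitian "kmetric \<omega> p" by (rule hermitian_kmetric)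
  note l = linear_from_chart[OF p(1)]
  have eq: "gc q z = (\<lambda>u v. kmetric \<omega> p (from_chart A q p u) (from_chart A q p v))"
    unfolding p(2) by (intro ext) (rule gc_from[OF p(1)])
  show ?thesis
  proof unfold_locales
    show "bilinear (gc q z)"
      unfolding eq bilinear_def
      using linear_compose[OF l bilinear_linear_left[OF bilin]]
        linear_compose[OF l bilinear_linear_right[OF bilin]] by (auto simp: comp_def)
    show "gc q z u v = gc q z v u" for u v unfolding eq by (rule sym)
    show "0 < gc q z v v" if "v \<noteq> 0" for v
      unfolding eq using that to_from_chart[OF p(1), of v] linear_0[OF linear_to_chart[OF p(1)]]
      by (intro pos) auto
    show "gc q z (J u) (J v) = gc q z u v" for u v
      unfolding eq by (simp add: from_chart_J[OF p(1)] g_J)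
  qed
qed

lemma gc_omega:
  assumes "z \<in> chart_img A q"
  shows "gc q z u v = tensor_in_chart A \<omega> q z u (J v)"
  using chart_inv_dom[OF assms] by (simp add: gc_def tensor_in_chart_def kmetric_def from_chart_J)

lemma omega_gc: "z \<in> chart_img A q \<Longrightarrow> tensor_in_chart A \<omega> q z u v = gc q z (J u) v"
  using chart_inv_dom by (simp add: gc_def tensor_in_chart_def omega_kmetric from_chart_J)

lemma smooth_gc: "smooth_on (chart_img A q) (\<lambda>z. gc q z u v)"
  by (rule smooth_on_cong[OF open_chart_img _ smooth_omega]) (rule gc_omega[symmetric])

lemma affine: "affine_connection A \<Gamma>"
  and christoffel_sym: "z \<in> chart_img A q \<Longrightarrow> \<Gamma> q z u v = \<Gamma> q z v u"
  and fd_gc: "z \<in> chart_img A q \<Longrightarrow> fd (\<lambda>x. gc q x v w) z u = gc q z (\<Gamma> q z u v) w + gc q z v (\<Gamma> q z u w)"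
  using levi_civita unfolding levi_civita_def gc_def by blast+

lemma bilinear_christoffel: "z \<in> chart_img A q \<Longrightarrow> bilinear (\<Gamma> q z)"
  and smooth_christoffel: "smooth_on (chart_img A q) (\<lambda>z. \<Gamma> q z u v)"
  using affine unfolding affine_connection_def by blast+

text \<open>In holomorphic coordinates \<open>J\<close> is constant, so this is the parallelism of
  \<open>J\<close>. It follows through \<open>covariant_J_vanishes\<close> from closedness of the
  Kaehler form, \<open>J\<^sup>2 = - 1\<close> and symmetry of the Christoffel symbols.\<close>

lemma christoffel_J:
  assumes z: "z \<in> chart_img A q"
  shows "\<Gamma> q z u (J v) = J (\<Gamma> q z u v)"
proof -
  interpret hermitian "gc q z" by (rule hermitian_gc[OF z])
  note b = bilinear_ladd[OF bilinear_christoffel[OF z]] bilinear_radd[OF bilinear_christoffel[OF z]]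
    bilinear_rneg[OF bilinear_christoffel[OF z]] bilinear_lneg[OF bilinear_christoffel[OF z]]
  define N where "N u v = \<Gamma> q z u (J v) - J (\<Gamma> q z u v)" for u v
  define T where "T u v w = gc q z (N u v) w" for u v w
  \<comment> \<open>\<open>T u v w\<close> is the covariant derivative of the Kaehler form. The
    other two terms are Christoffel corrections, which cancel in \<open>skew\<close> and, by
    symmetry of \<Gamma>, in \<open>closed\<close>.\<close>
  have d: "fd (\<lambda>x. tensor_in_chart A \<omega> q x v w) z u
      = T u v w + tensor_in_chart A \<omega> q z (\<Gamma> q z u v) w + tensor_in_chart A \<omega> q z v (\<Gamma> q z u w)" for u v w
  proof -
    have "fd (\<lambda>x. tensor_in_chart A \<omega> q x v w) z = fd (\<lambda>x. gc q x (J v) w) z"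
      by (rule fd_cong_open[OF open_chart_img z]) (rule omega_gc)
    then show ?thesis
      by (simp add: fd_gc[OF z] T_def N_def g_simps omega_gc[OF z])
  qed
  have om_skew: "tensor_in_chart A \<omega> q x u v = - tensor_in_chart A \<omega> q x v u" for x u v
    unfolding tensor_in_chart_def by (rule omega_skew)
  have skew: "T u v w = - T u w v" for u v w
  proof -
    have "fd (\<lambda>x. tensor_in_chart A \<omega> q x v w) z u = fd (\<lambda>x. - tensor_in_chart A \<omega> q x w v) z u"
      by (subst om_skew) (rule refl)
    also have "\<dots> = - fd (\<lambda>x. tensor_in_chart A \<omega> q x w v) z u"
      using fd_eq[OF has_derivative_minus[OF smooth_on_has_fd[OF smooth_omega z]]] by simp
    finally show ?thesis
      using om_skew[of z "\<Gamma> q z u v" w] om_skew[of z "\<Gamma> q z u w" v] by (simp add: d)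
  qed
  have closed: "T u v w + T v w u + T w u v = 0" for u v w
    using d_omega[OF z, of v w u] om_skew[of z "\<Gamma> q z u v" w] om_skew[of z "\<Gamma> q z v w" u]
      om_skew[of z "\<Gamma> q z w u" v]
      christoffel_sym[OF z, of u v] christoffel_sym[OF z, of v w] christoffel_sym[OF z, of w u]
    by (simp add: d)
  have J2: "T u (J v) w = T u v (J w)" for u v w
  proof -
    have "N u (J v) = - J (N u v)" by (simp add: N_def J_J J_diff b)
    then show ?thesis by (simp add: T_def g_simps g_J_left)
  qed
  \<comment> \<open>Vanishing of the Nijenhuis tensor is hidden in the constancy of
    \<open>J\<close>: the relevant terms reduce to
    \<open>\<Gamma> (J u) (J v) + \<Gamma> v u\<close>, which is symmetric in \<open>u\<close> and
    \<open>v\<close>.\<close>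
  have nij: "T (J u) v (J w) - T (J v) u (J w) = T u v w - T v u w" for u v w
  proof -
    have "N (J u) v + J (N v u) = N (J v) u + J (N u v)"
      using christoffel_sym[OF z, of "J u" "J v"] christoffel_sym[OF z, of "J u" v]
        christoffel_sym[OF z, of "J v" u] christoffel_sym[OF z, of u v]
      by (simp add: N_def J_diff J_J)
    then have "N (J u) v - N (J v) u = J (N u v - N v u)" by (simp add: J_diff algebra_simps)
    then have "gc q z (N (J u) v - N (J v) u) (J w) = gc q z (N u v - N v u) w" by (simp add: g_J)
    then show ?thesis by (simp add: T_def g_simps)
  qed
  have "T u v w = 0" for w
    by (rule covariant_J_vanishes[of T, OF skew closed J2 _ nij]) (simp add: T_def g_simps)
  then have "N u v = 0" using g_eq_0[of "N u v"] by (simp add: T_def)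
  then show ?thesis by (simp add: N_def)
qed

text \<open>Commuting with \<open>J\<close> makes the complexified curvature operator preserve the
  (1,0) part, so that a curvature matrix in the frame \<open>u\<^sub>j\<close> exists.\<close>

lemma linear_riemann: "linear (riemann A \<Gamma> p u v)"
  and riemann_J: "riemann A \<Gamma> p u v (J w) = J (riemann A \<Gamma> p u v w)"
proof -
  let ?z = "chart_map A p p"
  have z: "?z \<in> chart_img A p" by (rule chart_map_img[OF chart_center])
  note l = bilinear_linear_right[OF bilinear_christoffel[OF z]]
  have "linear (\<lambda>w. fd (\<lambda>z. \<Gamma> p z v w) ?z u)" for u v
  proof (rule linearI)
    fix w w' :: "complex ^ 'n" and r :: real
    have "fd (\<lambda>z. \<Gamma> p z v (w + w')) ?z = fd (\<lambda>z. \<Gamma> p z v w + \<Gamma> p z v w') ?z"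
      by (rule fd_cong_open[OF open_chart_img z]) (rule bilinear_radd[OF bilinear_christoffel])
    then show "fd (\<lambda>z. \<Gamma> p z v (w + w')) ?z u = fd (\<lambda>z. \<Gamma> p z v w) ?z u + fd (\<lambda>z. \<Gamma> p z v w') ?z u"
      using fd_eq[OF has_derivative_add[OF smooth_on_has_fd[OF smooth_christoffel z]
        smooth_on_has_fd[OF smooth_christoffel z]]] by simp
    have "fd (\<lambda>z. \<Gamma> p z v (r *\<^sub>R w)) ?z = fd (\<lambda>z. r *\<^sub>R \<Gamma> p z v w) ?z"
      by (rule fd_cong_open[OF open_chart_img z]) (rule bilinear_rmul[OF bilinear_christoffel])
    then show "fd (\<lambda>z. \<Gamma> p z v (r *\<^sub>R w)) ?z u = r *\<^sub>R fd (\<lambda>z. \<Gamma> p z v w) ?z u"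
      using fd_eq[OF has_derivative_scaleR_right[OF smooth_on_has_fd[OF smooth_christoffel z]]] by simp
  qed
  then show "linear (riemann A \<Gamma> p u v)"
    unfolding riemann_def[abs_def] Let_def
    by (intro linear_compose_sub linear_compose_add linear_compose[OF l l, unfolded comp_def])
  have "fd (\<lambda>z. \<Gamma> p z v (J w)) ?z u = J (fd (\<lambda>z. \<Gamma> p z v w) ?z u)" for u v
  proof -
    have "fd (\<lambda>z. \<Gamma> p z v (J w)) ?z = fd (\<lambda>z. J (\<Gamma> p z v w)) ?z"
      by (rule fd_cong_open[OF open_chart_img z]) (rule christoffel_J)
    then show ?thesis
      using fd_eq[OF bounded_linear.has_derivative[OF linear_J[unfolded linear_conv_bounded_linear]
        smooth_on_has_fd[OF smooth_christoffel z]]] by simp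
  qed
  then show "riemann A \<Gamma> p u v (J w) = J (riemann A \<Gamma> p u v w)"
    by (simp add: riemann_def Let_def christoffel_J[OF z] J_add J_diff)
qed

text \<open>\<open>ricci_form\<close> constrains \<rho> through unitary frames that come with a
  curvature matrix \<open>K\<close>; the Hermitian coefficients of the curvature operator are such a
  matrix.\<close>

lemma ricci_trace:
  assumes "ricci_form A \<omega> \<Gamma> \<rho>" and e: "hermitian.unitary (kmetric \<omega> p) {1..CARD('n)} e"
  shows "\<i> * complex_of_real (\<rho> p u v) =
    (\<Sum>j=1..CARD('n). hermitian.h (kmetric \<omega> p) (riemann A \<Gamma> p u v (e j)) (e j))"
proof -
  interpret hermitian "kmetric \<omega> p" by (rule hermitian_kmetric)
  define K where "K i j u v = h (riemann A \<Gamma> p u v (e j)) (e i)" for i j u v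
  have "unitary_frame_at \<omega> p e"
    using e unfolding unitary_frame_at_def unitary_iff by (simp add: g_J)
  moreover have "curvature_forms_at A \<Gamma> p e K"
    unfolding curvature_forms_at_def
  proof (intro allI ballI)
    fix u v j
    have "cext (riemann A \<Gamma> p u v) (u_frame e j) = part10 (riemann A \<Gamma> p u v (e j))"
      unfolding u_frame_part10 by (rule cext_part10[OF linear_riemann riemann_J])
    also have "riemann A \<Gamma> p u v (e j) = (\<Sum>i=1..CARD('n). K i j u v *s e i)"
      unfolding K_def by (rule unitary_expansion[OF e]) auto
    finally show "cext (riemann A \<Gamma> p u v) (u_frame e j) = (\<Sum>i=1..CARD('n). cscale (K i j u v) (u_frame e i))"
      by (simp add: part10_sum cscale_part10 u_frame_part10)
  qed
  ultimately show ?thesis using assms(1) unfolding ricci_form_def K_def by blast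
qed

end

section \<open>Coisotropic submanifolds\<close>

locale coisotropic_submanifold = kaehler_manifold A \<omega> \<Gamma>
  for A :: "('x::topological_space, complex ^ 'n::finite) atlas"
    and \<omega> :: "'x \<Rightarrow> complex ^ 'n \<Rightarrow> complex ^ 'n \<Rightarrow> real"
    and \<Gamma> :: "('x, complex ^ 'n) christoffel" +
  fixes B :: "('y::topological_space, 'f::euclidean_space) atlas" and \<iota> :: "'y \<Rightarrow> 'x" and k :: nat
  assumes embedded: "embedded_submanifold A B \<iota>" and coisotropic: "coisotropic A \<omega> B \<iota>"
    and dimension: "DIM('f) = CARD('n) + k"
begin

sublocale B: smooth_atlas B
  using embedded by unfold_locales (simp add: embedded_submanifold_def)

lemma continuous_embedding: "continuous_on UNIV \<iota>"
  using embedded unfolding embedded_submanifold_def homeomorphism_def by blast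

lemma inj_push: "inj (push A B \<iota> y)"
  using embedded unfolding embedded_submanifold_def by blast

end

section \<open>The submanifold in a pair of charts\<close>

locale submanifold_chart = coisotropic_submanifold A \<omega> \<Gamma> B \<iota> k
  for A :: "('x::topological_space, complex ^ 'n::finite) atlas"
    and \<omega> :: "'x \<Rightarrow> complex ^ 'n \<Rightarrow> complex ^ 'n \<Rightarrow> real"
    and \<Gamma> :: "('x, complex ^ 'n) christoffel"
    and B :: "('y::topological_space, 'f::euclidean_space) atlas" and \<iota> :: "'y \<Rightarrow> 'x" and k :: nat +
  fixes q :: 'x and r :: 'y
begin

text \<open>The data that interpret \<open>coisotropic_chart\<close>: \<open>phi\<close> is \<iota>
  in the two charts, \<open>met\<close> the metric along it, \<open>chr\<close> the pulled-back
  Christoffel term. \<open>cdom\<close> is the part of the chart of \<open>B\<close> that \<iota>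
  maps into the chart of \<open>A\<close>.\<close>

definition cdom :: "'y set" where "cdom = chart_dom B r \<inter> \<iota> -` chart_dom A q"
definition cimg :: "'f set" where "cimg = chart_map B r ` cdom"
definition phi :: "'f \<Rightarrow> complex ^ 'n" where "phi = chart_map A q \<circ> \<iota> \<circ> chart_inv B r"
definition met :: "'f \<Rightarrow> complex ^ 'n \<Rightarrow> complex ^ 'n \<Rightarrow> real" where "met x = gc q (phi x)"
definition chr :: "'f \<Rightarrow> 'f \<Rightarrow> complex ^ 'n \<Rightarrow> complex ^ 'n" where "chr x v a = \<Gamma> q (phi x) (fd phi x v) a"
abbreviation dphi :: "'f \<Rightarrow> 'f \<Rightarrow> complex ^ 'n" where "dphi x v \<equiv> fd phi x v"
abbreviation xc :: "'y \<Rightarrow> 'f" where "xc \<equiv> chart_map B r"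
abbreviation fromA :: "'y \<Rightarrow> complex ^ 'n \<Rightarrow> complex ^ 'n" where "fromA y \<equiv> from_chart A q (\<iota> y)"
abbreviation toA :: "'y \<Rightarrow> complex ^ 'n \<Rightarrow> complex ^ 'n" where "toA y \<equiv> to_chart A q (\<iota> y)"
abbreviation fromB :: "'y \<Rightarrow> 'f \<Rightarrow> 'f" where "fromB y \<equiv> from_chart B r y"
abbreviation toB :: "'y \<Rightarrow> 'f \<Rightarrow> 'f" where "toB y \<equiv> to_chart B r y"

lemma cdomD: "y \<in> cdom \<Longrightarrow> y \<in> chart_dom B r" "y \<in> cdom \<Longrightarrow> \<iota> y \<in> chart_dom A q"
  by (auto simp: cdom_def)

lemma open_cdom: "open cdom"
  unfolding cdom_def
  by (intro open_Int B.open_chart_dom open_vimage[OF open_chart_dom continuous_embedding])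

lemma open_cimg: "open cimg"
  unfolding cimg_def by (rule B.open_chart_image[OF open_cdom]) (auto simp: cdom_def)

lemma cimgI: "y \<in> cdom \<Longrightarrow> xc y \<in> cimg"
  by (simp add: cimg_def)

lemma cimgE:
  assumes "x \<in> cimg"
  obtains y where "y \<in> cdom" "x = xc y" "chart_inv B r x = y"
proof -
  from assms obtain y where y: "y \<in> cdom" "x = xc y" unfolding cimg_def by blast
  show thesis using that[OF y] y by (simp add: cdomD)
qed

lemma smooth_phi: "smooth_on cimg phi"
  using embedded unfolding embedded_submanifold_def cimg_def cdom_def phi_def by blast

lemma phi_chart: "y \<in> cdom \<Longrightarrow> phi (xc y) = chart_map A q (\<iota> y)"
  by (simp add: phi_def cdomD)

lemma phi_img: "x \<in> cimg \<Longrightarrow> phi x \<in> chart_img A q"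
  by (erule cimgE) (simp add: phi_chart chart_map_img cdomD)

lemma phi_has_derivative: "x \<in> cimg \<Longrightarrow> (phi has_derivative dphi x) (at x)"
  by (rule smooth_on_has_fd[OF smooth_phi])

lemma met_from: "y \<in> cdom \<Longrightarrow> met (xc y) a b = kmetric \<omega> (\<iota> y) (fromA y a) (fromA y b)"
  by (simp add: met_def phi_chart gc_from cdomD)

text \<open>\<open>push\<close> is formed in the charts centred at \<open>y\<close> and
  \<open>\<iota> y\<close>. The chain rule through the two transition maps rewrites it in the fixed
  pair of charts.\<close>

lemma push_eq:
  assumes y: "y \<in> cdom"
  shows "push A B \<iota> y v = fromA y (dphi (xc y) (toB y v))"
proof -
  let ?c = "chart_map B y y"
  have yr: "y \<in> chart_dom B r" and yq: "\<iota> y \<in> chart_dom A q" using y by (auto dest: cdomD)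
  have t: "transition B y r ?c = xc y" by (simp add: transition_def B.chart_center)
  have d1: "(transition B y r has_derivative toB y) (at ?c)"
    using B.transition_has_derivative[OF B.chart_center yr] by (simp add: to_chart_def[abs_def])
  have d2: "((\<lambda>z. phi (transition B y r z)) has_derivative (\<lambda>v. dphi (xc y) (toB y v))) (at ?c)"
    by (rule has_derivative_compose[OF d1]) (unfold t, rule phi_has_derivative[OF cimgI[OF y]])
  have d3: "(transition A q (\<iota> y) has_derivative fromA y) (at (phi (transition B y r ?c)))"
    unfolding t phi_chart[OF y]
    using transition_has_derivative[OF yq chart_center] by (simp add: from_chart_def[abs_def])
  have d: "((\<lambda>z. transition A q (\<iota> y) (phi (transition B y r z))) has_derivative
      (\<lambda>v. fromA y (dphi (xc y) (toB y v)))) (at ?c)"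
    by (rule has_derivative_compose[OF d2 d3])
  \<comment> \<open>On this neighbourhood all four charts are available and the two expressions for
    the embedding coincide.\<close>
  define N where "N = chart_map B y ` (chart_dom B y \<inter> cdom \<inter> \<iota> -` chart_dom A (\<iota> y))"
  have "open N"
    unfolding N_def
    by (intro B.open_chart_image open_Int B.open_chart_dom open_cdom
        open_vimage[OF open_chart_dom continuous_embedding]) auto
  moreover have "?c \<in> N" using y B.chart_center chart_center by (auto simp: N_def)
  ultimately have "fd (chart_map A (\<iota> y) \<circ> \<iota> \<circ> chart_inv B y) ?c =
      fd (\<lambda>z. transition A q (\<iota> y) (phi (transition B y r z))) ?c"
    by (rule fd_cong_open) (auto simp: N_def transition_def phi_def cdomD)
  then show ?thesis by (simp add: push_def fd_eq[OF d])
qed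

lemma TF_iff:
  assumes y: "y \<in> cdom"
  shows "fromA y a \<in> TF A \<omega> B \<iota> y \<longleftrightarrow> (\<forall>v. met (xc y) (J a) (dphi (xc y) v) = 0)"
proof -
  have "fromA y a \<in> TF A \<omega> B \<iota> y \<longleftrightarrow> (\<forall>v. met (xc y) (J a) (dphi (xc y) (toB y v)) = 0)"
    using y by (simp add: TF_def symplectic_orthogonal_def TY_def push_eq met_from omega_kmetric
        from_chart_J cdomD)
  also have "\<dots> \<longleftrightarrow> (\<forall>v. met (xc y) (J a) (dphi (xc y) v) = 0)"
    using B.to_from_chart[OF cdomD(1)[OF y]] by metis
  finally show ?thesis .
qed

text \<open>The analytic axioms are ambient properties composed with \<open>phi\<close>,
  compatibility with the metric being the chain rule; injectivity and coisotropy are translated by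
  \<open>push_eq\<close> and \<open>TF_iff\<close>.\<close>

sublocale chart: coisotropic_chart cimg met chr dphi k
proof (rule coisotropic_chart.intro)
  show "open cimg" by (rule open_cimg)
  show "DIM('f) = CARD('n) + k" by (rule dimension)
  show "smooth_on cimg (\<lambda>x. dphi x v)" for v by (rule smooth_on_fd[OF smooth_phi])
  show "smooth_on cimg (\<lambda>x. met x a b)" for a b
    unfolding met_def by (rule smooth_on_compose[OF open_cimg smooth_phi smooth_gc]) (auto simp: phi_img)
  show "smooth_on cimg (\<lambda>x. chr x v a)" for v a
    unfolding chr_def
    by (rule smooth_on_linear_family[where P = "\<lambda>x b. \<Gamma> q (phi x) b a" and Z = "\<lambda>x. dphi x v", OF open_cimg])
      (auto intro!: bilinear_linear_left[OF bilinear_christoffel] phi_img smooth_on_fd smooth_phi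
        smooth_on_compose[OF open_cimg smooth_phi smooth_christoffel])
  fix x assume x: "x \<in> cimg"
  then obtain y where y: "y \<in> cdom" "x = xc y" by (rule cimgE)
  note px = phi_img[OF x]
  show lin: "linear (dphi x)" by (rule smooth_on_linear_fd[OF smooth_phi x])
  show "hermitian (met x)" unfolding met_def by (rule hermitian_gc[OF px])
  show "bilinear (chr x)"
    unfolding bilinear_def chr_def
    using linear_compose[OF lin bilinear_linear_left[OF bilinear_christoffel[OF px]]]
      bilinear_linear_right[OF bilinear_christoffel[OF px]] by (auto simp: comp_def)
  show "chr x v (J a) = J (chr x v a)" for v a unfolding chr_def by (rule christoffel_J[OF px])
  show "fd (\<lambda>x. met x a b) x v = met x (chr x v a) b + met x a (chr x v b)" for a b v
  proof -
    have "((\<lambda>x. gc q (phi x) a b) has_derivative (\<lambda>v. fd (\<lambda>z. gc q z a b) (phi x) (dphi x v))) (at x)"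
      by (rule has_derivative_compose[OF phi_has_derivative[OF x] smooth_on_has_fd[OF smooth_gc px]])
    then show ?thesis by (simp add: met_def fd_eq fd_gc[OF px] chr_def)
  qed
  \<comment> \<open>Torsion-freeness along the embedding: the second derivative of
    \<open>phi\<close> and the Christoffel symbols are both symmetric.\<close>
  show "fd (\<lambda>x. dphi x v) x u + chr x u (dphi x v) = fd (\<lambda>x. dphi x u) x v + chr x v (dphi x u)" for u v
    using second_derivative_symmetric[OF open_cimg smooth_phi x, of v u] christoffel_sym[OF px]
    by (simp add: chr_def)
  show "inj (dphi x)"
  proof (rule injI)
    fix u v assume uv: "dphi x u = dphi x v"
    have yB: "y \<in> chart_dom B r" using y by (simp add: cdomD)
    have "push A B \<iota> y (fromB y u) = push A B \<iota> y (fromB y v)"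
      using uv by (simp add: push_eq y yB)
    then have "fromB y u = fromB y v" using inj_push by (auto dest: injD)
    then show "u = v" using B.to_from_chart[OF yB] by metis
  qed
  show "a \<in> range (dphi x)" if "\<And>v. met x (J a) (dphi x v) = 0" for a
  proof -
    have "fromA y a \<in> TF A \<omega> B \<iota> y" using that TF_iff[OF y(1)] y(2) by blast
    then obtain v where "fromA y a = push A B \<iota> y v"
      using coisotropic unfolding coisotropic_def TY_def by blast
    then have "toA y (fromA y a) = toA y (fromA y (dphi x (toB y v)))" by (simp add: push_eq y)
    then show ?thesis by (simp add: cdomD y(1))
  qed
qed

lemma TF_tf: "y \<in> cdom \<Longrightarrow> fromA y a \<in> TF A \<omega> B \<iota> y \<longleftrightarrow> a \<in> chart.tf (xc y)"
  by (simp add: TF_iff chart.tf_def)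

lemma leaf_dir_iff: "y \<in> cdom \<Longrightarrow> v \<in> leaf_dir A \<omega> B \<iota> y \<longleftrightarrow> dphi (xc y) (toB y v) \<in> chart.tf (xc y)"
  by (simp add: leaf_dir_def push_eq TF_tf)

text \<open>The covariant derivative depends on the section near \<open>y\<close> only, so agreement
  over \<open>T\<close> suffices; frames that live on a smaller set can thus be differentiated with
  the connection of the whole chart.\<close>

lemma nabla_eq:
  assumes T: "open T" "T \<subseteq> cimg" and y: "y \<in> cdom" "xc y \<in> T"
    and Z: "\<And>y. y \<in> cdom \<Longrightarrow> xc y \<in> T \<Longrightarrow> Z' y = fromA y (Z (xc y))"
  shows "nabla A \<Gamma> B \<iota> q r Z' y v = fromA y (chart.nab Z (xc y) (toB y v))"
proof -
  have "fd (section_in_charts A B \<iota> q r Z') (xc y) = fd Z (xc y)"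
  proof (rule fd_cong_open[OF T(1) y(2)])
    fix x assume x: "x \<in> T"
    then obtain y' where "y' \<in> cdom" "x = xc y'" "chart_inv B r x = y'" using T cimgE by blast
    then show "section_in_charts A B \<iota> q r Z' x = Z x"
      using x by (simp add: section_in_charts_def Z cdomD)
  qed
  then show ?thesis
    using y by (simp add: nabla_def chart.nab_def Z push_eq chr_def phi_chart cdomD)
qed

lemma hh_from:
  "y \<in> cdom \<Longrightarrow> hermitian.h (kmetric \<omega> (\<iota> y)) (fromA y a) (fromA y b) = chart.hh (xc y) a b"
  by (simp add: hermitian.h_def[OF hermitian_kmetric] chart.hh_def met_from complex_eq_iff
      from_chart_J[symmetric] cdomD)

text \<open>The ambient chart is centred at \<open>\<iota> y\<close> because \<open>riemann\<close>
  is defined in that chart. Differentiating \<open>chr\<close> also produces second derivatives of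
  \<open>phi\<close>, which cancel in the antisymmetrisation.\<close>

lemma curv_riemann:
  assumes y: "y \<in> cdom" "\<iota> y = q"
  shows "chart.curv (xc y) u v a = riemann A \<Gamma> q (dphi (xc y) u) (dphi (xc y) v) a"
proof -
  let ?x = "xc y"
  have x: "?x \<in> cimg" by (rule cimgI[OF y(1)])
  note px = phi_img[OF x]
  have phx: "phi ?x = chart_map A q q" using phi_chart[OF y(1)] y(2) by simp
  have "fd (\<lambda>x. chr x v a) ?x u = fd (\<lambda>z. \<Gamma> q z (dphi ?x v) a) (phi ?x) (dphi ?x u)
      + \<Gamma> q (phi ?x) (fd (\<lambda>x. dphi x v) ?x u) a" for u v
  proof -
    have comp: "((\<lambda>x. \<Gamma> q (phi x) b a) has_derivative (\<lambda>u. fd (\<lambda>z. \<Gamma> q z b a) (phi ?x) (dphi ?x u))) (at ?x)" for b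
      by (rule has_derivative_compose[OF phi_has_derivative[OF x] smooth_on_has_fd[OF smooth_christoffel px]])
    have "((\<lambda>x. \<Gamma> q (phi x) (dphi x v) a) has_derivative
        (\<lambda>u. fd (\<lambda>x. \<Gamma> q (phi x) (dphi ?x v) a) ?x u + \<Gamma> q (phi ?x) (fd (\<lambda>x. dphi x v) ?x u) a)) (at ?x)"
      by (rule has_derivative_linear_family[where P = "\<lambda>x b. \<Gamma> q (phi x) b a", OF open_cimg x
            bilinear_linear_left[OF bilinear_christoffel[OF phi_img]] _
            smooth_on_has_fd[OF smooth_on_fd[OF smooth_phi] x]])
        (use comp in \<open>auto simp: differentiable_def\<close>)
    then show ?thesis by (simp add: chr_def fd_eq fd_eq[OF comp])
  qed
  then show ?thesis
    using second_derivative_symmetric[OF open_cimg smooth_phi x, of v u]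
    by (simp add: chart.curv_def riemann_def Let_def chr_def phx)
qed

end

section \<open>The determinant bundles in an adapted frame\<close>

locale submanifold_frame = submanifold_chart A \<omega> \<Gamma> B \<iota> k q r
  for A :: "('x::topological_space, complex ^ 'n::finite) atlas"
    and \<omega> :: "'x \<Rightarrow> complex ^ 'n \<Rightarrow> complex ^ 'n \<Rightarrow> real"
    and \<Gamma> :: "('x, complex ^ 'n) christoffel"
    and B :: "('y::topological_space, 'f::euclidean_space) atlas" and \<iota> :: "'y \<Rightarrow> 'x" and k :: nat
    and q :: 'x and r :: 'y +
  fixes T :: "'f set" and e :: "nat \<Rightarrow> 'f \<Rightarrow> complex ^ 'n" and l :: "nat \<Rightarrow> 'f \<Rightarrow> 'f"
  assumes T_subset: "T \<subseteq> cimg" and adapted: "adapted_frame T met chr dphi k e l"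
begin

sublocale fr: adapted_frame T met chr dphi k e l
  by (rule adapted)

definition V :: "'y set" where "V = {y \<in> cdom. xc y \<in> T}"

lemma VD: "y \<in> V \<Longrightarrow> y \<in> cdom" "y \<in> V \<Longrightarrow> xc y \<in> T"
    "y \<in> V \<Longrightarrow> y \<in> chart_dom B r" "y \<in> V \<Longrightarrow> \<iota> y \<in> chart_dom A q"
  by (auto simp: V_def dest: cdomD)

lemma xc_V: "xc ` V = T"
  using T_subset by (auto simp: V_def elim!: cimgE)

lemma inv_T: "x \<in> T \<Longrightarrow> chart_inv B r x \<in> V" "x \<in> T \<Longrightarrow> xc (chart_inv B r x) = x"
  using T_subset by (auto simp: V_def elim!: cimgE)

lemma open_V: "open V"
proof -
  have "V = cdom \<inter> (chart_dom B r \<inter> xc -` T)" by (auto simp: V_def cdom_def)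
  moreover have "open (chart_dom B r \<inter> xc -` T)"
    using homeomorphism_cont1[OF B.homeomorphism_chart] B.open_chart_dom fr.open_S
    by (rule continuous_open_preimage)
  ultimately show ?thesis using open_cdom by auto
qed

lemma coord_nbhd_V: "coord_nbhd A B \<iota> q r V"
  using open_V by (auto simp: coord_nbhd_def dest: VD)

lemma nabla_V:
  assumes "y \<in> V" "\<And>y. y \<in> V \<Longrightarrow> Z' y = fromA y (Z (xc y))"
  shows "nabla A \<Gamma> B \<iota> q r Z' y v = fromA y (chart.nab Z (xc y) (toB y v))"
  by (rule nabla_eq[OF fr.open_S T_subset]) (use assms in \<open>auto simp: V_def\<close>)

text \<open>The frame as stored on the manifold, each vector in the chart centred at its own base
  point.\<close>

definition ee :: "nat \<Rightarrow> 'y \<Rightarrow> complex ^ 'n" where "ee i y = fromA y (e i (xc y))"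

lemma unitary_ee:
  assumes "y \<in> V"
  shows "hermitian.unitary (kmetric \<omega> (\<iota> y)) {1..CARD('n)} (\<lambda>i. ee i y)"
  using fr.hh_e[OF VD(2)[OF assms]]
  by (simp add: hermitian.unitary_def[OF hermitian_kmetric] ee_def hh_from VD(1)[OF assms])

lemma unitary_ee_leaf:
  assumes "y \<in> V"
  shows "hermitian.unitary (kmetric \<omega> (\<iota> y)) {k+1..CARD('n)} (\<lambda>i. ee i y)"
  using unitary_ee[OF assms] by (simp add: hermitian.unitary_def[OF hermitian_kmetric])

lemma orthonormal_ee_leaf:
  assumes "y \<in> V"
  shows "inner_prod.orthonormal (kmetric \<omega> (\<iota> y)) {k+1..CARD('n)} (\<lambda>i. ee i y)"
proof -
  interpret hermitian "kmetric \<omega> (\<iota> y)" by (rule hermitian_kmetric)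
  show ?thesis using unitary_ee_leaf[OF assms] by (simp add: unitary_iff orthonormal_def)
qed

lemma TF_span:
  assumes y: "y \<in> V"
  shows "TF A \<omega> B \<iota> y = span ((\<lambda>\<beta>. ee \<beta> y) ` {k+1..CARD('n)})"
proof -
  have "TF A \<omega> B \<iota> y = fromA y ` chart.tf (xc y)"
  proof
    show "TF A \<omega> B \<iota> y \<subseteq> fromA y ` chart.tf (xc y)"
    proof
      fix a assume "a \<in> TF A \<omega> B \<iota> y"
      then have "toA y a \<in> chart.tf (xc y)" using TF_tf[OF VD(1)[OF y], of "toA y a"] VD[OF y] by simp
      then show "a \<in> fromA y ` chart.tf (xc y)" using VD(4)[OF y] by (metis from_to_chart imageI)
    qed
  qed (use TF_tf VD[OF y] in auto)
  also have "\<dots> = fromA y ` span ((\<lambda>\<beta>. e \<beta> (xc y)) ` {k+1..CARD('n)})"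
    using fr.tf_span[OF VD(2)[OF y]] by simp
  also have "\<dots> = span ((\<lambda>\<beta>. ee \<beta> y) ` {k+1..CARD('n)})"
    by (simp add: linear_span_image[OF linear_from_chart[OF VD(4)[OF y]], symmetric] image_image ee_def)
  finally show ?thesis .
qed

text \<open>In \<open>a + J b\<close> the real coefficients of \<open>a\<close> and of
  \<open>b\<close> become the real and imaginary parts of one complex coefficient.\<close>

lemma EE_eq:
  assumes y: "y \<in> V"
  shows "EE A \<omega> B \<iota> y = {\<Sum>\<alpha>\<in>{k+1..CARD('n)}. c \<alpha> *s ee \<alpha> y | c. True}"
proof
  interpret hermitian "kmetric \<omega> (\<iota> y)" by (rule hermitian_kmetric)
  have exp: "a = (\<Sum>\<alpha>\<in>{k+1..CARD('n)}. kmetric \<omega> (\<iota> y) a (ee \<alpha> y) *\<^sub>R ee \<alpha> y)" if "a \<in> TF A \<omega> B \<iota> y" for a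
    using that orthonormal_span[OF orthonormal_ee_leaf[OF y]] unfolding TF_span[OF y] by auto
  show "EE A \<omega> B \<iota> y \<subseteq> {\<Sum>\<alpha>\<in>{k+1..CARD('n)}. c \<alpha> *s ee \<alpha> y | c. True}"
  proof
    fix z assume "z \<in> EE A \<omega> B \<iota> y"
    then obtain a b where ab: "a \<in> TF A \<omega> B \<iota> y" "b \<in> TF A \<omega> B \<iota> y" "z = a + J b" by (auto simp: EE_def)
    let ?c = "\<lambda>\<alpha>. Complex (kmetric \<omega> (\<iota> y) a (ee \<alpha> y)) (kmetric \<omega> (\<iota> y) b (ee \<alpha> y))"
    have "J b = (\<Sum>\<alpha>\<in>{k+1..CARD('n)}. kmetric \<omega> (\<iota> y) b (ee \<alpha> y) *\<^sub>R J (ee \<alpha> y))"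
      using arg_cong[OF exp[OF ab(2)], of J] by (simp only: J_sum J_scaleR)
    then have "z = (\<Sum>\<alpha>\<in>{k+1..CARD('n)}. kmetric \<omega> (\<iota> y) a (ee \<alpha> y) *\<^sub>R ee \<alpha> y)
        + (\<Sum>\<alpha>\<in>{k+1..CARD('n)}. kmetric \<omega> (\<iota> y) b (ee \<alpha> y) *\<^sub>R J (ee \<alpha> y))"
      using exp[OF ab(1)] ab(3) by simp
    then have "z = (\<Sum>\<alpha>\<in>{k+1..CARD('n)}. ?c \<alpha> *s ee \<alpha> y)" by (simp add: scale_eq sum.distrib)
    then show "z \<in> {\<Sum>\<alpha>\<in>{k+1..CARD('n)}. c \<alpha> *s ee \<alpha> y | c. True}" by (intro CollectI exI[of _ ?c]) simp
  qed
  show "{\<Sum>\<alpha>\<in>{k+1..CARD('n)}. c \<alpha> *s ee \<alpha> y | c. True} \<subseteq> EE A \<omega> B \<iota> y"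
  proof safe
    fix c
    have "(\<Sum>\<alpha>\<in>{k+1..CARD('n)}. c \<alpha> *s ee \<alpha> y) =
        (\<Sum>\<alpha>\<in>{k+1..CARD('n)}. Re (c \<alpha>) *\<^sub>R ee \<alpha> y) + J (\<Sum>\<alpha>\<in>{k+1..CARD('n)}. Im (c \<alpha>) *\<^sub>R ee \<alpha> y)"
      by (simp add: J_sum J_scaleR scale_eq sum.distrib)
    moreover have mem: "(\<Sum>\<alpha>\<in>{k+1..CARD('n)}. f \<alpha> *\<^sub>R ee \<alpha> y) \<in> TF A \<omega> B \<iota> y" for f
      unfolding TF_span[OF y] by (intro span_sum span_scale span_base) auto
    ultimately show "(\<Sum>\<alpha>\<in>{k+1..CARD('n)}. c \<alpha> *s ee \<alpha> y) \<in> EE A \<omega> B \<iota> y"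
      unfolding EE_def by (intro CollectI exI conjI mem)
  qed
qed

lemma orth_proj_EE:
  assumes y: "y \<in> V"
  shows "orth_proj (kmetric \<omega> (\<iota> y)) (EE A \<omega> B \<iota> y) z =
    (\<Sum>\<beta>\<in>{k+1..CARD('n)}. hermitian.h (kmetric \<omega> (\<iota> y)) z (ee \<beta> y) *s ee \<beta> y)"
  by (rule hermitian.orth_proj_unitary[OF hermitian_kmetric unitary_ee_leaf[OF y] _ EE_eq[OF y]]) simp

lemma smooth_section_part10:
  assumes "i \<in> {1..CARD('n)}"
  shows "smooth_on (xc ` V) (section_in_charts A B \<iota> q r (\<lambda>y. fst (part10 (ee i y))))"
    and "smooth_on (xc ` V) (section_in_charts A B \<iota> q r (\<lambda>y. snd (part10 (ee i y))))"
proof -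
  have sec: "section_in_charts A B \<iota> q r (\<lambda>y. fst (part10 (ee i y))) x = (1/2) *\<^sub>R e i x"
    "section_in_charts A B \<iota> q r (\<lambda>y. snd (part10 (ee i y))) x = - ((1/2) *\<^sub>R J (e i x))"
    if x: "x \<in> T" for x
    using VD[OF inv_T(1)[OF x]] inv_T[OF x]
    by (simp_all add: section_in_charts_def part10_def ee_def from_chart_J[symmetric]
        linear_cmul[OF linear_to_chart] linear_neg[OF linear_to_chart])
  have "smooth_on T (\<lambda>x. (1/2) *\<^sub>R e i x)"
    by (intro smooth_on_scaleR smooth_on_const fr.open_S fr.smooth_e assms)
  then show "smooth_on (xc ` V) (section_in_charts A B \<iota> q r (\<lambda>y. fst (part10 (ee i y))))"
    unfolding xc_V by (rule smooth_on_cong[OF fr.open_S, rotated]) (simp add: sec)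
  have "smooth_on T (\<lambda>x. - ((1/2) *\<^sub>R J (e i x)))"
    by (intro smooth_on_minus smooth_on_scaleR smooth_on_const smooth_on_linear[OF _ linear_J] fr.open_S
        fr.smooth_e assms)
  then show "smooth_on (xc ` V) (section_in_charts A B \<iota> q r (\<lambda>y. snd (part10 (ee i y))))"
    unfolding xc_V by (rule smooth_on_cong[OF fr.open_S, rotated]) (simp add: sec)
qed

text \<open>The eigenvalue equation makes each vector of \<open>E10\<close> the
  \<open>part10\<close> of twice its first component, so a complex basis of \<open>EE\<close>
  becomes one of \<open>E10\<close>.\<close>

lemma E10_frame: "E10_frame A \<omega> B \<iota> k q r V (\<lambda>\<alpha> y. part10 (ee \<alpha> y))"
  unfolding E10_frame_def
proof (intro conjI ballI)
  fix \<alpha> assume "\<alpha> \<in> {k+1..CARD('n)}"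
  then have "\<alpha> \<in> {1..CARD('n)}" by auto
  from smooth_section_part10[OF this]
  show "smooth_on (xc ` V) (section_in_charts A B \<iota> q r (\<lambda>y. fst (part10 (ee \<alpha> y))))"
    "smooth_on (xc ` V) (section_in_charts A B \<iota> q r (\<lambda>y. snd (part10 (ee \<alpha> y))))" .
next
  fix y assume y: "y \<in> V"
  interpret hermitian "kmetric \<omega> (\<iota> y)" by (rule hermitian_kmetric)
  have sum: "(\<Sum>\<alpha>\<in>{k+1..CARD('n)}. cscale (c \<alpha>) (part10 (ee \<alpha> y))) = part10 (\<Sum>\<alpha>\<in>{k+1..CARD('n)}. c \<alpha> *s ee \<alpha> y)" for c
    by (simp add: part10_sum cscale_part10)
  show "\<forall>c. (\<Sum>\<alpha>\<in>{k+1..CARD('n)}. cscale (c \<alpha>) (part10 (ee \<alpha> y))) = 0 \<longrightarrow> (\<forall>\<alpha>\<in>{k+1..CARD('n)}. c \<alpha> = 0)"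
  proof (intro allI impI ballI)
    fix c \<alpha> assume "(\<Sum>\<alpha>\<in>{k+1..CARD('n)}. cscale (c \<alpha>) (part10 (ee \<alpha> y))) = 0" "\<alpha> \<in> {k+1..CARD('n)}"
    then have "(\<Sum>\<alpha>\<in>{k+1..CARD('n)}. c \<alpha> *s ee \<alpha> y) = 0"
      unfolding sum by (metis part10_0 part10_inject)
    then show "c \<alpha> = 0"
      using unitary_coeff[OF unitary_ee_leaf[OF y], of "{k+1..CARD('n)}" \<alpha> c] \<open>\<alpha> \<in> {k+1..CARD('n)}\<close> by (simp add: h_0_left)
  qed
  have "E10 A \<omega> B \<iota> y = part10 ` EE A \<omega> B \<iota> y"
  proof
    have half: "(1/2) *\<^sub>R a \<in> EE A \<omega> B \<iota> y" "2 *\<^sub>R a \<in> EE A \<omega> B \<iota> y" "- a \<in> EE A \<omega> B \<iota> y" "J a \<in> EE A \<omega> B \<iota> y"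
      if a: "a \<in> EE A \<omega> B \<iota> y" for a
    proof -
      obtain c where c: "a = (\<Sum>\<alpha>\<in>{k+1..CARD('n)}. c \<alpha> *s ee \<alpha> y)" using a unfolding EE_eq[OF y] by auto
      have "d *s a \<in> EE A \<omega> B \<iota> y" for d
        unfolding EE_eq[OF y] c
        by (intro CollectI exI[of _ "\<lambda>\<alpha>. d * c \<alpha>"]) (simp add: vec.scale_sum_right)
      from this[of "1/2"] this[of 2] this[of "-1"] this[of \<i>]
      show "(1/2) *\<^sub>R a \<in> EE A \<omega> B \<iota> y" "2 *\<^sub>R a \<in> EE A \<omega> B \<iota> y" "- a \<in> EE A \<omega> B \<iota> y" "J a \<in> EE A \<omega> B \<iota> y"
        by (simp_all add: scale_eq)
    qed
    show "part10 ` EE A \<omega> B \<iota> y \<subseteq> E10 A \<omega> B \<iota> y"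
      using half by (auto simp: E10_def part10_def cext_def cscale_def J_scaleR J_minus J_J)
    show "E10 A \<omega> B \<iota> y \<subseteq> part10 ` EE A \<omega> B \<iota> y"
    proof
      fix z assume z: "z \<in> E10 A \<omega> B \<iota> y"
      then have "J (fst z) = - snd z" by (auto simp: E10_def cext_def cscale_def)
      then have "snd z = - J (fst z)" by simp
      then have "z = part10 (2 *\<^sub>R fst z)" by (simp add: part10_def J_scaleR prod_eq_iff)
      moreover have "2 *\<^sub>R fst z \<in> EE A \<omega> B \<iota> y" using half(2) z by (simp add: E10_def)
      ultimately show "z \<in> part10 ` EE A \<omega> B \<iota> y" by blast
    qed
  qed
  then show "E10 A \<omega> B \<iota> y = {\<Sum>\<alpha>\<in>{k+1..CARD('n)}. cscale (c \<alpha>) (part10 (ee \<alpha> y)) | c. True}"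
    unfolding sum EE_eq[OF y] by auto
qed

text \<open>\<open>nabla_E\<close> differentiates the two real components of
  \<open>u\<^sub>\<alpha>\<close> separately. As \<open>J\<close> is parallel, the results are again
  the components of a (1,0) vector, and the projection onto \<open>EE\<close> preserves this by
  being complex linear.\<close>

lemma nabla_E_frame:
  assumes y: "y \<in> V" and \<alpha>: "\<alpha> \<in> {k+1..CARD('n)}"
  shows "nabla_E A \<omega> \<Gamma> B \<iota> q r (\<lambda>y. part10 (ee \<alpha> y)) y v =
    part10 (\<Sum>\<beta>\<in>{k+1..CARD('n)}. fr.om \<beta> \<alpha> (xc y) (toB y v) *s ee \<beta> y)"
proof -
  interpret hermitian "kmetric \<omega> (\<iota> y)" by (rule hermitian_kmetric)
  have \<alpha>': "\<alpha> \<in> {1..CARD('n)}" using \<alpha> by auto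
  note se = fr.smooth_e[OF \<alpha>'] and x = VD(2)[OF y]
  let ?N = "chart.nab (e \<alpha>) (xc y) (toB y v)"
  have n1: "chart.nab (\<lambda>x. (1/2) *\<^sub>R e \<alpha> x) (xc y) (toB y v) = (1/2) *\<^sub>R ?N"
    by (rule fr.nab_scaleR[OF se x])
  have "smooth_on T (\<lambda>x. (- 1/2) *\<^sub>R e \<alpha> x)"
    by (intro smooth_on_scaleR smooth_on_const fr.open_S se)
  then have n2: "chart.nab (\<lambda>x. J ((- 1/2) *\<^sub>R e \<alpha> x)) (xc y) (toB y v) = J ((- 1/2) *\<^sub>R ?N)"
    by (simp only: fr.nab_J[OF _ x] fr.nab_scaleR[OF se x])
  have "nabla A \<Gamma> B \<iota> q r (\<lambda>y. fst (part10 (ee \<alpha> y))) y v = fromA y ((1/2) *\<^sub>R ?N)"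
    unfolding n1[symmetric]
    by (rule nabla_V[OF y]) (simp add: part10_def ee_def linear_cmul[OF linear_from_chart[OF VD(4)]])
  moreover have "nabla A \<Gamma> B \<iota> q r (\<lambda>y. snd (part10 (ee \<alpha> y))) y v = fromA y (J ((- 1/2) *\<^sub>R ?N))"
    unfolding n2[symmetric]
    by (rule nabla_V[OF y])
      (simp add: part10_def ee_def linear_cmul[OF linear_from_chart[OF VD(4)]] from_chart_J[OF VD(4)] J_scaleR
        J_minus linear_neg[OF linear_from_chart[OF VD(4)]])
  ultimately have "nabla_E A \<omega> \<Gamma> B \<iota> q r (\<lambda>y. part10 (ee \<alpha> y)) y v =
      cext (orth_proj (kmetric \<omega> (\<iota> y)) (EE A \<omega> B \<iota> y)) (part10 (fromA y ?N))"
    by (simp add: nabla_E_def part10_def linear_cmul[OF linear_from_chart[OF VD(4)[OF y]]]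
        from_chart_J[OF VD(4)[OF y]] J_scaleR J_minus linear_neg[OF linear_from_chart[OF VD(4)[OF y]]])
  also have "\<dots> = part10 (\<Sum>\<beta>\<in>{k+1..CARD('n)}. h (fromA y ?N) (ee \<beta> y) *s ee \<beta> y)"
  proof -
    define p where "p z = (\<Sum>\<beta>\<in>{k+1..CARD('n)}. h z (ee \<beta> y) *s ee \<beta> y)" for z
    have proj: "orth_proj (kmetric \<omega> (\<iota> y)) (EE A \<omega> B \<iota> y) = p"
      by (rule ext) (simp only: p_def orth_proj_EE[OF y])
    have "p (c *s z) = c *s p z" for c z
      by (simp add: p_def h_scale_left vec.scale_sum_right)
    then have pJ: "p (J z) = J (p z)" for z by (simp add: J_def)
    have "linear p"
    proof (rule linearI)
      show "p (z + z') = p z + p z'" for z z'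
        by (simp add: p_def h_add_left vector_sadd_rdistrib sum.distrib)
      show "p (r *\<^sub>R z) = r *\<^sub>R p z" for r z
        using scale_eq[of "of_real r" "p z"] by (simp add: p_def h_scaleR_left vec.scale_sum_right)
    qed
    from cext_part10[OF this pJ] show ?thesis unfolding proj p_def .
  qed
  also have "\<dots> = part10 (\<Sum>\<beta>\<in>{k+1..CARD('n)}. fr.om \<beta> \<alpha> (xc y) (toB y v) *s ee \<beta> y)"
    by (simp add: ee_def hh_from VD(1)[OF y] fr.om_def)
  finally show ?thesis .
qed

lemma detE_connection:
  "detE_connection_form A \<omega> \<Gamma> B \<iota> k D q r V (\<lambda>\<alpha> y. part10 (ee \<alpha> y)) (\<lambda>y v. fr.tauE (xc y) (toB y v))"
  unfolding detE_connection_form_def Let_def fr.tauE_def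
  by (intro ballI allI impI wedge_trace) (simp_all add: nabla_E_frame cpair_part10_sum)

text \<open>This is \<open>e\<^sub>a\<^sup>* + \<i> f\<^sub>a\<^sup>*\<close>: the imaginary part of
  the Hermitian form pairs with \<open>J (ee a y)\<close>.\<close>

definition theta :: "nat \<Rightarrow> 'y \<Rightarrow> complex ^ 'n \<Rightarrow> complex" where
  "theta a y z = hermitian.h (kmetric \<omega> (\<iota> y)) z (ee a y)"

lemma theta_chart: "y \<in> V \<Longrightarrow> theta a y (fromA y z) = chart.hh (xc y) z (e a (xc y))"
  by (simp add: theta_def ee_def hh_from VD(1))

text \<open>A covector in \<open>N10\<close> is complex linear, hence determined by its values on
  the unitary frame; vanishing on \<open>EE\<close> kills those with index above k.\<close>

lemma N10_frame: "N10_frame A \<omega> B \<iota> k q r V theta"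
  unfolding N10_frame_def
proof (intro conjI ballI allI)
  fix a z assume a: "a \<in> {1..k}"
  then have "a \<in> {1..CARD('n)}" using fr.k_le by auto
  then have "smooth_on T (\<lambda>x. chart.hh x z (e a x))"
    by (intro fr.smooth_on_hh smooth_on_const fr.smooth_e)
  then show "smooth_on (xc ` V) (\<lambda>x. theta a (chart_inv B r x) (from_chart A q (\<iota> (chart_inv B r x)) z))"
    unfolding xc_V
    by (rule smooth_on_cong[OF fr.open_S, rotated]) (simp add: theta_chart inv_T)
next
  fix y c assume y: "y \<in> V"
  interpret hermitian "kmetric \<omega> (\<iota> y)" by (rule hermitian_kmetric)
  show "(\<forall>z. (\<Sum>a=1..k. c a * theta a y z) = 0) \<longrightarrow> (\<forall>a\<in>{1..k}. c a = 0)"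
  proof (intro impI ballI)
    fix b assume c: "\<forall>z. (\<Sum>a=1..k. c a * theta a y z) = 0" and b: "b \<in> {1..k}"
    have "(\<Sum>a=1..k. c a * theta a y (ee b y)) = (\<Sum>a=1..k. if a = b then c a else 0)"
      using unitary_ee[OF y] b fr.k_le by (intro sum.cong) (auto simp: theta_def unitary_def)
    then show "c b = 0" using c b by simp
  qed
next
  fix y assume y: "y \<in> V"
  interpret hermitian "kmetric \<omega> (\<iota> y)" by (rule hermitian_kmetric)
  note u = unitary_ee[OF y]
  show "N10 A \<omega> B \<iota> y = {\<lambda>z. \<Sum>a=1..k. c a * theta a y z | c. True}"
  proof
    show "N10 A \<omega> B \<iota> y \<subseteq> {\<lambda>z. \<Sum>a=1..k. c a * theta a y z | c. True}"
    proof
      fix \<theta> assume \<theta>: "\<theta> \<in> N10 A \<omega> B \<iota> y"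
      then have lin: "linear \<theta>" and \<theta>J: "\<And>v. \<theta> (J v) = \<i> * \<theta> v"
        and \<theta>0: "\<And>v. v \<in> EE A \<omega> B \<iota> y \<Longrightarrow> \<theta> v = 0" by (auto simp: N10_def)
      have scale: "\<theta> (c *s v) = c * \<theta> v" for c v
      proof -
        have "\<theta> (c *s v) = (of_real (Re c) + \<i> * of_real (Im c)) * \<theta> v"
          by (simp add: scale_eq linear_add[OF lin] linear_cmul[OF lin] \<theta>J
              scaleR_conv_of_real[where 'a = complex] algebra_simps)
        then show ?thesis by (simp add: complex_eq[symmetric])
      qed
      have ee0: "\<theta> (ee \<alpha> y) = 0" if \<alpha>: "\<alpha> \<in> {k+1..CARD('n)}" for \<alpha>
      proof (rule \<theta>0)
        have "(\<Sum>\<beta>\<in>{k+1..CARD('n)}. (if \<beta> = \<alpha> then 1 else 0) *s ee \<beta> y) = (\<Sum>\<beta>\<in>{k+1..CARD('n)}. if \<beta> = \<alpha> then ee \<beta> y else 0)"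
          by (rule sum.cong) auto
        then have "ee \<alpha> y = (\<Sum>\<beta>\<in>{k+1..CARD('n)}. (if \<beta> = \<alpha> then 1 else 0) *s ee \<beta> y)" using \<alpha> by simp
        then show "ee \<alpha> y \<in> EE A \<omega> B \<iota> y"
          unfolding EE_eq[OF y] by (intro CollectI exI[of _ "\<lambda>\<beta>. if \<beta> = \<alpha> then 1 else 0"]) simp
      qed
      have "\<theta> z = (\<Sum>a=1..k. \<theta> (ee a y) * theta a y z)" for z
      proof -
        have "\<theta> z = \<theta> (\<Sum>i=1..CARD('n). h z (ee i y) *s ee i y)"
          by (rule arg_cong[OF unitary_expansion[OF u]]) auto
        also have "\<dots> = (\<Sum>i\<in>{1..CARD('n)}. h z (ee i y) * \<theta> (ee i y))"
          by (simp add: linear_sum[OF lin] scale)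
        also have "\<dots> = (\<Sum>i\<in>{1..k}. h z (ee i y) * \<theta> (ee i y))"
          by (rule sum.mono_neutral_right) (use fr.k_le ee0 in auto)
        finally show ?thesis by (simp add: theta_def mult.commute)
      qed
      then have "\<theta> = (\<lambda>z. \<Sum>a=1..k. \<theta> (ee a y) * theta a y z)" by (rule ext)
      then show "\<theta> \<in> {\<lambda>z. \<Sum>a=1..k. c a * theta a y z | c. True}"
        by (intro CollectI exI[of _ "\<lambda>a. \<theta> (ee a y)"] conjI TrueI)
    qed
    show "{\<lambda>z. \<Sum>a=1..k. c a * theta a y z | c. True} \<subseteq> N10 A \<omega> B \<iota> y"
    proof safe
      fix c :: "nat \<Rightarrow> complex"
      let ?\<theta> = "\<lambda>z. \<Sum>a=1..k. c a * theta a y z"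
      have "linear ?\<theta>"
        by (rule linearI) (simp_all add: theta_def h_add_left h_scaleR_left distrib_left sum.distrib
            scaleR_conv_of_real[where 'a = complex] sum_distrib_left mult_ac)
      moreover have "?\<theta> v = 0" if v: "v \<in> EE A \<omega> B \<iota> y" for v
      proof -
        obtain d where d: "v = (\<Sum>\<alpha>\<in>{k+1..CARD('n)}. d \<alpha> *s ee \<alpha> y)" using v unfolding EE_eq[OF y] by auto
        show ?thesis
          unfolding d theta_def
          using unitary_coeff[OF u, of "{k+1..CARD('n)}" _ d] fr.k_le by (intro sum.neutral) auto
      qed
      moreover have "?\<theta> (J v) = \<i> * ?\<theta> v" for v
        by (simp add: theta_def h_J_left sum_distrib_left mult_ac)
      ultimately show "?\<theta> \<in> N10 A \<omega> B \<iota> y" by (simp add: N10_def)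
    qed
  qed
qed

text \<open>\<open>theta a\<close> has \<open>e\<^sub>a\<close> in the antilinear slot, so its
  derivative has the derivative of \<open>e\<^sub>a\<close> there and conjugate coefficients appear.
  Projecting \<open>z\<close> off \<open>EE\<close> removes the indices above k. By skewness
  \<open>cnj (om b a)\<close> is \<open>- om a b\<close>, the expected
  \<open>- \<omega>\<^sup>a\<^sub>b\<close>.\<close>

lemma nabla_N_frame:
  assumes y: "y \<in> V" and a: "a \<in> {1..k}"
  shows "nabla_N A \<omega> \<Gamma> B \<iota> q r (theta a) y v z = (\<Sum>b=1..k. cnj (fr.om b a (xc y) (toB y v)) * theta b y z)"
proof -
  interpret hermitian "kmetric \<omega> (\<iota> y)" by (rule hermitian_kmetric)
  have a': "a \<in> {1..CARD('n)}" using a fr.k_le by auto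
  note x = VD(2)[OF y] and u = unitary_ee[OF y]
  define z' where "z' = z - (\<Sum>\<beta>\<in>{k+1..CARD('n)}. h z (ee \<beta> y) *s ee \<beta> y)"
  \<comment> \<open>\<open>nabla_dual\<close> extends its argument with constant coordinates; these
    are \<open>c\<close>, and the covariant derivative of the extension cancels below.\<close>
  define c where "c = toA y z'"
  have Fc: "fromA y c = z'" using VD(4)[OF y] by (simp add: c_def)
  have n: "nabla A \<Gamma> B \<iota> q r (\<lambda>y'. fromA y' c) y v = fromA y (chart.nab (\<lambda>_. c) (xc y) (toB y v))"
    by (rule nabla_V[OF y]) simp
  have "fd ((\<lambda>y'. theta a y' (fromA y' c)) \<circ> chart_inv B r) (xc y) = fd (\<lambda>x. chart.hh x c (e a x)) (xc y)"
    by (rule fd_cong_open[OF fr.open_S x]) (simp add: theta_chart inv_T)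
  then have "dir_deriv B r (\<lambda>y'. theta a y' (fromA y' c)) y v =
      chart.hh (xc y) (chart.nab (\<lambda>_. c) (xc y) (toB y v)) (e a (xc y))
      + chart.hh (xc y) c (chart.nab (e a) (xc y) (toB y v))"
    by (simp add: dir_deriv_def fd_eq[OF fr.fd_hh[OF smooth_on_const fr.smooth_e[OF a'] x]])
  then have "nabla_N A \<omega> \<Gamma> B \<iota> q r (theta a) y v z = chart.hh (xc y) c (chart.nab (e a) (xc y) (toB y v))"
    unfolding nabla_N_def orth_proj_EE[OF y] z'_def[symmetric] nabla_dual_def Let_def c_def[symmetric]
    by (simp add: n theta_chart[OF y])
  also have "\<dots> = h z' (fromA y (chart.nab (e a) (xc y) (toB y v)))"
    using hh_from[OF VD(1)[OF y], of c] Fc by simp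
  also have "fromA y (chart.nab (e a) (xc y) (toB y v)) = (\<Sum>i=1..CARD('n). fr.om i a (xc y) (toB y v) *s ee i y)"
    by (simp add: fr.nab_frame[OF x] ee_def linear_sum[OF linear_from_chart[OF VD(4)[OF y]]]
        linear_complex_linear[OF linear_from_chart[OF VD(4)[OF y]] from_chart_J[OF VD(4)[OF y]]])
  also have "h z' \<dots> = (\<Sum>i\<in>{1..CARD('n)}. cnj (fr.om i a (xc y) (toB y v)) * h z' (ee i y))"
    by (simp add: h_sum_right h_scale_right)
  also have "\<dots> = (\<Sum>i\<in>{1..CARD('n)}. if i \<in> {k+1..CARD('n)} then 0 else cnj (fr.om i a (xc y) (toB y v)) * h z (ee i y))"
    by (rule sum.cong) (auto simp: z'_def h_diff_left unitary_coeff[OF u])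
  also have "\<dots> = (\<Sum>b\<in>{1..k}. cnj (fr.om b a (xc y) (toB y v)) * theta b y z)"
    by (rule sum.mono_neutral_cong_right) (use fr.k_le in \<open>auto simp: theta_def\<close>)
  finally show ?thesis .
qed

text \<open>The trace of the conjugated matrix is \<open>- tauN\<close> by skewness. The directions
  \<open>D\<close> are arbitrary, so the same form serves the full and the leafwise
  curvature.\<close>

lemma KY_connection:
  "KY_connection_form A \<omega> \<Gamma> B \<iota> k D q r V theta (\<lambda>y v. - fr.tauN (xc y) (toB y v))"
  unfolding KY_connection_form_def Let_def
proof (intro ballI allI)
  fix y v z assume y: "y \<in> V"
  have "- fr.tauN (xc y) (toB y v) = (\<Sum>a=1..k. cnj (fr.om a a (xc y) (toB y v)))"
    unfolding fr.tauN_def sum_negf[symmetric]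
    by (rule sum.cong) (use fr.om_skew[OF VD(2)[OF y]] fr.k_le in auto)
  then show "(\<Sum>a=1..k. wedge {1..k} (\<lambda>\<theta> z. \<theta> z)
        ((\<lambda>i. theta i y)(a := nabla_N A \<omega> \<Gamma> B \<iota> q r (theta a) y v)) z) =
      - fr.tauN (xc y) (toB y v) * wedge {1..k} (\<lambda>\<theta> z. \<theta> z) (\<lambda>i. theta i y) z"
    by (simp only:) (intro wedge_trace, simp_all add: nabla_N_frame[OF y])
qed

section \<open>Exterior derivatives, leaf directions and mean curvature\<close>

definition lift :: "('f \<Rightarrow> 'f) \<Rightarrow> 'y \<Rightarrow> 'f" where "lift U y = fromB y (U (xc y))"

lemma field_in_chart_lift: "x \<in> T \<Longrightarrow> field_in_chart B r (lift U) x = U x"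
  using VD(3)[OF inv_T(1)] by (simp add: field_in_chart_def lift_def inv_T)

lemma smooth_field_lift:
  assumes "smooth_on T U" "\<And>y. y \<in> V \<Longrightarrow> lift U y \<in> D y"
  shows "smooth_field_in B r V D (lift U)"
proof -
  have "smooth_on T (field_in_chart B r (lift U))"
    by (rule smooth_on_cong[OF fr.open_S _ assms(1)]) (simp add: field_in_chart_lift)
  then show ?thesis using assms(2) by (simp add: smooth_field_in_def xc_V)
qed

text \<open>\<open>is_ext_deriv\<close> quantifies over fields on the manifold; on lifts of
  coordinate fields its formula becomes \<open>extd\<close>. Agreement of \<eta> with
  \<open>\<eta>'\<close> over \<open>V\<close> suffices, since all derivatives are local.\<close>

lemma ext_deriv_chart:
  assumes F: "is_ext_deriv B D V' \<eta> F" "V \<subseteq> V'"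
    and U: "smooth_on T U" "\<And>y. y \<in> V \<Longrightarrow> lift U y \<in> D y"
    and W: "smooth_on T W" "\<And>y. y \<in> V \<Longrightarrow> lift W y \<in> D y"
    and \<eta>: "\<And>y v. y \<in> V \<Longrightarrow> \<eta> y v = \<eta>' (xc y) (toB y v)" and y: "y \<in> V"
  shows "F y (lift U y) (lift W y) = fr.extd \<eta>' U W (xc y)"
proof -
  note x = VD(2)[OF y]
  have d: "dir_deriv B r (\<lambda>y. \<eta> y (lift W y)) y v = fd (\<lambda>x. \<eta>' x (W x)) (xc y) (toB y v)" for W v
  proof -
    have "fd ((\<lambda>y. \<eta> y (lift W y)) \<circ> chart_inv B r) (xc y) = fd (\<lambda>x. \<eta>' x (W x)) (xc y)"
      by (rule fd_cong_open[OF fr.open_S x]) (simp add: \<eta> inv_T lift_def VD(3))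
    then show ?thesis by (simp add: dir_deriv_def)
  qed
  have f: "fd (field_in_chart B r (lift U)) (xc y) = fd U (xc y)" for U
    by (rule fd_cong_open[OF fr.open_S x field_in_chart_lift])
  have b: "lie_bracket B r (lift U) (lift W) y = fromB y (fd W (xc y) (U (xc y)) - fd U (xc y) (W (xc y)))"
    by (simp add: lie_bracket_def Let_def f field_in_chart_lift[OF x])
  have "V \<subseteq> V' \<inter> chart_dom B r" using F(2) VD(3) by blast
  then have "F y (lift U y) (lift W y) =
      dir_deriv B r (\<lambda>y. \<eta> y (lift W y)) y (lift U y) - dir_deriv B r (\<lambda>y. \<eta> y (lift U y)) y (lift W y)
      - \<eta> y (lie_bracket B r (lift U) (lift W) y)"
    using F(1) open_V smooth_field_lift[OF U] smooth_field_lift[OF W] y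
    unfolding is_ext_deriv_def by blast
  then show ?thesis
    by (simp add: d b fr.extd_def \<eta>[OF y] VD(3)[OF y]) (simp add: lift_def VD(3)[OF y])
qed

lemma linear_push:
  assumes y: "y \<in> V"
  shows "linear (push A B \<iota> y)"
proof -
  have "push A B \<iota> y = fromA y \<circ> dphi (xc y) \<circ> toB y"
    by (rule ext) (simp add: push_eq VD[OF y])
  then show ?thesis
    using linear_compose[OF B.linear_to_chart[OF VD(3)[OF y]]
        linear_compose[OF fr.linear_P[OF VD(2)[OF y]] linear_from_chart[OF VD(4)[OF y]]]]
    by (simp add: o_assoc)
qed

lemma push_lift: "y \<in> V \<Longrightarrow> push A B \<iota> y (lift U y) = fromA y (dphi (xc y) (U (xc y)))"
  by (simp add: push_eq lift_def VD)

lemma push_lift_l: "y \<in> V \<Longrightarrow> \<beta> \<in> {k+1..CARD('n)} \<Longrightarrow> push A B \<iota> y (lift (l \<beta>) y) = ee \<beta> y"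
  by (simp add: push_lift fr.P_l ee_def VD del: atLeastAtMost_iff)

lemma leaf_expansion:
  assumes y: "y \<in> V" and u: "u \<in> leaf_dir A \<omega> B \<iota> y"
  obtains c where "u = (\<Sum>\<beta>\<in>{k+1..CARD('n)}. c \<beta> *\<^sub>R lift (l \<beta>) y)"
proof -
  interpret hermitian "kmetric \<omega> (\<iota> y)" by (rule hermitian_kmetric)
  note lp = linear_push[OF y]
  let ?c = "\<lambda>\<beta>. kmetric \<omega> (\<iota> y) (push A B \<iota> y u) (ee \<beta> y)"
  have "push A B \<iota> y u \<in> span ((\<lambda>\<beta>. ee \<beta> y) ` {k+1..CARD('n)})"
    using u by (simp add: leaf_dir_def TF_span[OF y])
  then have "push A B \<iota> y u = (\<Sum>\<beta>\<in>{k+1..CARD('n)}. ?c \<beta> *\<^sub>R ee \<beta> y)"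
    using orthonormal_span[OF orthonormal_ee_leaf[OF y]] by auto
  also have "\<dots> = push A B \<iota> y (\<Sum>\<beta>\<in>{k+1..CARD('n)}. ?c \<beta> *\<^sub>R lift (l \<beta>) y)"
    by (simp add: linear_sum[OF lp] linear_cmul[OF lp] push_lift_l[OF y] del: atLeastAtMost_iff)
  finally have "u = (\<Sum>\<beta>\<in>{k+1..CARD('n)}. ?c \<beta> *\<^sub>R lift (l \<beta>) y)" using inj_push by (auto dest: injD)
  then show thesis by (rule that)
qed

lemma lift_l_leaf: "y \<in> V \<Longrightarrow> \<beta> \<in> {k+1..CARD('n)} \<Longrightarrow> lift (l \<beta>) y \<in> leaf_dir A \<omega> B \<iota> y"
  unfolding leaf_dir_def by (simp add: push_lift_l TF_span span_base del: atLeastAtMost_iff)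

lemma subspace_leaf_dir: "y \<in> V \<Longrightarrow> subspace (leaf_dir A \<omega> B \<iota> y)"
  using linear_subspace_vimage[OF linear_push, of y "TF A \<omega> B \<iota> y"]
  by (simp add: leaf_dir_def vimage_def TF_span)

lemma leaf_orthonormal_basis_l:
  assumes y: "y \<in> V"
  shows "leaf_orthonormal_basis A \<omega> B \<iota> k y (\<lambda>\<beta>. lift (l \<beta>) y)"
  unfolding leaf_orthonormal_basis_def
proof (intro conjI ballI)
  interpret hermitian "kmetric \<omega> (\<iota> y)" by (rule hermitian_kmetric)
  show "kmetric \<omega> (\<iota> y) (push A B \<iota> y (lift (l \<beta>) y)) (push A B \<iota> y (lift (l \<gamma>) y)) = (if \<beta> = \<gamma> then 1 else 0)"
    if "\<beta> \<in> {k+1..CARD('n)}" "\<gamma> \<in> {k+1..CARD('n)}" for \<beta> \<gamma>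
    using orthonormal_ee_leaf[OF y] that by (simp add: push_lift_l[OF y] orthonormal_def del: atLeastAtMost_iff)
  show "span ((\<lambda>\<beta>. lift (l \<beta>) y) ` {k+1..CARD('n)}) = leaf_dir A \<omega> B \<iota> y"
  proof
    show "span ((\<lambda>\<beta>. lift (l \<beta>) y) ` {k+1..CARD('n)}) \<subseteq> leaf_dir A \<omega> B \<iota> y"
      by (rule span_minimal[OF _ subspace_leaf_dir[OF y]]) (use lift_l_leaf[OF y] in blast)
    show "leaf_dir A \<omega> B \<iota> y \<subseteq> span ((\<lambda>\<beta>. lift (l \<beta>) y) ` {k+1..CARD('n)})"
    proof
      fix u assume "u \<in> leaf_dir A \<omega> B \<iota> y"
      then obtain c where "u = (\<Sum>\<beta>\<in>{k+1..CARD('n)}. c \<beta> *\<^sub>R lift (l \<beta>) y)" by (rule leaf_expansion[OF y])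
      then show "u \<in> span ((\<lambda>\<beta>. lift (l \<beta>) y) ` {k+1..CARD('n)})"
        by (simp only:) (intro span_sum span_scale span_base imageI)
    qed
  qed
qed

text \<open>A combination of the \<open>l \<beta>\<close> with constant coefficients stays in
  \<open>leaf_dir\<close>, which an extension with constant coordinates would not do in
  general.\<close>

lemma leaf_field:
  assumes y: "y \<in> V" and u: "u \<in> leaf_dir A \<omega> B \<iota> y"
  obtains U where "smooth_on T U" "\<And>y. y \<in> V \<Longrightarrow> lift U y \<in> leaf_dir A \<omega> B \<iota> y" "lift U y = u"
proof -
  obtain c where c: "u = (\<Sum>\<beta>\<in>{k+1..CARD('n)}. c \<beta> *\<^sub>R lift (l \<beta>) y)" by (rule leaf_expansion[OF assms])
  let ?U = "\<lambda>x. \<Sum>\<beta>\<in>{k+1..CARD('n)}. c \<beta> *\<^sub>R l \<beta> x"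
  have lift: "lift ?U y = (\<Sum>\<beta>\<in>{k+1..CARD('n)}. c \<beta> *\<^sub>R lift (l \<beta>) y)" if "y \<in> V" for y
    by (simp add: lift_def linear_sum[OF B.linear_from_chart] linear_cmul[OF B.linear_from_chart] VD(3)[OF that])
  show thesis
  proof (rule that)
    show "smooth_on T ?U"
      by (intro smooth_on_sum smooth_on_scaleR smooth_on_const fr.open_S fr.smooth_l)
    show "lift ?U y \<in> leaf_dir A \<omega> B \<iota> y" if "y \<in> V" for y
      unfolding lift[OF that]
      by (intro subspace_sum subspace_scale subspace_leaf_dir lift_l_leaf that)
    show "lift ?U y = u" using lift[OF y] c by simp
  qed
qed

text \<open>\<open>orth_proj\<close> is a definite description, so a projection has to be exhibited
  before anything is known about its value: here the components along the normal vectors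
  \<open>J e\<^sub>\<beta>\<close> are subtracted.\<close>

lemma orth_proj_TY:
  assumes y: "y \<in> V"
  shows "orth_proj (kmetric \<omega> (\<iota> y)) (TY A B \<iota> y) z \<in> TY A B \<iota> y"
proof -
  interpret hermitian "kmetric \<omega> (\<iota> y)" by (rule hermitian_kmetric)
  interpret m: hermitian "met (xc y)" by (rule fr.hermitian_G[OF VD(2)[OF y]])
  note x = VD(2)[OF y] and lA = linear_from_chart[OF VD(4)[OF y]]
  define a where "a = toA y z"
  define b where "b = (\<Sum>\<beta>\<in>{k+1..CARD('n)}. met (xc y) a (J (e \<beta> (xc y))) *\<^sub>R J (e \<beta> (xc y)))"
  have orth: "m.orthonormal {k+1..CARD('n)} (\<lambda>\<beta>. J (e \<beta> (xc y)))"
    using fr.unitary_e[OF x] by (simp add: m.unitary_iff m.orthonormal_def m.g_J)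
  have "a - b \<in> range (dphi (xc y))"
  proof (rule fr.normal_J_e[OF x])
    show "met (xc y) (a - b) (J (e \<beta> (xc y))) = 0" if "\<beta> \<in> {k+1..CARD('n)}" for \<beta>
      using m.orthonormal_coeff[OF orth _ that, of "\<lambda>\<beta>. met (xc y) a (J (e \<beta> (xc y)))"]
      by (simp add: b_def m.g_simps)
  qed
  then obtain u where u: "a - b = dphi (xc y) u" by blast
  have w: "fromA y (a - b) = push A B \<iota> y (fromB y u)"
    by (simp add: u push_eq VD[OF y])
  have "orth_proj (kmetric \<omega> (\<iota> y)) (TY A B \<iota> y) z = fromA y (a - b)"
  proof (rule orth_proj_eqI)
    show "fromA y (a - b) \<in> TY A B \<iota> y" by (simp add: w TY_def)
    show "subspace (TY A B \<iota> y)"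
      unfolding TY_def by (rule linear_subspace_image[OF linear_push[OF y] subspace_UNIV])
  next
    fix t assume "t \<in> TY A B \<iota> y"
    then obtain v where t: "t = fromA y (dphi (xc y) (toB y v))" by (auto simp: TY_def push_eq VD[OF y])
    have "z - fromA y (a - b) = fromA y b"
      by (simp add: linear_diff[OF lA] a_def VD[OF y])
    then have "kmetric \<omega> (\<iota> y) (z - fromA y (a - b)) t = met (xc y) b (dphi (xc y) (toB y v))"
      by (simp add: t met_from VD[OF y])
    also have "\<dots> = 0"
      unfolding b_def m.g_sum_left
      using fr.tf_ortho[OF fr.e_tf[OF x]] by (intro sum.neutral) (auto simp: m.g_simps)
    finally show "kmetric \<omega> (\<iota> y) (z - fromA y (a - b)) t = 0" .
  qed
  then show ?thesis by (simp add: w TY_def)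
qed

text \<open>On the leaf frame, \<open>S\<close> is the derivative of \<open>e\<^sub>\<beta>\<close>
  along \<open>l \<beta>\<close> minus a tangential projection. The projections are collected into
  one tangent vector, which is the \<open>w\<close> of the coordinate version.\<close>

lemma tauE_mean_curvature:
  assumes S: "is_second_fundamental_form A \<omega> \<Gamma> B \<iota> S" and H: "is_leafwise_mean_curvature A \<omega> B \<iota> k S H"
    and y: "y \<in> V" and v: "v \<in> leaf_dir A \<omega> B \<iota> y"
  shows "fr.tauE (xc y) (toB y v) = - \<i> * of_real (mean_curvature_form A \<omega> B \<iota> H y v)"
proof -
  note x = VD(2)[OF y] and lA = linear_from_chart[OF VD(4)[OF y]]
  let ?N = "\<lambda>\<beta>. chart.nab (e \<beta>) (xc y) (l \<beta> (xc y))"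
  have "\<exists>u. S y (lift (l \<beta>) y) (lift (l \<beta>) y) = fromA y (?N \<beta>) + push A B \<iota> y u" if \<beta>: "\<beta> \<in> {k+1..CARD('n)}" for \<beta>
  proof -
    let ?Z = "nabla A \<Gamma> B \<iota> q r (\<lambda>y. push A B \<iota> y (lift (l \<beta>) y)) y (lift (l \<beta>) y)"
    have "smooth_field_in B r V (\<lambda>_. UNIV) (lift (l \<beta>))"
      by (rule smooth_field_lift[OF fr.smooth_l[OF \<beta>]]) simp
    then have "S y (lift (l \<beta>) y) (lift (l \<beta>) y) = ?Z - orth_proj (kmetric \<omega> (\<iota> y)) (TY A B \<iota> y) ?Z"
      using S coord_nbhd_V y unfolding is_second_fundamental_form_def Let_def by blast
    moreover obtain u where "orth_proj (kmetric \<omega> (\<iota> y)) (TY A B \<iota> y) ?Z = push A B \<iota> y u"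
      using orth_proj_TY[OF y, of ?Z] by (auto simp: TY_def)
    moreover have "?Z = fromA y (?N \<beta>)"
    proof -
      have "?Z = fromA y (chart.nab (e \<beta>) (xc y) (toB y (lift (l \<beta>) y)))"
        by (rule nabla_V[OF y]) (use push_lift_l[OF _ \<beta>] in \<open>simp add: ee_def\<close>)
      then show ?thesis by (simp add: lift_def VD[OF y])
    qed
    ultimately have "S y (lift (l \<beta>) y) (lift (l \<beta>) y) = fromA y (?N \<beta>) + push A B \<iota> y (- u)"
      by (simp add: linear_neg[OF linear_push[OF y]])
    then show ?thesis ..
  qed
  then obtain u where u: "\<And>\<beta>. \<beta> \<in> {k+1..CARD('n)} \<Longrightarrow>
      S y (lift (l \<beta>) y) (lift (l \<beta>) y) = fromA y (?N \<beta>) + push A B \<iota> y (u \<beta>)" by metis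
  define Hc where "Hc = (\<Sum>\<beta>=k+1..CARD('n). ?N \<beta>) + dphi (xc y) (\<Sum>\<beta>=k+1..CARD('n). toB y (u \<beta>))"
  have "H y = (\<Sum>\<beta>\<in>{k+1..CARD('n)}. S y (lift (l \<beta>) y) (lift (l \<beta>) y))"
    using H leaf_orthonormal_basis_l[OF y] unfolding is_leafwise_mean_curvature_def by blast
  also have "\<dots> = fromA y Hc"
    using u by (simp add: Hc_def linear_add[OF lA] linear_sum[OF lA] linear_sum[OF fr.linear_P[OF x]]
        sum.distrib push_eq VD[OF y])
  finally have "mean_curvature_form A \<omega> B \<iota> H y v = met (xc y) (J Hc) (dphi (xc y) (toB y v))"
    by (simp add: mean_curvature_form_def omega_kmetric push_eq met_from from_chart_J VD[OF y])
  then show ?thesis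
    using fr.tauE_mean_curvature[OF x _ Hc_def, of "toB y v"] v leaf_dir_iff[OF VD(1)[OF y]] by simp
qed

text \<open>With both charts centred, \<open>from_chart\<close> at the point is the identity and
  \<open>push\<close> is \<open>dphi\<close>, so the Euclidean curvature can be compared with
  \<open>riemann\<close> directly.\<close>

lemma ricci_trace_chart:
  assumes "ricci_form A \<omega> \<Gamma> \<rho>" and y: "y \<in> V" "\<iota> y = q" "y = r"
  shows "(\<Sum>j=1..CARD('n). chart.hh (xc y) (chart.curv (xc y) u v (e j (xc y))) (e j (xc y))) =
    \<i> * complex_of_real (\<rho> (\<iota> y) (push A B \<iota> y u) (push A B \<iota> y v))"
proof -
  have [simp]: "fromA y a = a" for a using y by simp
  have push: "push A B \<iota> y u = dphi (xc y) u" for u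
    using push_eq[OF VD(1)[OF y(1)]] y by simp
  show ?thesis
    unfolding ricci_trace[OF assms(1) unitary_ee[OF y(1)]] push
    using hh_from[OF VD(1)[OF y(1)]] curv_riemann[OF VD(1)[OF y(1)] y(2)] y(2)
    by (simp add: ee_def)
qed

lemma curv_detE_ext_deriv:
  "is_curv_detE A \<omega> \<Gamma> B \<iota> k D F \<Longrightarrow> is_ext_deriv B D V (\<lambda>y v. fr.tauE (xc y) (toB y v)) F"
  using coord_nbhd_V E10_frame detE_connection unfolding is_curv_detE_def by blast

lemma curv_KY_ext_deriv:
  "is_curv_KY A \<omega> \<Gamma> B \<iota> k D F \<Longrightarrow> is_ext_deriv B D V (\<lambda>y v. - fr.tauN (xc y) (toB y v)) F"
  using coord_nbhd_V N10_frame KY_connection unfolding is_curv_KY_def by blast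

text \<open>With \<open>u\<close> and \<open>v\<close> extended by constant coordinates, both
  curvatures are values of \<open>extd\<close> at \<open>y\<close>, and their difference is
  \<open>extd\<close> of the full trace.\<close>

lemma curvature_difference:
  assumes "ricci_form A \<omega> \<Gamma> \<rho>" and y: "y \<in> V" "\<iota> y = q" "y = r"
    and E: "is_curv_detE A \<omega> \<Gamma> B \<iota> k (\<lambda>_. UNIV) curvE" and K: "is_curv_KY A \<omega> \<Gamma> B \<iota> k (\<lambda>_. UNIV) curvK"
  shows "curvE y u v - curvK y u v = \<i> * complex_of_real (\<rho> (\<iota> y) (push A B \<iota> y u) (push A B \<iota> y v))"
proof -
  let ?U = "\<lambda>_. u :: 'f" and ?W = "\<lambda>_. v :: 'f"
  have lift: "lift (\<lambda>_. u) y = u" for u using y by (simp add: lift_def)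
  have "curvE y (lift ?U y) (lift ?W y) = fr.extd fr.tauE ?U ?W (xc y)"
    by (rule ext_deriv_chart[OF curv_detE_ext_deriv[OF E]]) (auto intro: smooth_on_const y)
  moreover have "curvK y (lift ?U y) (lift ?W y) = fr.extd (\<lambda>x v. - fr.tauN x v) ?U ?W (xc y)"
    by (rule ext_deriv_chart[OF curv_KY_ext_deriv[OF K]]) (auto intro: smooth_on_const y)
  moreover have "fr.extd fr.tau ?U ?W (xc y) = \<i> * complex_of_real (\<rho> (\<iota> y) (push A B \<iota> y u) (push A B \<iota> y v))"
    unfolding fr.extd_tau[OF smooth_on_const smooth_on_const VD(2)[OF y(1)]]
    by (rule ricci_trace_chart[OF assms(1) y])
  ultimately show ?thesis
    by (simp add: lift fr.extd_split[OF smooth_on_const smooth_on_const VD(2)[OF y(1)]])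
qed

text \<open>In the splitting of \<open>extd tau\<close>, the full trace gives the Ricci term and the
  \<open>tauN\<close> part the curvature of \<open>K\<^sub>Y\<close>; along the leaves
  \<open>extd tauE\<close> is \<open>- \<i>\<close> times \<open>d\<alpha>\<close>.\<close>

lemma leafwise_curvature:
  assumes "ricci_form A \<omega> \<Gamma> \<rho>" and y: "y \<in> V" "\<iota> y = q" "y = r"
    and K: "is_curv_KY A \<omega> \<Gamma> B \<iota> k (leaf_dir A \<omega> B \<iota>) curvK"
    and SH: "is_second_fundamental_form A \<omega> \<Gamma> B \<iota> S" "is_leafwise_mean_curvature A \<omega> B \<iota> k S H"
    and d\<alpha>: "is_ext_deriv B (leaf_dir A \<omega> B \<iota>) UNIV (mean_curvature_form A \<omega> B \<iota> H) d\<alpha>"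
    and u: "u \<in> leaf_dir A \<omega> B \<iota> y" and v: "v \<in> leaf_dir A \<omega> B \<iota> y"
  shows "- curvK y u v = \<i> * complex_of_real (d\<alpha> y u v)
    + \<i> * complex_of_real (\<rho> (\<iota> y) (push A B \<iota> y u) (push A B \<iota> y v))"
proof -
  obtain U where U: "smooth_on T U" "\<And>y. y \<in> V \<Longrightarrow> lift U y \<in> leaf_dir A \<omega> B \<iota> y" "lift U y = u"
    by (rule leaf_field[OF y(1) u]) (rule that)
  obtain W where W: "smooth_on T W" "\<And>y. y \<in> V \<Longrightarrow> lift W y \<in> leaf_dir A \<omega> B \<iota> y" "lift W y = v"
    by (rule leaf_field[OF y(1) v]) (rule that)
  \<comment> \<open>The mean curvature form in coordinates. In leaf directions it equals
    \<open>\<i> * tauE\<close>; in other directions no relation is claimed.\<close>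
  define a where "a x v = mean_curvature_form A \<omega> B \<iota> H (chart_inv B r x) (fromB (chart_inv B r x) v)" for x v
  have tf: "dphi x (Z x) \<in> chart.tf x" if "\<And>y. y \<in> V \<Longrightarrow> lift Z y \<in> leaf_dir A \<omega> B \<iota> y" "x \<in> T" for Z x
    using that(1)[OF inv_T(1)[OF that(2)]] leaf_dir_iff[OF VD(1)[OF inv_T(1)[OF that(2)]]] inv_T[OF that(2)]
    by (simp add: lift_def VD)
  have a: "fr.tauE x v = - \<i> * of_real (a x v)" if "x \<in> T" "dphi x v \<in> chart.tf x" for x v
  proof -
    note i = inv_T[OF that(1)]
    have "fromB (chart_inv B r x) v \<in> leaf_dir A \<omega> B \<iota> (chart_inv B r x)"
      using that i by (simp add: leaf_dir_iff VD)
    from tauE_mean_curvature[OF SH i(1) this] show ?thesis using i by (simp add: a_def VD)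
  qed
  have "curvK y (lift U y) (lift W y) = fr.extd (\<lambda>x v. - fr.tauN x v) U W (xc y)"
    by (rule ext_deriv_chart[OF curv_KY_ext_deriv[OF K]]) (auto intro: U W y)
  moreover have "d\<alpha> y (lift U y) (lift W y) = fr.extd a U W (xc y)"
    by (rule ext_deriv_chart[OF d\<alpha>]) (auto intro: U W y simp: a_def VD)
  moreover have "fr.extd fr.tauE U W (xc y) = - \<i> * of_real (fr.extd a U W (xc y))"
    by (rule fr.extd_leafwise[OF U(1) W(1) VD(2)[OF y(1)] tf[OF U(2)] tf[OF W(2)] a])
  moreover have "fr.extd fr.tau U W (xc y) = \<i> * complex_of_real (\<rho> (\<iota> y) (push A B \<iota> y u) (push A B \<iota> y v))"
  proof -
    have "U (xc y) = u" "W (xc y) = v" using U(3) W(3) y by (simp_all add: lift_def)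
    then show ?thesis
      unfolding fr.extd_tau[OF U(1) W(1) VD(2)[OF y(1)]] by (simp only: ricci_trace_chart[OF assms(1) y])
  qed
  ultimately have "\<i> * complex_of_real (\<rho> (\<iota> y) (push A B \<iota> y u) (push A B \<iota> y v))
      = - \<i> * of_real (d\<alpha> y u v) - curvK y u v"
    using fr.extd_split[OF U(1) W(1) VD(2)[OF y(1)]] U(3) W(3) by simp
  then show ?thesis by simp
qed

end

text \<open>Both charts are centred, at \<open>\<iota> y\<close> and at \<open>y\<close>, as the
  pointwise comparison with the Ricci form requires.\<close>

lemma (in coisotropic_submanifold) submanifold_frame_exists:
  "\<exists>T e l. submanifold_frame A \<omega> \<Gamma> B \<iota> k (\<iota> y) y T e l \<and> y \<in> submanifold_frame.V A B \<iota> (\<iota> y) y T"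
proof -
  interpret submanifold_chart A \<omega> \<Gamma> B \<iota> k "\<iota> y" y by unfold_locales
  have y: "y \<in> cdom" by (simp add: cdom_def B.chart_center chart_center)
  obtain T e l where T: "xc y \<in> T" "T \<subseteq> cimg" "adapted_frame T met chr dphi k e l"
    using chart.adapted_frame_exists[OF cimgI[OF y]] by blast
  interpret submanifold_frame A \<omega> \<Gamma> B \<iota> k "\<iota> y" y T e l
    by (intro submanifold_frame.intro submanifold_frame_axioms.intro submanifold_chart_axioms T)
  show ?thesis by (intro exI conjI, rule submanifold_frame_axioms) (simp add: V_def T y)
qed

theorem theorem6p2:
  fixes A :: "('x::{t2_space,second_countable_topology}, complex ^ 'n::finite) atlas"
    and B :: "('y::{t2_space,second_countable_topology}, 'f::euclidean_space) atlas"
    and \<omega> \<rho> :: "'x \<Rightarrow> complex ^ 'n \<Rightarrow> complex ^ 'n \<Rightarrow> real"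
    and \<Gamma> :: "('x, complex ^ 'n) christoffel"
    and \<iota> :: "'y \<Rightarrow> 'x" and k :: nat
    and curvE curvK curvK_leaf :: "'y \<Rightarrow> 'f \<Rightarrow> 'f \<Rightarrow> complex"
    and S :: "'y \<Rightarrow> 'f \<Rightarrow> 'f \<Rightarrow> complex ^ 'n"
    and H :: "'y \<Rightarrow> complex ^ 'n"
    and d\<alpha> :: "'y \<Rightarrow> 'f \<Rightarrow> 'f \<Rightarrow> real"
  assumes "kaehler A \<omega>"
    and "levi_civita A (kmetric \<omega>) \<Gamma>"
    and "embedded_submanifold A B \<iota>"
    and "coisotropic A \<omega> B \<iota>"
    and "DIM('f) = CARD('n) + k"
    and "ricci_form A \<omega> \<Gamma> \<rho>"
    and "is_curv_detE A \<omega> \<Gamma> B \<iota> k (\<lambda>_. UNIV) curvE"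
    and "is_curv_KY A \<omega> \<Gamma> B \<iota> k (\<lambda>_. UNIV) curvK"
    and "is_curv_KY A \<omega> \<Gamma> B \<iota> k (leaf_dir A \<omega> B \<iota>) curvK_leaf"
    and "is_second_fundamental_form A \<omega> \<Gamma> B \<iota> S"
    and "is_leafwise_mean_curvature A \<omega> B \<iota> k S H"
    and "is_ext_deriv B (leaf_dir A \<omega> B \<iota>) UNIV (mean_curvature_form A \<omega> B \<iota> H) d\<alpha>"
  shows "(\<forall>y u v. - curvK y u v =
            - curvE y u v + \<i> * complex_of_real (\<rho> (\<iota> y) (push A B \<iota> y u) (push A B \<iota> y v))) \<and>
         (\<forall>y. \<forall>u \<in> leaf_dir A \<omega> B \<iota> y. \<forall>v \<in> leaf_dir A \<omega> B \<iota> y. - curvK_leaf y u v =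
            \<i> * complex_of_real (d\<alpha> y u v)
            + \<i> * complex_of_real (\<rho> (\<iota> y) (push A B \<iota> y u) (push A B \<iota> y v))) \<and>
         (\<forall>y u v. - curvK y u v + curvE y u v =
            \<i> * complex_of_real (\<rho> (\<iota> y) (push A B \<iota> y u) (push A B \<iota> y v))) \<and>
         (\<forall>y. \<forall>u \<in> leaf_dir A \<omega> B \<iota> y. \<forall>v \<in> leaf_dir A \<omega> B \<iota> y.
            - curvK_leaf y u v - \<i> * complex_of_real (d\<alpha> y u v) =
            \<i> * complex_of_real (\<rho> (\<iota> y) (push A B \<iota> y u) (push A B \<iota> y v)))"
proof -
  interpret coisotropic_submanifold A \<omega> \<Gamma> B \<iota> k
    by unfold_locales (use assms in auto)
  \<comment> \<open>\<open>diff\<close> yields the first and third conclusions and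
    \<open>leaf\<close> the other two, by rearrangement.\<close>
  have diff: "curvE y u v - curvK y u v = \<i> * complex_of_real (\<rho> (\<iota> y) (push A B \<iota> y u) (push A B \<iota> y v))" for y u v
  proof -
    obtain T e l where "submanifold_frame A \<omega> \<Gamma> B \<iota> k (\<iota> y) y T e l" "y \<in> submanifold_frame.V A B \<iota> (\<iota> y) y T"
      using submanifold_frame_exists by blast
    then show ?thesis
      using submanifold_frame.curvature_difference[OF _ assms(6) _ refl refl assms(7,8)] by blast
  qed
  have leaf: "- curvK_leaf y u v = \<i> * complex_of_real (d\<alpha> y u v)
      + \<i> * complex_of_real (\<rho> (\<iota> y) (push A B \<iota> y u) (push A B \<iota> y v))"
    if "u \<in> leaf_dir A \<omega> B \<iota> y" "v \<in> leaf_dir A \<omega> B \<iota> y" for y u v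
  proof -
    obtain T e l where "submanifold_frame A \<omega> \<Gamma> B \<iota> k (\<iota> y) y T e l" "y \<in> submanifold_frame.V A B \<iota> (\<iota> y) y T"
      using submanifold_frame_exists by blast
    then show ?thesis
      using submanifold_frame.leafwise_curvature[OF _ assms(6) _ refl refl assms(9-12) that] by blast
  qed
  show ?thesis
    by (intro conjI allI ballI) (simp_all add: leaf diff[symmetric])
qed

end
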